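(* Let $x,y,z$ be non-negative integers. (i) For all non-negative integers $a,b$, $$M(H^{(3)}_{x,y,z}(a,b))=\frac{P'_{y,y+2a,b}\,P'_{z+b,z+b,a}\,Q'(a,b,x,y+z)}{P'_{y+z+b,y+z+b,a}}\cdot\frac{T(x+b+1,y+a-1,a)\,T(x+z+a+b+1,y+a-1,a)\,T(2a+b+1,y+b-1,b)\,T(z+1,y+b-1,b)}{T(b+1,y+a-1,a)\,T(z+a+b+1,y+a-1,a)\,T(x+2a+b+1,y+b-1,b)\,T(x+z+1,y+b-1,b)}.$$ (ii) For every $k\ge 2$ and every sequence $\mathbf a=(a_1,\dots,a_{2k})$ of non-negative integers, write $\mathrm O=\mathrm O(\mathbf a)$, $\mathrm E=\mathrm E(\mathbf a)$, $e_i=e_i(\mathbf a)$, $o_i=o_i(\mathbf a)$, $\sigma_i=s_{2i-1}(\mathbf a)+s_{2k}(\mathbf a)$ and $T_i(u)=T(u,\,a_{2i-2}+o_i-1,\,o_i)$. Then $$M(H^{(3)}_{x,y,z}(a_1,\dots,a_{2k}))=2^{a_1}M(H^{(3)}_{x,y,z}(\mathrm O,\mathrm E))\,\frac{Q'(0,a_1,\dots,a_{2k},y)\,Q'(a_1,\dots,a_{2k-1},a_{2k}+z)}{P'_{y,y+2\mathrm O,\mathrm E}\,P'_{z+\mathrm E,z+\mathrm E,\mathrm O}}$$ $$\times\prod_{i=2}^{k}\frac{T_i(x+z+e_i+1)\,T_i(y+e_i+1)}{T_i(x+y+e_i+1)\,T_i(z+e_i+1)}\cdot\frac{T_i(x+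y+\sigma_i+1)\,T_i(z+\sigma_i+1)}{T_i(x+z+\sigma_i+1)\,T_i(y+\sigma_i+1)}.$$
   Context: Geometry. Work on the triangular lattice with unit equilateral triangles and horizontal lattice lines; consecutive horizontal lattice lines are one level apart. East, west, NE, NW, SE, SW denote the six unit lattice steps. An up-pointing (down-pointing) triangle has a horizontal bottom (top) side. A lozenge is the union of two unit triangles sharing an edge; it is vertical if the shared edge is horizontal. A tiling of a region (finite union of unit triangles) is a covering by lozenges without gaps or overlaps. Lozenges may carry weights (weight 1 unless stated otherwise); the weight of a tiling is the product of the weights of its lozenges, and $M(R)$ is the sum of the weights of all tilings of $R$. Polygons are described by their boundary path, starting at the upper-left corner and going counterclockwise; $(\mathrm{SW},\mathrm{SE})^m$ means the two steps repeated $m$ times. Numbers $P'$. For $0\le a\le b$, $c\ge0$, take the polygon with boundary $(\mathrm{SW},\mathrm{SE})^{a}$, then $b-a$ steps SE, $c$ steps east, $a$ steps NE, $b$ steps NW, $c$ steps west, and give weight $\frac12$ to each vertical lozenge whose two left sides both lie on the zigzag part $(\mathrm{SW},\mathrm{SE})^a$ of the boundary. $P'_{a,b,c}$ is the weighted tiling number $M$ of this region. Sequences. For a finite sequence $\mathbf t=(t_1,t_2,\dots)$ of non-negative integers: $\mathrm O(\mathbf t)=\sum_{i\text{ odd}}t_i$, $\mathrm E(\mathbf t)=\sum_{i\text{ even}}t_i$, $s_m(\mathbf t)=\sum_{i=1}^m t_i$, $o_m(\mathbf t)=\sum_{i\ge m}t_{2i-1}$, $e_m(\mathbf t)=\sum_{i\ge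 m}t_{2i}$. Numbers $Q'$. For $\mathbf t=(t_1,\dots,t_{2l})$ take the polygon with boundary $(\mathrm{SW},\mathrm{SE})^{\mathrm E(\mathbf t)}$, then $\mathrm E(\mathbf t)+\mathrm O(\mathbf t)$ steps east, $2\mathrm E(\mathbf t)$ steps NW, $\mathrm O(\mathbf t)$ steps west. Divide its bottom side from left to right into segments of lengths $t_1,\dots,t_{2l}$, and for each $i$ remove the up-pointing triangle of side $t_{2i}$ whose bottom side is the $2i$-th segment (intersected with the polygon). Give weight $\frac12$ to each vertical lozenge whose two left sides both lie on the western zigzag. $Q'(\mathbf t)$ is the weighted tiling number of the resulting region. Region $H^{(3)}_{x,y,z}(a_1,\dots,a_k)$. With $\mathrm O=\mathrm O(\mathbf a)$, $\mathrm E=\mathrm E(\mathbf a)$, take the polygon with boundary $(\mathrm{SW},\mathrm{SE})^{y+z+\mathrm E+\mathrm O}$, then $x+\mathrm O$ steps east, $y+z+2\mathrm E$ steps NE, $y+z+2\mathrm O$ steps NW, $x+\mathrm E$ steps west. Let $L$ be the horizontal lattice line $2z+2\mathrm E$ levels above the bottom side; starting at the leftmost point of the polygon on $L$, mark on $L$ from left to right consecutive segments of lengths $a_1,\dots,a_k$. Remove: for $i=1$, the part of the polygon above $L$ and to the left of the line going from the right endpoint of the first segment in direction NW (the right half of an up-pointing triangle of side $2a_1$); for odd $i\ge3$, the up-pointing triangle of side $a_i$ whose bottom side is the $i$-th segment; for even $i$, the down-pointing triangle of side $a_i$ whose top side is the $i$-th segment. Give weight $\frac12$ to each vertical lozenge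 whose two left sides both lie on the western zigzag. Products. $(u)_n=u(u+1)\cdots(u+n-1)$ for $n>0$, $(u)_0=1$, $(u)_n=\frac1{(u-1)(u-2)\cdots(u+n)}$ for $n<0$; $T(u,n,m)=\prod_{i=0}^{m-1}(u+i)_{n-2i}$ (empty product $=1$).
   Formalization: In (ii), σ_i is taken as s_{2i-3}(a)+s_{2k}(a) instead of the printed s_{2i-1}(a)+s_{2k}(a); the printed formula fails, e.g. for k=2, (x,y,z)=(1,0,1), a=(0,1,1,0), where it gives 81/16 but the weighted tiling number is 21/4. *)

theory Defs
  imports Complex_Main "HOL-Library.Disjoint_Sets"
begin

section \<open>The triangular lattice\<close>

text \<open>
  The pair \<open>(p, q)\<close> stands for the lattice point obtained from the origin by \<open>p\<close> unit steps
  east and \<open>q\<close> unit steps NE.  Thus \<open>q\<close> is the level, and the Cartesian abscissa is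
  \<open>p + q / 2\<close>.
\<close>

type_synonym point = "int \<times> int"

datatype step = East | West | NE | NW | SE | SW

fun move :: "step \<Rightarrow> point \<Rightarrow> point" where
  "move East (p, q) = (p + 1, q)"
| "move West (p, q) = (p - 1, q)"
| "move NE (p, q) = (p, q + 1)"
| "move NW (p, q) = (p - 1, q + 1)"
| "move SE (p, q) = (p + 1, q - 1)"
| "move SW (p, q) = (p, q - 1)"

text \<open>
  \<open>Up v\<close> and \<open>Down v\<close> are the two unit triangles that share the horizontal edge from \<open>v\<close> to
  its eastern neighbour: \<open>Up v\<close> has it as its bottom side, \<open>Down v\<close> as its top side.
\<close>

datatype tri = Up point | Down point

fun vertices :: "tri \<Rightarrow> point set" where
  "vertices (Up v) = {v, move East v, move NE v}"
| "vertices (Down v) = {v, move East v, move SE v}"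

definition lozenge :: "tri set \<Rightarrow> bool" where
  "lozenge l \<longleftrightarrow> (\<exists>s t. l = {s, t} \<and> card (vertices s \<inter> vertices t) = 2)"

definition tilings :: "tri set \<Rightarrow> tri set set set" where
  "tilings R = {\<T>. partition_on R \<T> \<and> (\<forall>l\<in>\<T>. lozenge l)}"

definition M :: "(tri set \<Rightarrow> real) \<Rightarrow> tri set \<Rightarrow> real" where
  "M wt R = (\<Sum>\<T>\<in>tilings R. \<Prod>l\<in>\<T>. wt l)"

section \<open>Regions given by boundary paths\<close>

fun edges :: "point \<Rightarrow> step list \<Rightarrow> (point \<times> point) list" where
  "edges v [] = []"
| "edges v (s # ss) = (v, move s v) # edges (move s v) ss"

text \<open>
  A unit triangle is enclosed by a closed lattice path if the path winds around it once
  counterclockwise.  The winding number is computed along the ray that runs from the interior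
  of the triangle to the west, half-way between the two levels bounding the triangle: an edge
  crossing that ray downwards counts \<open>1\<close>, one crossing it upwards counts \<open>-1\<close>.
  With \<open>twice_x\<close> twice the Cartesian abscissa, the crossed edge \<open>(v, w)\<close> meets the ray at
  abscissa \<open>(twice_x v + twice_x w) / 4\<close>, and both \<open>Up u\<close> and \<open>Down u\<close> are centred
  at abscissa \<open>(twice_x u + 1) / 2\<close>.
\<close>

fun twice_x :: "point \<Rightarrow> int" where
  "twice_x (p, q) = 2 * p + q"

fun anchor :: "tri \<Rightarrow> point" where
  "anchor (Up u) = u"
| "anchor (Down u) = u"

fun lower_level :: "tri \<Rightarrow> int" where
  "lower_level (Up u) = snd u"
| "lower_level (Down u) = snd u - 1"

definition crossing :: "tri \<Rightarrow> point \<times> point \<Rightarrow> int" where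
  "crossing t = (\<lambda>(v, w).
     if twice_x v + twice_x w < 2 * (twice_x (anchor t) + 1) then
       (if snd v = lower_level t + 1 \<and> snd w = lower_level t then 1
        else if snd v = lower_level t \<and> snd w = lower_level t + 1 then - 1
        else 0)
     else 0)"

definition enclosed :: "point \<Rightarrow> step list \<Rightarrow> tri set" where
  "enclosed v ss = {t. (\<Sum>e\<leftarrow>edges v ss. crossing t e) = 1}"

text \<open>Polygons have their upper-left corner, the starting point of the path, at the origin.\<close>

definition polygon :: "step list \<Rightarrow> tri set" where
  "polygon ss = enclosed (0, 0) ss"

text \<open>Triangle of side \<open>n\<close> whose bottom (top) side is the segment of length \<open>n\<close>
  starting at \<open>v\<close> and going east.\<close>

definition up_triangle :: "point \<Rightarrow> nat \<Rightarrow> tri set" where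
  "up_triangle v n = enclosed v (replicate n East @ replicate n NW @ replicate n SW)"

definition down_triangle :: "point \<Rightarrow> nat \<Rightarrow> tri set" where
  "down_triangle v n = enclosed v (replicate n SE @ replicate n NE @ replicate n West)"

definition zigzag :: "nat \<Rightarrow> step list" where
  "zigzag m = concat (replicate m [SW, SE])"

text \<open>
  The weight of a lozenge when the zigzag \<open>(SW, SE)\<^sup>m\<close> starts at the origin.  The vertical
  lozenge \<open>{Up v, Down v}\<close> has left vertex \<open>v\<close>; its left sides join \<open>v\<close> to its NE and
  SE neighbours, and the zigzag, running downwards, traverses them as below.
\<close>

definition zigzag_weight :: "nat \<Rightarrow> tri set \<Rightarrow> real" where
  "zigzag_weight m l =
     (if \<exists>v. l = {Up v, Down v} \<and>
             (move NE v, v) \<in> set (edges (0, 0) (zigzag m)) \<and>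
             (v, move SE v) \<in> set (edges (0, 0) (zigzag m))
      then 1 / 2 else 1)"

section \<open>Finite sequences\<close>

text \<open>Sequences are lists, but their entries are numbered from \<open>1\<close>.\<close>

definition entry :: "nat list \<Rightarrow> nat \<Rightarrow> nat" where
  "entry t i = (if 1 \<le> i \<and> i \<le> length t then t ! (i - 1) else 0)"

definition odd_sum :: "nat list \<Rightarrow> nat" where
  "odd_sum t = (\<Sum>i | i \<in> {1..length t} \<and> odd i. entry t i)"

definition even_sum :: "nat list \<Rightarrow> nat" where
  "even_sum t = (\<Sum>i | i \<in> {1..length t} \<and> even i. entry t i)"

definition s_sum :: "nat \<Rightarrow> nat list \<Rightarrow> nat" where
  "s_sum m t = (\<Sum>i=1..m. entry t i)"

text \<open>In the next two sums all indices beyond \<open>length t\<close> contribute \<open>0\<close>.\<close>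

definition o_sum :: "nat \<Rightarrow> nat list \<Rightarrow> nat" where
  "o_sum m t = (\<Sum>i=m..length t. entry t (2 * i - 1))"

definition e_sum :: "nat \<Rightarrow> nat list \<Rightarrow> nat" where
  "e_sum m t = (\<Sum>i=m..length t. entry t (2 * i))"

section \<open>The weighted tiling numbers\<close>

text \<open>The number \<open>P'\<^bsub>a,b,c\<^esub>\<close>, meant for \<open>a \<le> b\<close>.\<close>

definition P_num :: "nat \<Rightarrow> nat \<Rightarrow> nat \<Rightarrow> real" where
  "P_num a b c = M (zigzag_weight a)
     (polygon (zigzag a @ replicate (b - a) SE @ replicate c East @ replicate a NE
               @ replicate b NW @ replicate c West))"

text \<open>For \<open>Q'(t)\<close>, the left end of the bottom side is \<open>(E, - 2 * E)\<close>, where \<open>E = even_sum t\<close>.\<close>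

definition Q_region :: "nat list \<Rightarrow> tri set" where
  "Q_region t = (let Od = odd_sum t; Ev = even_sum t in
     polygon (zigzag Ev @ replicate (Ev + Od) East @ replicate (2 * Ev) NW @ replicate Od West)
     - (\<Union>i \<in> {i \<in> {1..length t}. even i}.
          up_triangle (int Ev + int (s_sum (i - 1) t), - 2 * int Ev) (entry t i)))"

definition Q_num :: "nat list \<Rightarrow> real" where
  "Q_num t = M (zigzag_weight (even_sum t)) (Q_region t)"

text \<open>
  The region \<open>H\<^sup>(\<^sup>3\<^sup>)\<close>.  The bottom side is \<open>2 * (y + z + Ev + Od)\<close> levels below the origin,
  so the line \<open>L\<close> at height \<open>2 * z + 2 * Ev\<close> above it is at level \<open>- 2 * m\<close> with
  \<open>m = y + Od\<close>.  The zigzag meets \<open>L\<close> only in the end point \<open>(m, - 2 * m)\<close> of its first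
  \<open>m\<close> periods, which is therefore the leftmost point of the polygon on \<open>L\<close>.
  The line going NW from the right end of the first segment consists of the points
  \<open>(p, q)\<close> with \<open>p + q = - m + entry a 1\<close>.
\<close>

definition H3_region :: "nat \<Rightarrow> nat \<Rightarrow> nat \<Rightarrow> nat list \<Rightarrow> tri set" where
  "H3_region x y z a = (let Od = odd_sum a; Ev = even_sum a; m = int (y + Od) in
     polygon (zigzag (y + z + Ev + Od) @ replicate (x + Od) East
              @ replicate (y + z + 2 * Ev) NE @ replicate (y + z + 2 * Od) NW
              @ replicate (x + Ev) West)
     - {t. \<forall>(p, q) \<in> vertices t. - 2 * m \<le> q \<and> p + q \<le> - m + int (entry a 1)}
     - (\<Union>i \<in> {i \<in> {3..length a}. odd i}.
          up_triangle (m + int (s_sum (i - 1) a), - 2 * m) (entry a i))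
     - (\<Union>i \<in> {i \<in> {1..length a}. even i}.
          down_triangle (m + int (s_sum (i - 1) a), - 2 * m) (entry a i)))"

definition M_H3 :: "nat \<Rightarrow> nat \<Rightarrow> nat \<Rightarrow> nat list \<Rightarrow> real" where
  "M_H3 x y z a =
     M (zigzag_weight (y + z + even_sum a + odd_sum a)) (H3_region x y z a)"

section \<open>Products\<close>

text \<open>The symbol \<open>(u)\<^sub>n\<close> for an arbitrary integer \<open>n\<close>.\<close>

definition poch :: "real \<Rightarrow> int \<Rightarrow> real" where
  "poch u n = (if 0 \<le> n then pochhammer u (nat n)
               else 1 / (\<Prod>j=1..nat (- n). u - real j))"

definition T_prod :: "real \<Rightarrow> int \<Rightarrow> nat \<Rightarrow> real" where
  "T_prod u n m = (\<Prod>i<m. poch (u + real i) (n - 2 * int i))"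

definition T_seq :: "nat list \<Rightarrow> nat \<Rightarrow> nat \<Rightarrow> real" where
  "T_seq a i u =
     T_prod (real u) (int (entry a (2 * i - 2)) + int (o_sum i a) - 1) (o_sum i a)"

text \<open>
  Correction of a misprint: the source has \<open>s_sum (2 * i - 1) a + s_sum (2 * k) a\<close> here, for
  a sequence \<open>a\<close> of length \<open>2 * k\<close>.  With that the factorization it is used for fails, for
  instance for \<open>x = z = 1\<close>, \<open>y = 0\<close>, \<open>a = [0, 1, 1, 0]\<close>: the weighted tiling number
  of the region is \<open>21/4\<close>, but the formula would give \<open>81/16\<close>.
\<close>

definition sigma :: "nat list \<Rightarrow> nat \<Rightarrow> nat" where
  "sigma a i = s_sum (2 * i - 3) a + s_sum (length a) a"

end

theory Submission
  imports Defs "Jordan_Normal_Form.Determinant" "HOL-Computational_Algebra.Formal_Power_Series"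
begin

text \<open>
  A unit triangle between the levels \<open>q\<close> and \<open>q + 1\<close> whose centre has abscissa \<open>c / 2\<close> is encoded as
  the cell \<open>(q, c)\<close>.  Lozenges then are pairs of neighbouring cells of one strip \<open>q\<close>, or (the vertical
  lozenges) pairs \<open>{(q, c), (q - 1, c)}\<close> with \<open>c - q\<close> odd, and the lozenges of weight 1/2 at the western
  zigzag are exactly the vertical ones with \<open>c = 0\<close>.  So all tiling numbers are weighted matching numbers \<open>W\<close>.

  The matching numbers are computed by cutting along horizontal lattice lines (\<open>W_level_cut\<close>).  A
  strip admits at most one matching, and only if the vertical lozenges below it interlace
  those above it (\<open>strip_sum\<close>).  For the trapezoid \<open>trap k t\<close>, the polygon of the numbers \<open>Q'\<close>, with
  up-pointing unit triangles removed at the positions \<open>S\<close> of the bottom row, the iterated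
  interlacing sums are determinants: binomial coefficients in central form are
  each other's central differences, so that each summation telescopes and turns one determinant into the
  next (\<open>sum_odd_det\<close>, \<open>sum_even_det\<close>); the weight 1/2 at the wall is what
  makes the first row telescope too.  The final determinant is a Vandermonde determinant in the
  squares \<open>(d - 1 / 2)\<^sup>2\<close>, and the number is a constant times
  \<open>V S = (\<Prod>d\<in>S. d - 1 / 2) * (\<Prod>d<e. (e - d) * (e + d - 1))\<close> (\<open>trap_W_det\<close>, \<open>trap_dents\<close>).
  A removed triangle whose bottom side lies on the bottom of the trapezoid has the same effect as the
  dents along its bottom side, since the dents force the lozenges above them (\<open>W_fill\<close>); at the wall a
  removed half triangle of side \<open>2 * a\<close> moreover gives the factor \<open>2 ^ a\<close>.  This evaluates \<open>P'\<close> and \<open>Q'\<close>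
  (\<open>P_num_eq\<close>, \<open>Q_num_eq\<close>).

  Cutting the region \<open>H\<close> along the line \<open>L\<close> gives two such trapezoids, the lower one upside down, and
  the tiling number is a sum over the set \<open>S\<close> of positions of the vertical lozenges that
  cross \<open>L\<close> (\<open>M_H3_eq\<close>).  As \<open>V\<close> is multiplicative up to the interaction \<open>link\<close>, the set \<open>A\<close> of positions
  of odd segments, which are dents of the upper half, and the set \<open>B\<close> for the even segments enter the
  terms only through \<open>A \<union> B\<close>, an initial segment \<open>{1..n}\<close>.  The
  sum over \<open>S\<close> thus splits off as the factor \<open>racah_selberg\<close>, which does not depend on how \<open>{1..n}\<close> is split
  into \<open>A\<close> and \<open>B\<close> (\<open>selberg_reduction\<close>).

  For part (ii) this factor cancels in the quotient of the tiling numbers for \<open>\<^bold>a\<close> and for \<open>(O, E)\<close>,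
  and \<open>Q'\<close> and \<open>P'\<close> supply the other parts of the quotient except for a product of the functions
  \<open>K\<close> of the set \<open>A\<close> (\<open>V_exchange\<close>).  Shifting the odd segments together one after the other changes
  \<open>K\<close> by quotients of the products \<open>T\<close> (\<open>K_fern_odd\<close>).

  For part (i) the sum itself is needed.  It is a discrete Selberg sum for a weight on the quadratic
  lattice \<open>(s - 1 / 2)\<^sup>2\<close>.  The Andreief identity makes it a determinant of single sums; these
  satisfy a contiguity relation and have a closed form with one binomial coefficient
  (\<open>racah_mass_closed\<close>), and the determinant of these coefficients factors (\<open>racah_selberg_product\<close>).
  In terms of superfactorials the claim then becomes an identity between two products of the same factors
  (\<open>H3_two_fern\<close>).
\<close>


section \<open>Weighted matchings of cells\<close>

text \<open>
  The cell \<open>(q, c)\<close> is the unit triangle between the levels \<open>q\<close> and \<open>q + 1\<close> whose centre has abscissa \<open>c / 2\<close>.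
  It points up if and only if \<open>c - q\<close> is odd.
\<close>

type_synonym node = "int \<times> int"

text \<open>
  The cells of two triangles with a common slanted side, or with a common horizontal side at level \<open>q\<close>.
\<close>

definition adjacent_pair :: "node set \<Rightarrow> bool" where
  "adjacent_pair l \<longleftrightarrow>
     (\<exists>q c. l = {(q, c), (q, c + 1)}) \<or> (\<exists>q c. odd (c - q) \<and> l = {(q, c), (q - 1, c)})"

text \<open>
  The wall is the line \<open>c = 0\<close>.  Only vertical lozenges centred on it have weight 1/2; when a region extends
  beyond a zigzag, the weight has to be compared with the original one (\<open>zigzag_weight_eq\<close> below).
\<close>

definition wall_weight :: "node set \<Rightarrow> real" where
  "wall_weight l = (if \<exists>q. l = {(q, 0), (q - 1, 0)} then 1 / 2 else 1)"

definition matchings :: "node set \<Rightarrow> node set set set" where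
  "matchings R = {T. partition_on R T \<and> (\<forall>l\<in>T. adjacent_pair l)}"

text \<open>
  The weighted number of perfect matchings of a set of cells by adjacent pairs.
\<close>

definition W :: "node set \<Rightarrow> real" where
  "W R = (\<Sum>T\<in>matchings R. \<Prod>l\<in>T. wall_weight l)"

lemma finite_matchings: "finite R \<Longrightarrow> finite (matchings R)"
proof -
  assume f: "finite R"
  have "matchings R \<subseteq> Pow (Pow R)" by (auto simp: matchings_def partition_on_def)
  then show ?thesis using f by (meson finite_Pow_iff finite_subset)
qed

lemma finite_matching: "finite R \<Longrightarrow> T \<in> matchings R \<Longrightarrow> finite T"
  by (auto simp: matchings_def dest: finite_elements)

lemma matchings_empty [simp]: "matchings {} = {{}}"
  by (auto simp: matchings_def partition_on_def)

lemma W_empty [simp]: "W {} = 1"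
  by (simp add: W_def)

text \<open>
  The possible pairs of a matching of \<open>A \<union> B\<close> that have one cell in \<open>A\<close> and one in \<open>B\<close> (for disjoint
  \<open>A\<close> and \<open>B\<close>).
\<close>

definition cross :: "node set \<Rightarrow> node set \<Rightarrow> node set set" where
  "cross A B = {l. adjacent_pair l \<and> l \<subseteq> A \<union> B \<and> l \<inter> A \<noteq> {} \<and> l \<inter> B \<noteq> {}}"

lemma finite_cross: "finite A \<Longrightarrow> finite B \<Longrightarrow> finite (cross A B)"
  by (rule finite_subset[of _ "Pow (A \<union> B)"]) (auto simp: cross_def)

lemma adjacent_pair_nonempty: "adjacent_pair l \<Longrightarrow> l \<noteq> {}"
  by (auto simp: adjacent_pair_def)

lemma matchings_Un_glue:
  assumes V: "V \<subseteq> cross A B" "disjoint V"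
    and T1: "T1 \<in> matchings (A - \<Union>V)" and T2: "T2 \<in> matchings (B - \<Union>V)" and AB: "A \<inter> B = {}"
  shows "V \<union> T1 \<union> T2 \<in> matchings (A \<union> B)"
    "{l \<in> V \<union> T1 \<union> T2. l \<in> cross A B} = V"
    "{l \<in> V \<union> T1 \<union> T2. l \<subseteq> A} = T1" "{l \<in> V \<union> T1 \<union> T2. l \<subseteq> B} = T2"
    "V \<inter> T1 = {}" "V \<inter> T2 = {}" "T1 \<inter> T2 = {}"
proof -
  have t1: "\<Union>T1 = A - \<Union>V" "disjoint T1" "{} \<notin> T1" "\<And>l. l \<in> T1 \<Longrightarrow> adjacent_pair l"
    using T1 by (auto simp: matchings_def partition_on_def)
  have t2: "\<Union>T2 = B - \<Union>V" "disjoint T2" "{} \<notin> T2" "\<And>l. l \<in> T2 \<Longrightarrow> adjacent_pair l"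
    using T2 by (auto simp: matchings_def partition_on_def)
  have v: "\<And>l. l \<in> V \<Longrightarrow> adjacent_pair l \<and> l \<subseteq> A \<union> B \<and> l \<inter> A \<noteq> {} \<and> l \<inter> B \<noteq> {}"
    using V by (auto simp: cross_def)
  have s1: "\<And>l. l \<in> T1 \<Longrightarrow> l \<subseteq> A \<and> l \<noteq> {} \<and> l \<inter> B = {}" using t1 AB by blast
  have s2: "\<And>l. l \<in> T2 \<Longrightarrow> l \<subseteq> B \<and> l \<noteq> {} \<and> l \<inter> A = {}" using t2 AB by blast
  have U: "\<Union>(V \<union> T1 \<union> T2) = A \<union> B" using t1(1) t2(1) v by blast
  have "disjoint (V \<union> T1)"
    by (rule disjoint_union) (use V t1 in auto)
  then have dis: "disjoint (V \<union> T1 \<union> T2)"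
    by (rule disjoint_union) (use t2 t1 v AB in blast)+
  show "V \<union> T1 \<union> T2 \<in> matchings (A \<union> B)"
    unfolding matchings_def partition_on_def mem_Collect_eq
    using U dis t1(3,4) t2(3,4) v adjacent_pair_nonempty by blast
  show "{l \<in> V \<union> T1 \<union> T2. l \<in> cross A B} = V"
    using V s1 s2 by (auto simp: cross_def)
  show "{l \<in> V \<union> T1 \<union> T2. l \<subseteq> A} = T1" using v s1 s2 AB by blast
  show "{l \<in> V \<union> T1 \<union> T2. l \<subseteq> B} = T2" using v s1 s2 AB by blast
  show "V \<inter> T1 = {}" "V \<inter> T2 = {}" "T1 \<inter> T2 = {}" using v s1 s2 by blast+
qed

lemma matchings_Un_cut:
  assumes T: "T \<in> matchings (A \<union> B)" and AB: "A \<inter> B = {}"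
  defines "V \<equiv> {l \<in> T. l \<in> cross A B}"
  shows "V \<subseteq> cross A B" "disjoint V"
    "{l \<in> T. l \<subseteq> A} \<in> matchings (A - \<Union>V)" "{l \<in> T. l \<subseteq> B} \<in> matchings (B - \<Union>V)"
    "V \<union> {l \<in> T. l \<subseteq> A} \<union> {l \<in> T. l \<subseteq> B} = T"
proof -
  have t: "\<Union>T = A \<union> B" "disjoint T" "{} \<notin> T" "\<And>l. l \<in> T \<Longrightarrow> adjacent_pair l"
    using T by (auto simp: matchings_def partition_on_def)
  show "V \<subseteq> cross A B" by (auto simp: V_def)
  show "disjoint V" using t(2) by (auto simp: V_def disjoint_def)
  have cases: "\<And>l. l \<in> T \<Longrightarrow> l \<in> V \<or> l \<subseteq> A \<or> l \<subseteq> B"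
    using t by (fastforce simp: V_def cross_def)
  show "V \<union> {l \<in> T. l \<subseteq> A} \<union> {l \<in> T. l \<subseteq> B} = T"
    using cases by (auto simp: V_def)
  have nv: "\<And>l. l \<in> T \<Longrightarrow> l \<subseteq> A \<or> l \<subseteq> B \<Longrightarrow> l \<notin> V"
    using AB by (auto simp: V_def cross_def)
  have dj: "\<And>l l' x. l \<in> T \<Longrightarrow> l' \<in> T \<Longrightarrow> x \<in> l \<Longrightarrow> x \<in> l' \<Longrightarrow> l = l'"
    using t(2) by (auto simp: disjoint_def)
  have VT: "V \<subseteq> T" by (auto simp: V_def)
  have eqA: "\<Union>{l \<in> T. l \<subseteq> A} = A - \<Union>V"
  proof (intro equalityI subsetI)
    fix x assume "x \<in> \<Union>{l \<in> T. l \<subseteq> A}"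
    then obtain l where l: "l \<in> T" "l \<subseteq> A" "x \<in> l" by auto
    then have "x \<notin> \<Union>V" using dj nv VT by blast
    then show "x \<in> A - \<Union>V" using l by auto
  next
    fix x assume x: "x \<in> A - \<Union>V"
    then obtain l where l: "l \<in> T" "x \<in> l" using t(1) by blast
    then have "l \<subseteq> A" using cases[of l] x AB by blast
    then show "x \<in> \<Union>{l \<in> T. l \<subseteq> A}" using l by auto
  qed
  have eqB: "\<Union>{l \<in> T. l \<subseteq> B} = B - \<Union>V"
  proof (intro equalityI subsetI)
    fix x assume "x \<in> \<Union>{l \<in> T. l \<subseteq> B}"
    then obtain l where l: "l \<in> T" "l \<subseteq> B" "x \<in> l" by auto
    then have "x \<notin> \<Union>V" using dj nv VT by blast
    then show "x \<in> B - \<Union>V" using l by auto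
  next
    fix x assume x: "x \<in> B - \<Union>V"
    then obtain l where l: "l \<in> T" "x \<in> l" using t(1) by blast
    then have "l \<subseteq> B" using cases[of l] x AB by blast
    then show "x \<in> \<Union>{l \<in> T. l \<subseteq> B}" using l by auto
  qed
  show "{l \<in> T. l \<subseteq> A} \<in> matchings (A - \<Union>V)"
    using eqA t by (auto simp: matchings_def partition_on_def disjoint_def)
  show "{l \<in> T. l \<subseteq> B} \<in> matchings (B - \<Union>V)"
    using eqB t by (auto simp: matchings_def partition_on_def disjoint_def)
qed

text \<open>
  Splitting a matching of \<open>A \<union> B\<close> into the pairs that cross the cut and the matchings they leave on the two sides.
\<close>

lemma W_cut:
  assumes AB: "A \<inter> B = {}" and fin: "finite A" "finite B"
  shows "W (A \<union> B) = (\<Sum>V | V \<subseteq> cross A B \<and> disjoint V.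
           (\<Prod>l\<in>V. wall_weight l) * (W (A - \<Union>V) * W (B - \<Union>V)))"
proof -
  let ?VV = "{V. V \<subseteq> cross A B \<and> disjoint V}"
  let ?S = "SIGMA V:?VV. matchings (A - \<Union>V) \<times> matchings (B - \<Union>V)"
  let ?w = "\<lambda>T. \<Prod>l\<in>T. wall_weight l"
  have fV: "finite ?VV"
    by (rule finite_subset[of _ "Pow (cross A B)"]) (use finite_cross[OF fin] in auto)
  have "(\<Sum>V\<in>?VV. ?w V * (W (A - \<Union>V) * W (B - \<Union>V)))
      = (\<Sum>V\<in>?VV. \<Sum>(T1, T2)\<in>matchings (A - \<Union>V) \<times> matchings (B - \<Union>V). ?w V * (?w T1 * ?w T2))"
    unfolding W_def sum_product sum.cartesian_product
    by (simp add: sum_distrib_left case_prod_beta)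
  also have "\<dots> = (\<Sum>(V, T1, T2)\<in>?S. ?w V * (?w T1 * ?w T2))"
    by (subst sum.Sigma) (use fV fin finite_matchings in \<open>auto intro!: finite_matchings\<close>)
  also have "\<dots> = (\<Sum>T\<in>matchings (A \<union> B). ?w T)"
  proof (rule sum.reindex_bij_witness[where
        j = "\<lambda>(V, T1, T2). V \<union> T1 \<union> T2" and
        i = "\<lambda>T. ({l \<in> T. l \<in> cross A B}, {l \<in> T. l \<subseteq> A}, {l \<in> T. l \<subseteq> B})"], goal_cases)
    case (1 a)
    then obtain V T1 T2 where a: "a = (V, T1, T2)" "V \<subseteq> cross A B" "disjoint V"
      "T1 \<in> matchings (A - \<Union>V)" "T2 \<in> matchings (B - \<Union>V)" by auto
    show ?case using matchings_Un_glue[OF a(2-5) AB] a(1) by simp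
  next
    case (2 a)
    then obtain V T1 T2 where a: "a = (V, T1, T2)" "V \<subseteq> cross A B" "disjoint V"
      "T1 \<in> matchings (A - \<Union>V)" "T2 \<in> matchings (B - \<Union>V)" by auto
    show ?case using matchings_Un_glue[OF a(2-5) AB] a(1) by simp
  next
    case (3 T)
    then show ?case using matchings_Un_cut[OF 3 AB] by simp
  next
    case (4 T)
    then show ?case using matchings_Un_cut[OF 4 AB] by simp
  next
    case (5 a)
    then obtain V T1 T2 where a: "a = (V, T1, T2)" "V \<subseteq> cross A B" "disjoint V"
      "T1 \<in> matchings (A - \<Union>V)" "T2 \<in> matchings (B - \<Union>V)" by auto
    note g = matchings_Un_glue[OF a(2-5) AB]
    have f: "finite V" "finite T1" "finite T2"
      using a finite_subset[OF a(2) finite_cross[OF fin]] finite_matching fin by (meson finite_Diff)+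
    have "?w (V \<union> T1 \<union> T2) = ?w V * ?w T1 * ?w T2"
      using g(5-7) f by (simp add: prod.union_disjoint Int_Un_distrib2)
    then show ?case using a by simp
  qed
  finally show ?thesis by (simp add: W_def)
qed

lemma W_Un_separated:
  assumes "A \<inter> B = {}" "finite A" "finite B" "cross A B = {}"
  shows "W (A \<union> B) = W A * W B"
proof -
  have "{V. V \<subseteq> cross A B \<and> disjoint V} = {{}}" using assms(4) by (auto simp: disjoint_def)
  then show ?thesis using W_cut[OF assms(1-3)] by simp
qed

lemma W_singleton [simp]: "W {s} = 0"
proof -
  have "matchings {s} = {}"
  proof (rule equals0I)
    fix T assume T: "T \<in> matchings {s}"
    then have "\<Union>T = {s}" "{} \<notin> T" "\<forall>l\<in>T. adjacent_pair l"
      by (auto simp: matchings_def partition_on_def)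
    then obtain l where "l \<in> T" "l = {s}" by blast
    then have "adjacent_pair {s}" using \<open>\<forall>l\<in>T. adjacent_pair l\<close> by auto
    then show False by (auto simp: adjacent_pair_def doubleton_eq_iff)
  qed
  then show ?thesis by (simp add: W_def)
qed

text \<open>
  If the cell \<open>s\<close> has the single neighbour \<open>t\<close> in the region, the pair \<open>{s, t}\<close> belongs to every matching.
\<close>

lemma W_forced:
  assumes s: "s \<in> R" and t: "t \<in> R" "t \<noteq> s" and f: "finite R" and e: "adjacent_pair {s, t}"
    and only: "\<And>u. u \<in> R \<Longrightarrow> adjacent_pair {s, u} \<Longrightarrow> u = t"
  shows "W R = wall_weight {s, t} * W (R - {s, t})"
proof -
  have two: "\<exists>u. l = {s, u}" if "adjacent_pair l" "s \<in> l" for l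
    using that by (auto simp: adjacent_pair_def)
  have c: "cross {s} (R - {s}) = {{s, t}}"
  proof (intro equalityI subsetI)
    fix l assume l: "l \<in> cross {s} (R - {s})"
    then obtain u where u: "l = {s, u}" "adjacent_pair l" "l \<subseteq> R" using two[of l] s
      by (auto simp: cross_def)
    then have "u = t" using only[of u] by auto
    then show "l \<in> {{s, t}}" using u by auto
  next
    fix l assume "l \<in> {{s, t}}"
    moreover have "adjacent_pair {s, t} \<and> {s, t} \<subseteq> {s} \<union> (R - {s}) \<and> {s, t} \<inter> {s} \<noteq> {} \<and> {s, t} \<inter> (R - {s}) \<noteq> {}"
      using t e by blast
    ultimately show "l \<in> cross {s} (R - {s})" by (simp add: cross_def)
  qed
  have V: "{V. V \<subseteq> cross {s} (R - {s}) \<and> disjoint V} = {{}, {{s, t}}}"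
    unfolding c by (auto simp: disjoint_def subset_singleton_iff)
  have "W ({s} \<union> (R - {s})) = wall_weight {s, t} * W (R - {s} - {s, t})"
    by (subst W_cut) (use f in \<open>auto simp: V\<close>)
  moreover have "{s} \<union> (R - {s}) = R" "R - {s} - {s, t} = R - {s, t}" using s by auto
  ultimately show ?thesis by simp
qed

lemma adjacent_pair_iff:
  "adjacent_pair {(q, c), (q', c')} \<longleftrightarrow>
     (q = q' \<and> (c' = c + 1 \<or> c = c' + 1)) \<or>
     (c = c' \<and> (q' = q - 1 \<and> odd (c - q) \<or> q = q' - 1 \<and> odd (c - q')))"
  by (auto simp: adjacent_pair_def doubleton_eq_iff)

lemma adjacent_pairE:
  assumes "adjacent_pair l"
  obtains q c q' c' where "l = {(q, c), (q', c')}" "adjacent_pair {(q, c), (q', c')}"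
  using assms unfolding adjacent_pair_def by blast

lemma wall_weight_iff:
  "wall_weight {(q, c), (q', c')} = (if c = 0 \<and> c' = 0 \<and> (q' = q - 1 \<or> q = q' - 1) then 1/2 else 1)"
  by (auto simp: wall_weight_def doubleton_eq_iff)

text \<open>
  The cut along level \<open>r\<close>.  The summation index \<open>C\<close> is the set of abscissas of the vertical
  lozenges that cross this level, and at most the one with \<open>c = 0\<close> carries a weight.
\<close>

lemma W_level_cut:
  assumes fin: "finite A" "finite B"
    and A: "\<And>q c. (q, c) \<in> A \<Longrightarrow> r \<le> q" and B: "\<And>q c. (q, c) \<in> B \<Longrightarrow> q < r"
  shows "W (A \<union> B) = (\<Sum>C\<in>Pow {c. odd (c - r) \<and> (r, c) \<in> A \<and> (r - 1, c) \<in> B}.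
           (if 0 \<in> C then 1/2 else 1) * (W (A - {r} \<times> C) * W (B - {r - 1} \<times> C)))"
proof -
  let ?X = "{c. odd (c - r) \<and> (r, c) \<in> A \<and> (r - 1, c) \<in> B}"
  let ?e = "\<lambda>c. {(r, c), (r - 1, c)}"
  have AB: "A \<inter> B = {}" using A B by fastforce
  have fX: "finite ?X"
    by (rule finite_subset[of _ "snd ` A"]) (use fin in \<open>force+\<close>)
  have inj: "inj ?e" by (auto simp: inj_def doubleton_eq_iff)
  have cr: "cross A B = ?e ` ?X"
  proof (intro equalityI subsetI)
    fix l assume l: "l \<in> cross A B"
    then have l1: "adjacent_pair l" "l \<subseteq> A \<union> B" "l \<inter> A \<noteq> {}" "l \<inter> B \<noteq> {}" by (auto simp: cross_def)
    then obtain q c where "l = {(q, c), (q, c + 1)} \<or> (odd (c - q) \<and> l = {(q, c), (q - 1, c)})"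
      unfolding adjacent_pair_def by blast
    then show "l \<in> ?e ` ?X"
    proof
      assume e: "l = {(q, c), (q, c + 1)}"
      then obtain c1 c2 where "(q, c1) \<in> A" "(q, c2) \<in> B" using l1(3,4) by blast
      then show ?thesis using A B by fastforce
    next
      assume e: "odd (c - q) \<and> l = {(q, c), (q - 1, c)}"
      then have m: "(q, c) \<in> A \<or> (q - 1, c) \<in> A" "(q, c) \<in> B \<or> (q - 1, c) \<in> B"
        using l1(3,4) by blast+
      have "q \<ge> r" using m(1) A[of q c] A[of "q - 1" c] by linarith
      moreover have "q - 1 < r" using m(2) B[of q c] B[of "q - 1" c] by linarith
      ultimately have "q = r" by simp
      moreover have "(r, c) \<in> A" "(r - 1, c) \<in> B" 
        using m \<open>q = r\<close> A[of "r - 1" c] B[of r c] by auto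
      ultimately show ?thesis using e by auto
    qed
  next
    fix l assume "l \<in> ?e ` ?X"
    then show "l \<in> cross A B" by (auto simp: cross_def adjacent_pair_iff)
  qed
  have VV: "{V. V \<subseteq> cross A B \<and> disjoint V} = (`) ?e ` Pow ?X"
  proof -
    have "disjoint (?e ` C)" for C by (auto simp: disjoint_def)
    then show ?thesis unfolding cr by (auto simp: subset_image_iff)
  qed
  have "W (A \<union> B) = (\<Sum>V\<in>(`) ?e ` Pow ?X. (\<Prod>l\<in>V. wall_weight l) * (W (A - \<Union>V) * W (B - \<Union>V)))"
    using W_cut[OF AB fin] VV by simp
  also have "\<dots> = (\<Sum>C\<in>Pow ?X. (\<Prod>l\<in>?e ` C. wall_weight l) * (W (A - \<Union>(?e ` C)) * W (B - \<Union>(?e ` C))))"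
    by (subst sum.reindex) (simp_all add: inj_on_def inj_image_eq_iff[OF inj])
  also have "\<dots> = (\<Sum>C\<in>Pow ?X. (if 0 \<in> C then 1/2 else 1) * (W (A - {r} \<times> C) * W (B - {r - 1} \<times> C)))"
  proof (rule sum.cong[OF refl])
    fix C assume C: "C \<in> Pow ?X"
    then have fC: "finite C" using fX finite_subset by auto
    have "(\<Prod>l\<in>?e ` C. wall_weight l) = (\<Prod>c\<in>C. wall_weight (?e c))"
      using prod.reindex[OF inj_on_subset[OF inj subset_UNIV], of wall_weight C] by (simp add: o_def)
    also have "\<dots> = (\<Prod>c\<in>C. if c = 0 then 1/2 else 1)"
      by (rule prod.cong) (auto simp: wall_weight_iff)
    also have "\<dots> = (if 0 \<in> C then 1/2 else 1)"
      using fC by (simp add: prod.delta)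
    finally have 1: "(\<Prod>l\<in>?e ` C. wall_weight l) = (if 0 \<in> C then 1/2 else 1)" .
    have "(r - 1, c) \<notin> A" "(r, c) \<notin> B" for c using A[of "r - 1" c] B[of r c] by auto
    then have 2: "A - \<Union>(?e ` C) = A - {r} \<times> C" and 3: "B - \<Union>(?e ` C) = B - {r - 1} \<times> C"
      by auto
    show "(\<Prod>l\<in>?e ` C. wall_weight l) * (W (A - \<Union>(?e ` C)) * W (B - \<Union>(?e ` C))) =
        (if 0 \<in> C then 1/2 else 1) * (W (A - {r} \<times> C) * W (B - {r - 1} \<times> C))"
      unfolding 1 2 3 ..
  qed
  finally show ?thesis .
qed

section \<open>Matchings of a single strip\<close>

text \<open>
  The difference of the numbers of even and odd elements.  It vanishes for the abscissas in a strip that can be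
  matched without using vertical lozenges.
\<close>

definition parity_sum :: "int set \<Rightarrow> int" where
  "parity_sum C = (\<Sum>c\<in>C. if even c then 1 else - 1)"

lemma W_strip_balanced:
  assumes fin: "finite C" and nz: "W ({q} \<times> C) \<noteq> 0"
  shows "parity_sum C = 0"
proof -
  let ?s = "\<lambda>(q' :: int, c :: int). if even c then 1 else - 1 :: int"
  obtain T where T: "T \<in> matchings ({q} \<times> C)"
    using nz by (force simp: W_def)
  have p: "partition_on ({q} \<times> C) T" and e: "\<And>l. l \<in> T \<Longrightarrow> adjacent_pair l"
    using T by (auto simp: matchings_def)
  have fl: "\<forall>l\<in>T. finite l"
    using e by (auto simp: adjacent_pair_def)
  have "parity_sum C = (\<Sum>u\<in>{q} \<times> C. ?s u)"
    unfolding parity_sum_def by (rule sum.reindex_bij_witness[where i = snd and j = "\<lambda>c. (q, c)"]) auto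
  also have "\<dots> = (\<Sum>u\<in>\<Union>T. ?s u)" using p by (simp add: partition_on_def)
  also have "\<dots> = (\<Sum>l\<in>T. \<Sum>u\<in>l. ?s u)"
    by (subst sum.Union_disjoint) (use p fl in \<open>auto simp: partition_on_def disjoint_def\<close>)
  also have "\<dots> = 0"
  proof (rule sum.neutral, rule ballI)
    fix l assume l: "l \<in> T"
    then have "l \<subseteq> {q} \<times> C" using p by (auto simp: partition_on_def)
    then obtain c where "l = {(q, c), (q, c + 1)}" 
      using e[OF l] unfolding adjacent_pair_def by auto
    then show "(\<Sum>u\<in>l. ?s u) = 0" by simp
  qed
  finally show ?thesis .
qed

lemma parity_sum_Suc: "a \<le> b \<Longrightarrow> parity_sum {a..<b + 1} = parity_sum {a..<b} + (if even b then 1 else - 1)"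
proof -
  assume "a \<le> b"
  then have "{a..<b + 1} = insert b {a..<b}" by auto
  then show ?thesis by (simp add: parity_sum_def)
qed

lemma parity_sum_even_interval: "parity_sum {a..<a + 2 * int n} = 0"
proof (induction n)
  case 0 then show ?case by (simp add: parity_sum_def)
next
  case (Suc n)
  have "parity_sum {a..<a + 2 * int n + 1 + 1} = 0"
    using Suc by (subst parity_sum_Suc, simp)+ simp
  then show ?case by (simp add: algebra_simps)
qed

lemma W_even_interval: "W ({q} \<times> {a..<a + 2 * int n}) = 1"
proof (induction n arbitrary: a)
  case (Suc n)
  have "W ({q} \<times> {a..<a + 2 * int (Suc n)}) =
      wall_weight {(q, a), (q, a + 1)} * W ({q} \<times> {a..<a + 2 * int (Suc n)} - {(q, a), (q, a + 1)})"
    by (rule W_forced) (auto simp: adjacent_pair_iff)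
  moreover have "{q} \<times> {a..<a + 2 * int (Suc n)} - {(q, a), (q, a + 1)} = {q} \<times> {a + 2..<(a + 2) + 2 * int n}"
    by auto
  ultimately show ?case using Suc[of "a + 2"] by (simp add: wall_weight_iff)
qed simp

lemma even_diff_obtain:
  fixes a b :: int
  assumes "a \<le> b" "even (b - a)"
  obtains n where "b = a + 2 * int n"
proof -
  from assms(2) obtain m where m: "b - a = 2 * m" by (rule evenE)
  then have "b = a + 2 * int (nat m)" using assms(1) by auto
  then show ?thesis by (rule that)
qed

lemma W_even_interval_diff:
  assumes ab: "a \<le> b" "even (b - a)" and Y: "\<And>c. c \<in> Y \<Longrightarrow> even (c - p)"
  shows "W ({q} \<times> ({a..<b} - Y)) = (if Y \<inter> {a..<b} = {} then 1 else 0)"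
proof (cases "Y \<inter> {a..<b} = {}")
  case True
  then have "{a..<b} - Y = {a..<b}" by auto
  then show ?thesis using True even_diff_obtain[OF ab] W_even_interval by metis
next
  case False
  let ?Y = "Y \<inter> {a..<b}"
  have "parity_sum {a..<b} = 0" using even_diff_obtain[OF ab] parity_sum_even_interval by metis
  moreover have "{a..<b} - Y = {a..<b} - ?Y" by auto
  ultimately have "parity_sum ({a..<b} - Y) = - parity_sum ?Y"
    unfolding parity_sum_def by (simp add: sum_diff)
  also have "parity_sum ?Y = (\<Sum>c\<in>?Y. if even p then 1 else - 1)"
    unfolding parity_sum_def by (rule sum.cong) (use Y in auto)
  also have "- \<dots> \<noteq> 0" using False by auto
  finally have "parity_sum ({a..<b} - Y) \<noteq> 0" .
  then show ?thesis using False W_strip_balanced[of "{a..<b} - Y" q] by auto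
qed

lemma W_strip_split:
  assumes "finite C" "x \<notin> C"
  shows "W ({q} \<times> C) = W ({q} \<times> {c\<in>C. c < x}) * W ({q} \<times> {c\<in>C. x < c})"
proof -
  have "{q} \<times> C = ({q} \<times> {c\<in>C. c < x}) \<union> ({q} \<times> {c\<in>C. x < c})"
    using assms(2) by (auto simp: not_less_iff_gr_or_eq)
  moreover have c: "cross ({q} \<times> {c\<in>C. c < x}) ({q} \<times> {c\<in>C. x < c}) = {}"
  proof (rule equals0I)
    fix l assume l: "l \<in> cross ({q} \<times> {c\<in>C. c < x}) ({q} \<times> {c\<in>C. x < c})"
    then have "adjacent_pair l" by (simp add: cross_def)
    then show False
      by (rule adjacent_pairE) (use l assms(2) in \<open>auto simp: cross_def adjacent_pair_iff\<close>)
  qed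
  moreover have "W (({q} \<times> {c\<in>C. c < x}) \<union> ({q} \<times> {c\<in>C. x < c}))
      = W ({q} \<times> {c\<in>C. c < x}) * W ({q} \<times> {c\<in>C. x < c})"
    by (rule W_Un_separated[OF _ _ _ c]) (use assms(1) in auto)
  ultimately show ?thesis by simp
qed

text \<open>
  Between two removed cells of the same parity exactly one cell of the other parity has to be removed.
\<close>

lemma W_gap:
  assumes ab: "a < b" "even (b - a)" and Y: "\<And>c. c \<in> Y \<Longrightarrow> odd (c - a)"
  shows "W ({q} \<times> ({a<..<b} - Y)) = (if card (Y \<inter> {a<..<b}) = 1 then 1 else 0)"
proof (cases "card (Y \<inter> {a<..<b}) = 1")
  case True
  then obtain y where y: "Y \<inter> {a<..<b} = {y}" by (auto simp: card_1_singleton_iff)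
  then have C: "{a<..<b} - Y = {a<..<b} - {y}" by auto
  have yy: "y \<in> Y" "a < y" "y < b" using y by auto
  have "odd (y - a)" using Y yy by auto
  then have e: "even (y - (a + 1))" "even (b - (y + 1))" using ab(2) by auto
  have l: "{c \<in> {a<..<b} - Y. c < y} = {a + 1..<y} - {}" "{c \<in> {a<..<b} - Y. y < c} = {y + 1..<b} - {}"
    using yy unfolding C by auto
  have "W ({q} \<times> ({a<..<b} - Y)) = W ({q} \<times> ({a + 1..<y} - {})) * W ({q} \<times> ({y + 1..<b} - {}))"
    using W_strip_split[of "{a<..<b} - Y" y q] yy(1) unfolding l by auto
  also have "\<dots> = 1"
    using W_even_interval_diff[of "a + 1" y "{}" 0 q] W_even_interval_diff[of "y + 1" b "{}" 0 q] e yy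
    by simp
  finally show ?thesis using True by simp
next
  case False
  let ?Y = "Y \<inter> {a<..<b}"
  let ?s = "if even (a + 1) then 1 else - 1 :: int"
  have I: "{a<..<b} = {a + 1..<b - 1 + 1}" by auto
  have e: "even (b - 1 - (a + 1))" using ab(2) by simp
  have ab': "a + 1 \<le> b - 1" using ab by presburger
  have "parity_sum {a + 1..<b - 1} = 0"
    using parity_sum_even_interval even_diff_obtain[OF ab' e] by metis
  moreover have "even (b - 1) \<longleftrightarrow> even (a + 1)" using e by presburger
  ultimately have "parity_sum {a<..<b} = ?s"
    unfolding I using ab' by (subst parity_sum_Suc) auto
  moreover have "{a<..<b} - Y = {a<..<b} - ?Y" by auto
  ultimately have "parity_sum ({a<..<b} - Y) = ?s - parity_sum ?Y"
    unfolding parity_sum_def by (simp add: sum_diff)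
  also have "parity_sum ?Y = (\<Sum>c\<in>?Y. ?s)"
    unfolding parity_sum_def by (rule sum.cong) (use Y in auto)
  also have "\<dots> = ?s * int (card ?Y)" by simp
  also have "?s - ?s * int (card ?Y) \<noteq> 0" using False by auto
  finally have "parity_sum ({a<..<b} - Y) \<noteq> 0" .
  then show ?thesis using False W_strip_balanced[of "{a<..<b} - Y" q] by auto
qed

lemma strict_chain:
  fixes x :: "nat \<Rightarrow> int"
  assumes "\<And>i. i < k \<Longrightarrow> x i < x (Suc i)"
  shows "i < j \<Longrightarrow> j \<le> k \<Longrightarrow> x i < x j"
proof (induction j)
  case (Suc j)
  show ?case
  proof (cases "i = j")
    case True then show ?thesis using assms Suc by auto
  next
    case False
    then have "x i < x j" using Suc by auto
    also have "x j < x (Suc j)" using assms Suc by auto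
    finally show ?thesis .
  qed
qed simp

lemma chain_locate:
  fixes x :: "nat \<Rightarrow> int"
  assumes "x 0 < c" "c < x k" "c \<notin> x ` {..k}"
  shows "\<exists>i<k. x i < c \<and> c < x (Suc i)"
  using assms
proof (induction k)
  case (Suc k)
  show ?case
  proof (cases "c < x k")
    case True
    moreover have "c \<notin> x ` {..k}" using Suc.prems(3) by auto
    ultimately have "\<exists>i<k. x i < c \<and> c < x (Suc i)" using Suc.IH Suc.prems(1) by blast
    then show ?thesis using less_SucI by blast
  next
    case False
    then have "x k < c" using Suc.prems(3) by (auto simp: order.order_iff_strict)
    then show ?thesis using Suc.prems by blast
  qed
qed auto

lemma W_strip_interlacing:
  fixes x :: "nat \<Rightarrow> int"
  assumes x: "\<And>i. i < k \<Longrightarrow> x i < x (Suc i)" "\<And>i. i \<le> k \<Longrightarrow> even (x i - p)"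
    and al: "\<alpha> \<le> x 0" "even (\<alpha> - p)" and be: "x k < \<beta>" "odd (\<beta> - p)"
    and Y: "\<And>c. c \<in> Y \<Longrightarrow> odd (c - p)"
  shows "W ({q} \<times> ({\<alpha>..<\<beta>} - x ` {..k} - Y)) =
    (if Y \<inter> {\<alpha>..<x 0} = {} \<and> (\<forall>i<k. card (Y \<inter> {x i<..<x (Suc i)}) = 1) \<and> Y \<inter> {x k<..<\<beta>} = {}
     then 1 else 0)"
proof -
  have mono: "i < j \<Longrightarrow> j \<le> k \<Longrightarrow> x i < x j" for i j using strict_chain[of k x] x(1) by auto
  have xk0: "x 0 \<le> x k" using mono[of 0 k] by (cases "k = 0") auto
  have left: "j \<le> k \<Longrightarrow> W ({q} \<times> ({\<alpha>..<x j} - x ` {..<j} - Y)) =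
     (if Y \<inter> {\<alpha>..<x 0} = {} \<and> (\<forall>i<j. card (Y \<inter> {x i<..<x (Suc i)}) = 1) then 1 else 0)" for j
  proof (induction j)
    case 0
    have "even (x 0 - \<alpha>)" using x(2)[of 0] al(2) by auto
    then have "W ({q} \<times> ({\<alpha>..<x 0} - Y)) = (if Y \<inter> {\<alpha>..<x 0} = {} then 1 else 0)"
      using al by (intro W_even_interval_diff[where p = "p + 1"]) (use Y in auto)
    then show ?case by simp
  next
    case (Suc j)
    let ?C = "{\<alpha>..<x (Suc j)} - x ` {..<Suc j} - Y"
    have jk: "j < k" using Suc by simp
    have aj: "\<alpha> \<le> x j" using al(1) mono[of 0 j] jk by (cases "j = 0") auto
    have "W ({q} \<times> ?C) = W ({q} \<times> {c\<in>?C. c < x j}) * W ({q} \<times> {c\<in>?C. x j < c})"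
      by (rule W_strip_split) auto
    moreover have "{c\<in>?C. c < x j} = {\<alpha>..<x j} - x ` {..<j} - Y"
      using x(1)[OF jk] by (auto simp: lessThan_Suc)
    moreover have "{c\<in>?C. x j < c} = {x j<..<x (Suc j)} - Y"
    proof -
      have "x i \<le> x j" if "i < Suc j" for i using mono[of i j] jk that by (cases "i = j") auto
      then show ?thesis using aj by fastforce
    qed
    moreover have "W ({q} \<times> ({x j<..<x (Suc j)} - Y)) = (if card (Y \<inter> {x j<..<x (Suc j)}) = 1 then 1 else 0)"
    proof (rule W_gap)
      show "even (x (Suc j) - x j)" using x(2)[of j] x(2)[of "Suc j"] jk by auto
      show "odd (c - x j)" if "c \<in> Y" for c using Y[OF that] x(2)[of j] jk by auto
    qed (use x(1) jk in auto)
    ultimately show ?case using Suc jk by (auto simp: less_Suc_eq)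
  qed
  let ?C = "{\<alpha>..<\<beta>} - x ` {..k} - Y"
  have ak: "\<alpha> \<le> x k" using al(1) xk0 by auto
  have "W ({q} \<times> ?C) = W ({q} \<times> {c\<in>?C. c < x k}) * W ({q} \<times> {c\<in>?C. x k < c})"
    by (rule W_strip_split) auto
  moreover have "{c\<in>?C. c < x k} = {\<alpha>..<x k} - x ` {..<k} - Y"
    using be by (auto simp: lessThan_Suc_atMost[symmetric] lessThan_Suc)
  moreover have "{c\<in>?C. x k < c} = {x k + 1..<\<beta>} - Y"
  proof -
    have "x i \<le> x k" if "i \<le> k" for i using mono[of i k] that by (cases "i = k") auto
    then show ?thesis using ak by fastforce
  qed
  moreover have "W ({q} \<times> ({x k + 1..<\<beta>} - Y)) = (if Y \<inter> {x k + 1..<\<beta>} = {} then 1 else 0)"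
    by (rule W_even_interval_diff[where p = "p + 1"]) (use be x(2)[of k] Y in auto)
  moreover have "{x k + 1..<\<beta>} = {x k<..<\<beta>}" by auto
  ultimately show ?thesis using left[of k] by auto
qed

text \<open>
  A strip with abscissas \<open>{\<alpha>..<\<beta>}\<close> from which \<open>x 0 < \<dots> < x k\<close>, all of one parity, have been removed.
  The sets \<open>Y\<close> of cells of the other parity whose removal leaves a matching are those that interlace with \<open>x\<close>,
  and the matching then is unique.  Hence a sum over sets \<open>Y\<close> becomes a sum over tuples with the
  element \<open>y i\<close> in the gap between \<open>x i\<close> and \<open>x (Suc i)\<close>.
\<close>

lemma strip_sum:
  fixes x :: "nat \<Rightarrow> int" and g :: "int set \<Rightarrow> real"
  assumes x: "\<And>i. i < k \<Longrightarrow> x i < x (Suc i)" "\<And>i. i \<le> k \<Longrightarrow> even (x i - p)"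
    and al: "\<alpha> \<le> x 0" "even (\<alpha> - p)" and be: "x k < \<beta>" "odd (\<beta> - p)"
  shows "(\<Sum>Y\<in>Pow {c\<in>{\<alpha>..<\<beta>}. odd (c - p)}. W ({q} \<times> ({\<alpha>..<\<beta>} - x ` {..k} - Y)) * g Y)
       = (\<Sum>y\<in>PiE {..<k} (\<lambda>i. {c\<in>{x i<..<x (Suc i)}. odd (c - p)}). g (y ` {..<k}))"
proof -
  have mono: "i < j \<Longrightarrow> j \<le> k \<Longrightarrow> x i < x j" for i j using strict_chain[of k x] x(1) by auto
  have mono': "i \<le> j \<Longrightarrow> j \<le> k \<Longrightarrow> x i \<le> x j" for i j
    using mono[of i j] by (cases "i = j") auto
  let ?P = "{c\<in>{\<alpha>..<\<beta>}. odd (c - p)}"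
  let ?E = "PiE {..<k} (\<lambda>i. {c\<in>{x i<..<x (Suc i)}. odd (c - p)})"
  let ?ok = "\<lambda>Y. Y \<inter> {\<alpha>..<x 0} = {} \<and> (\<forall>i<k. card (Y \<inter> {x i<..<x (Suc i)}) = 1) \<and> Y \<inter> {x k<..<\<beta>} = {}"
  have trace: "y ` {..<k} \<inter> {x i<..<x (Suc i)} = {y i}" if y: "y \<in> ?E" and i: "i < k" for y i
  proof -
    have yy: "x j < y j" "y j < x (Suc j)" if "j < k" for j using y that by (auto simp: PiE_iff)
    have "j = i" if "j < k" "x i < y j" "y j < x (Suc i)" for j
    proof (rule ccontr)
      assume "j \<noteq> i"
      then consider "Suc j \<le> i" | "Suc i \<le> j" by linarith
      then show False
      proof cases
        case 1 then show False using mono'[of "Suc j" i] yy[OF that(1)] that i by auto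
      next
        case 2 then show False using mono'[of "Suc i" j] yy[OF that(1)] that i by auto
      qed
    qed
    then show ?thesis using yy[OF i] i by fastforce
  qed
  have img: "{Y \<in> Pow ?P. ?ok Y} = (\<lambda>y. y ` {..<k}) ` ?E"
  proof (intro equalityI subsetI)
    fix Y assume "Y \<in> {Y \<in> Pow ?P. ?ok Y}"
    then have Y: "Y \<subseteq> ?P" and ok: "?ok Y" by auto
    define y where "y = restrict (\<lambda>i. the_elem (Y \<inter> {x i<..<x (Suc i)})) {..<k}"
    have yi: "Y \<inter> {x i<..<x (Suc i)} = {y i}" if "i < k" for i
    proof -
      have "is_singleton (Y \<inter> {x i<..<x (Suc i)})"
        using ok that by (auto simp: is_singleton_altdef)
      then show ?thesis using that by (simp add: y_def is_singleton_the_elem)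
    qed
    then have yi': "y i \<in> Y \<inter> {x i<..<x (Suc i)}" if "i < k" for i using that by blast
    have "y \<in> ?E"
      using yi' Y by (force simp: y_def PiE_iff)
    moreover have "Y = y ` {..<k}"
    proof (intro equalityI subsetI)
      fix c assume c: "c \<in> Y"
      then have cP: "\<alpha> \<le> c" "c < \<beta>" "odd (c - p)" using Y by auto
      have nx: "c \<notin> x ` {..k}" using x(2) cP(3) by auto
      moreover have "x 0 < c" using ok c cP nx by (force simp: not_less_iff_gr_or_eq order.order_iff_strict)
      moreover have "c < x k" using ok c cP nx by (force simp: not_less_iff_gr_or_eq order.order_iff_strict)
      ultimately obtain i where i: "i < k" "x i < c" "c < x (Suc i)" using chain_locate by blast
      then have "c \<in> Y \<inter> {x i<..<x (Suc i)}" using c by auto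
      then show "c \<in> y ` {..<k}" using yi[OF i(1)] i(1) by auto
    qed (use yi' in auto)
    ultimately show "Y \<in> (\<lambda>y. y ` {..<k}) ` ?E" by blast
  next
    fix Y assume "Y \<in> (\<lambda>y. y ` {..<k}) ` ?E"
    then obtain y where y: "y \<in> ?E" "Y = y ` {..<k}" by auto
    have yy: "x j < y j" "y j < x (Suc j)" "odd (y j - p)" if "j < k" for j
      using y that by (auto simp: PiE_iff)
    have b: "x 0 < y j" "y j < x k" if "j < k" for j
      using yy[OF that] mono'[of 0 j] mono'[of "Suc j" k] that by auto
    have "Y \<subseteq> ?P"
    proof
      fix c assume "c \<in> Y"
      then obtain j where j: "j < k" "c = y j" using y(2) by auto
      show "c \<in> ?P" using b[OF j(1)] yy(3)[OF j(1)] al(1) be(1) j(2) by auto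
    qed
    moreover have "?ok Y"
      using trace[OF y(1)] b unfolding y(2) by fastforce
    ultimately show "Y \<in> {Y \<in> Pow ?P. ?ok Y}" by blast
  qed
  have inj: "inj_on (\<lambda>y. y ` {..<k}) ?E"
  proof (rule inj_onI)
    fix y z assume y: "y \<in> ?E" and z: "z \<in> ?E" and e: "y ` {..<k} = z ` {..<k}"
    have "y i = z i" if "i < k" for i
      using trace[OF y that] trace[OF z that] e by auto
    then show "y = z" using y z by (intro PiE_ext[OF y z]) auto
  qed
  have "(\<Sum>Y\<in>Pow ?P. W ({q} \<times> ({\<alpha>..<\<beta>} - x ` {..k} - Y)) * g Y)
      = (\<Sum>Y\<in>Pow ?P. if ?ok Y then g Y else 0)"
  proof (rule sum.cong[OF refl])
    fix Y assume "Y \<in> Pow ?P"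
    then have Y: "odd (c - p)" if "c \<in> Y" for c using that by blast
    have "W ({q} \<times> ({\<alpha>..<\<beta>} - x ` {..k} - Y)) = (if ?ok Y then 1 else 0)"
      by (rule W_strip_interlacing[where p = p]) (use x al be Y in auto)
    then have *: "W ({q} \<times> ({\<alpha>..<\<beta>} - x ` {..k} - Y)) = (if ?ok Y then 1 else 0)" .
    show "W ({q} \<times> ({\<alpha>..<\<beta>} - x ` {..k} - Y)) * g Y = (if ?ok Y then g Y else 0)"
      unfolding * by auto
  qed
  also have "\<dots> = (\<Sum>Y\<in>{Y \<in> Pow ?P. ?ok Y}. g Y)"
  proof (rule sum.inter_filter[symmetric])
    have "finite ?P" by (rule finite_subset[of _ "{\<alpha>..<\<beta>}"]) auto
    then show "finite (Pow ?P)" by simp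
  qed
  also have "\<dots> = (\<Sum>y\<in>?E. g (y ` {..<k}))"
    unfolding img by (rule sum.reindex_cong[OF inj]) auto
  finally show ?thesis .
qed

section \<open>Determinants with entries given by functions\<close>

text \<open>
  The determinant of the matrix with the entries \<open>f i j\<close> for \<open>i < n\<close> and \<open>j < n\<close>.  As a function of \<open>n\<close>
  and \<open>f\<close> it allows rows to be rewritten without reference to matrix carriers.
\<close>

definition D :: "nat \<Rightarrow> (nat \<Rightarrow> nat \<Rightarrow> real) \<Rightarrow> real" where
  "D n f = det (mat n n (\<lambda>(i, j). f i j))"

lemma D_expand: "D n f = (\<Sum>p | p permutes {..<n}. signof p * (\<Prod>i<n. f i (p i)))"
proof -
  have "D n f = (\<Sum>p | p permutes {0..<n}. signof p * (\<Prod>i = 0..<n. mat n n (\<lambda>(i, j). f i j) $$ (i, p i)))"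
    unfolding D_def by (rule det_def') simp
  also have "\<dots> = (\<Sum>p | p permutes {0..<n}. signof p * (\<Prod>i = 0..<n. f i (p i)))"
    by (intro sum.cong refl arg_cong2[where f = "(*)"] prod.cong)
       (auto dest: permutes_in_image)
  finally show ?thesis by (simp add: atLeast0LessThan)
qed

lemma D_cong: "(\<And>i j. i < n \<Longrightarrow> j < n \<Longrightarrow> f i j = g i j) \<Longrightarrow> D n f = D n g"
  unfolding D_def by (rule arg_cong[where f = det]) (auto intro!: eq_matI)

lemma D_0 [simp]: "D 0 f = 1"
  by (simp add: D_def)

lemma D_mult: "D n (\<lambda>i j. \<Sum>k<n. f i k * g k j) = D n f * D n g"
proof -
  have "mat n n (\<lambda>(i, j). f i j) * mat n n (\<lambda>(i, j). g i j) = mat n n (\<lambda>(i, j). \<Sum>k<n. f i k * g k j)"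
    by (rule eq_matI) (auto simp: scalar_prod_def atLeast0LessThan intro!: sum.cong)
  then show ?thesis unfolding D_def
    using det_mult[of "mat n n (\<lambda>(i, j). f i j)" n "mat n n (\<lambda>(i, j). g i j)"] by simp
qed

lemma D_lower: "(\<And>i j. i < j \<Longrightarrow> j < n \<Longrightarrow> f i j = 0) \<Longrightarrow> D n f = (\<Prod>i<n. f i i)"
  unfolding D_def
  by (subst det_lower_triangular[of n]) (auto simp: prod_list_diag_prod atLeast0LessThan)

lemma D_transpose: "D n (\<lambda>i j. f j i) = D n f"
proof -
  have "(mat n n (\<lambda>(i, j). f i j))\<^sup>T = mat n n (\<lambda>(i, j). f j i)" by (rule eq_matI) auto
  then show ?thesis unfolding D_def using det_transpose[of "mat n n (\<lambda>(i, j). f i j)" n] by simp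
qed

lemma D_upper: "(\<And>i j. j < i \<Longrightarrow> i < n \<Longrightarrow> f i j = 0) \<Longrightarrow> D n f = (\<Prod>i<n. f i i)"
  using D_lower[of n "\<lambda>i j. f j i"] D_transpose[of n f] by simp

lemma D_scale_rows: "D n (\<lambda>i j. c i * f i j) = (\<Prod>i<n. c i) * D n f"
  unfolding D_expand by (simp add: prod.distrib sum_distrib_left mult_ac)

lemma D_scale_cols: "D n (\<lambda>i j. c j * f i j) = (\<Prod>j<n. c j) * D n f"
  using D_scale_rows[of n c "\<lambda>i j. f j i"] D_transpose[of n f] D_transpose[of n "\<lambda>i j. c j * f i j"] by simp

text \<open>
  Multilinearity in all rows at once: the summation variable of each row is chosen separately.
\<close>

lemma D_sum_rows:
  assumes "\<And>i. i < n \<Longrightarrow> finite (A i)"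
  shows "D n (\<lambda>i j. \<Sum>y\<in>A i. f i y j) = (\<Sum>y\<in>PiE {..<n} A. D n (\<lambda>i j. f i (y i) j))"
proof -
  have "D n (\<lambda>i j. \<Sum>y\<in>A i. f i y j)
      = (\<Sum>p | p permutes {..<n}. signof p * (\<Sum>y\<in>PiE {..<n} A. \<Prod>i<n. f i (y i) (p i)))"
    unfolding D_expand using assms by (subst prod_sum_PiE) auto
  also have "\<dots> = (\<Sum>y\<in>PiE {..<n} A. D n (\<lambda>i j. f i (y i) j))"
    unfolding D_expand sum_distrib_left by (rule sum.swap)
  finally show ?thesis .
qed

lemma D_identical_rows:
  assumes "i < n" "k < n" "i \<noteq> k" "\<And>j. j < n \<Longrightarrow> f i j = f k j"
  shows "D n f = 0"
  unfolding D_def by (rule det_identical_rows[of _ n i k]) (use assms in \<open>auto intro!: eq_vecI\<close>)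

lemma D_permute_rows: "p permutes {..<n} \<Longrightarrow> D n (\<lambda>i j. f (p i) j) = signof p * D n f"
proof -
  assume p: "p permutes {..<n}"
  then have "det (mat n n (\<lambda>(i, j). mat n n (\<lambda>(i, j). f i j) $$ (p i, j))) = signof p * det (mat n n (\<lambda>(i, j). f i j))"
    by (intro det_permute_rows) (auto simp: atLeast0LessThan)
  moreover have "mat n n (\<lambda>(i, j). mat n n (\<lambda>(i, j). f i j) $$ (p i, j)) = mat n n (\<lambda>(i, j). f (p i) j)"
    using permutes_in_image[OF p] by (intro eq_matI) auto
  ultimately show ?thesis by (simp add: D_def)
qed

lemma D_row_differences:
  "D n (\<lambda>i j. f i j - (if i = 0 then 0 else f (i - 1) j)) = D n f"
proof -
  let ?L = "\<lambda>i k. if k = i then 1 else if Suc k = i then - 1 else 0 :: real"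
  have "(\<Sum>k<n. ?L i k * f k j) = f i j - (if i = 0 then 0 else f (i - 1) j)" if "i < n" for i j
  proof -
    have "(\<Sum>k<n. ?L i k * f k j) = (\<Sum>k<n. (if k = i then f k j else 0) - (if Suc k = i then f k j else 0))"
      by (rule sum.cong) auto
    also have "\<dots> = f i j - (\<Sum>k<n. if Suc k = i then f k j else 0)"
      using that by (simp add: sum_subtractf)
    also have "(\<Sum>k<n. if Suc k = i then f k j else 0) = (if i = 0 then 0 else f (i - 1) j)"
    proof (cases i)
      case (Suc m)
      then have "(\<Sum>k<n. if Suc k = i then f k j else 0) = (\<Sum>k<n. if k = m then f k j else 0)" by simp
      then show ?thesis using Suc that by simp
    qed simp
    finally show ?thesis .
  qed
  then have "D n (\<lambda>i j. f i j - (if i = 0 then 0 else f (i - 1) j)) = D n (\<lambda>i j. \<Sum>k<n. ?L i k * f k j)"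
    by (intro D_cong) simp
  also have "\<dots> = D n ?L * D n f" by (rule D_mult)
  also have "D n ?L = 1" by (subst D_lower) auto
  finally show ?thesis by simp
qed

lemma D_border:
  assumes "\<And>i. i < n \<Longrightarrow> f (Suc i) 0 = 0"
  shows "D (Suc n) f = f 0 0 * D n (\<lambda>i j. f (Suc i) (Suc j))"
proof -
  let ?A = "mat (Suc n) (Suc n) (\<lambda>(i, j). f i j)"
  have "det ?A = (\<Sum>i<Suc n. ?A $$ (i, 0) * cofactor ?A i 0)"
    by (rule laplace_expansion_column) auto
  also have "\<dots> = (\<Sum>i<Suc n. if i = 0 then f 0 0 * cofactor ?A 0 0 else 0)"
    by (rule sum.cong) (use assms gr0_conv_Suc in auto)
  also have "\<dots> = f 0 0 * cofactor ?A 0 0" by simp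
  also have "cofactor ?A 0 0 = D n (\<lambda>i j. f (Suc i) (Suc j))"
    unfolding cofactor_def D_def mat_delete_def by (auto intro!: arg_cong[where f = det] eq_matI)
  finally show ?thesis by (simp add: D_def)
qed

text \<open>
  With a first column of ones, passing to differences of consecutive rows removes one row and one column.
\<close>

lemma D_row_differences_const:
  assumes "\<And>i. i < Suc n \<Longrightarrow> f i 0 = 1"
  shows "D n (\<lambda>i j. f (Suc i) (Suc j) - f i (Suc j)) = D (Suc n) f"
proof -
  have "D (Suc n) f = D (Suc n) (\<lambda>i j. f i j - (if i = 0 then 0 else f (i - 1) j))"
    by (rule D_row_differences[symmetric])
  also have "\<dots> = D n (\<lambda>i j. f (Suc i) (Suc j) - f i (Suc j))"
    by (subst D_border) (use assms in auto)
  finally show ?thesis by simp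
qed

lemma D_monic_powers:
  assumes q: "\<And>j. j < n \<Longrightarrow> degree (q j) = j" "\<And>j. j < n \<Longrightarrow> lead_coeff (q j) = 1"
  shows "D n (\<lambda>i j. poly (q j) (x i)) = D n (\<lambda>i j. x i ^ j)"
proof -
  have "poly (q j) (x i) = (\<Sum>k<n. x i ^ k * coeff (q j) k)" if "j < n" for i j
  proof -
    have "poly (q j) (x i) = (\<Sum>k\<le>j. coeff (q j) k * x i ^ k)"
      using q(1)[OF that] by (simp add: poly_altdef)
    also have "\<dots> = (\<Sum>k<n. coeff (q j) k * x i ^ k)"
      by (rule sum.mono_neutral_left) (use that q(1)[OF that] in \<open>auto simp: coeff_eq_0\<close>)
    finally show ?thesis by (simp add: mult.commute)
  qed
  then have "D n (\<lambda>i j. poly (q j) (x i)) = D n (\<lambda>i j. \<Sum>k<n. x i ^ k * coeff (q j) k)"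
    by (intro D_cong) simp
  also have "\<dots> = D n (\<lambda>i j. x i ^ j) * D n (\<lambda>k j. coeff (q j) k)" by (rule D_mult)
  also have "D n (\<lambda>k j. coeff (q j) k) = (\<Prod>k<n. coeff (q k) k)"
    by (rule D_upper) (use q(1) in \<open>auto simp: coeff_eq_0\<close>)
  also have "\<dots> = 1" using q by (intro prod.neutral) auto
  finally show ?thesis by simp
qed

lemma degree_prod_linear:
  fixes a :: "nat \<Rightarrow> real"
  shows "degree (\<Prod>k<j. [:a k, 1:]) = j" "lead_coeff (\<Prod>k<j. [:a k, 1:]) = 1"
proof -
  show "lead_coeff (\<Prod>k<j. [:a k, 1:]) = 1" by (simp add: lead_coeff_prod)
  show "degree (\<Prod>k<j. [:a k, 1:]) = j" by (subst degree_prod_eq_sum_degree) auto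
qed

lemma D_vandermonde: "D n (\<lambda>i j. x i ^ j) = (\<Prod>j<n. \<Prod>i<j. x j - x i)"
proof -
  let ?q = "\<lambda>j. \<Prod>k<j. [:- x k, 1:]"
  have "D n (\<lambda>i j. x i ^ j) = D n (\<lambda>i j. poly (?q j) (x i))"
    by (rule D_monic_powers[symmetric]) (rule degree_prod_linear)+
  also have "\<dots> = D n (\<lambda>i j. \<Prod>k<j. x i - x k)"
    by (rule D_cong) (simp add: poly_prod)
  also have "\<dots> = (\<Prod>j<n. \<Prod>i<j. x j - x i)"
    by (rule D_lower) auto
  finally show ?thesis .
qed

lemma D_monic_products:
  "D n (\<lambda>i j. \<Prod>k<j. x i + a k) = (\<Prod>j<n. \<Prod>i<j. x j - x i)"
proof -
  have "D n (\<lambda>i j. \<Prod>k<j. x i + a k) = D n (\<lambda>i j. poly (\<Prod>k<j. [:a k, 1:]) (x i))"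
    by (rule D_cong) (simp add: poly_prod add.commute)
  also have "\<dots> = D n (\<lambda>i j. x i ^ j)"
    by (rule D_monic_powers) (rule degree_prod_linear)+
  finally show ?thesis by (simp add: D_vandermonde)
qed

section \<open>Trapezoids with dents as determinants\<close>

text \<open>
  Central forms of the binomial coefficients.  \<open>odd_fun j\<close> is an odd polynomial of degree \<open>2 * j + 1\<close> and
  \<open>even_fun j\<close> has degree \<open>2 * j\<close>.  By \<open>even_fun_diff\<close> and \<open>odd_fun_diff\<close> each is the central difference of
  another one of them.
\<close>

definition odd_fun :: "nat \<Rightarrow> real \<Rightarrow> real" where
  "odd_fun j X = (X + real j) gchoose (2 * j + 1)"

definition even_fun :: "nat \<Rightarrow> real \<Rightarrow> real" where
  "even_fun j v = (v + real j - 1 / 2) gchoose (2 * j)"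

lemma even_fun_0 [simp]: "even_fun 0 v = 1"
  by (simp add: even_fun_def)

lemma even_fun_diff: "odd_fun j (v + 1 / 2) - odd_fun j (v - 1 / 2) = even_fun j v"
  using gbinomial_Suc_Suc[of "v + real j - 1 / 2" "2 * j"]
  by (simp add: odd_fun_def even_fun_def algebra_simps)

lemma odd_fun_diff: "even_fun (Suc j) (X + 1 / 2) - even_fun (Suc j) (X - 1 / 2) = odd_fun j X"
  using gbinomial_Suc_Suc[of "X + real j" "2 * j + 1"]
  by (simp add: odd_fun_def even_fun_def algebra_simps)

lemma odd_fun_minus: "odd_fun j (- X) = - odd_fun j X"
  using gbinomial_negated_upper[of "- X + real j" "2 * j + 1"]
  by (simp add: odd_fun_def algebra_simps)

text \<open>
  A telescoping sum over the elements of the other parity between \<open>a\<close> and \<open>b\<close>.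
\<close>

lemma telescope_parity:
  fixes f :: "int \<Rightarrow> real"
  assumes "a \<le> b" "even (b - a)" "even (a - p)"
  shows "(\<Sum>c\<in>{c\<in>{a<..<b}. odd (c - p)}. f (c + 1) - f (c - 1)) = f b - f a"
proof -
  obtain n where b: "b = a + 2 * int n" using even_diff_obtain[OF assms(1,2)] .
  show ?thesis unfolding b
  proof (induction n)
    case (Suc n)
    have "{c\<in>{a<..<a + 2 * int (Suc n)}. odd (c - p)} =
      insert (a + 2 * int n + 1) {c\<in>{a<..<a + 2 * int n}. odd (c - p)}"
    proof (intro equalityI subsetI)
      fix c assume c: "c \<in> {c\<in>{a<..<a + 2 * int (Suc n)}. odd (c - p)}"
      then have "odd (c - a)" using assms(3) by auto
      then have "c \<noteq> a + 2 * int n" by auto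
      then show "c \<in> insert (a + 2 * int n + 1) {c\<in>{a<..<a + 2 * int n}. odd (c - p)}"
        using c by auto
    qed (use assms(3) in auto)
    moreover have "finite {c\<in>{a<..<a + 2 * int n}. odd (c - p)}"
      by (rule finite_subset[of _ "{a<..<a + 2 * int n}"]) auto
    ultimately show ?case using Suc by (simp add: algebra_simps)
  qed simp
qed

text \<open>
  \<open>odd_det\<close> will count trapezoids with dents whose lowest strip has even level, \<open>even_det\<close> those whose lowest strip has
  odd level.  The arguments \<open>d i\<close> and \<open>v i\<close> are the doubled abscissas of the dents.
\<close>

definition odd_det :: "nat \<Rightarrow> (nat \<Rightarrow> int) \<Rightarrow> real" where
  "odd_det m d = D m (\<lambda>i j. odd_fun j (of_int (d i) / 2))"

definition even_det :: "nat \<Rightarrow> (nat \<Rightarrow> int) \<Rightarrow> real" where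
  "even_det m v = D m (\<lambda>i j. even_fun j (of_int (v i) / 2))"

lemma finite_gap: "finite {c\<in>{a<..<b :: int}. P c}"
  by (rule finite_subset[of _ "{a<..<b}"]) auto

text \<open>
  Summation over the tuples \<open>u\<close> that interlace with \<open>v\<close>.  Row \<open>i\<close> telescopes to a difference of two rows of
  \<open>even_det\<close>, whose first column consists of ones.
\<close>

lemma sum_odd_det:
  fixes v :: "nat \<Rightarrow> int"
  assumes v: "\<And>i. i < n \<Longrightarrow> v i < v (Suc i)" "\<And>i. i \<le> n \<Longrightarrow> even (v i)"
  shows "(\<Sum>u\<in>PiE {..<n} (\<lambda>i. {c\<in>{v i<..<v (Suc i)}. odd c}). odd_det n u) = even_det (Suc n) v"
proof -
  have "(\<Sum>u\<in>PiE {..<n} (\<lambda>i. {c\<in>{v i<..<v (Suc i)}. odd c}). odd_det n u)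
    = D n (\<lambda>i j. \<Sum>c\<in>{c\<in>{v i<..<v (Suc i)}. odd c}. odd_fun j (of_int c / 2))"
    unfolding odd_det_def by (rule D_sum_rows[symmetric]) (rule finite_gap)
  also have "\<dots> = D n (\<lambda>i j. even_fun (Suc j) (of_int (v (Suc i)) / 2) - even_fun (Suc j) (of_int (v i) / 2))"
  proof (rule D_cong)
    fix i j assume i: "i < n"
    have "(\<Sum>c\<in>{c\<in>{v i<..<v (Suc i)}. odd c}. odd_fun j (of_int c / 2)) =
      (\<Sum>c\<in>{c\<in>{v i<..<v (Suc i)}. odd (c - 0)}. even_fun (Suc j) (of_int (c + 1) / 2) - even_fun (Suc j) (of_int (c - 1) / 2))"
      by (rule sum.cong) (auto simp: odd_fun_diff[symmetric] add_divide_distrib diff_divide_distrib)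
    also have "\<dots> = even_fun (Suc j) (of_int (v (Suc i)) / 2) - even_fun (Suc j) (of_int (v i) / 2)"
      by (rule telescope_parity) (use v(1)[OF i] v(2)[of i] v(2)[of "Suc i"] i in auto)
    finally show "(\<Sum>c\<in>{c\<in>{v i<..<v (Suc i)}. odd c}. odd_fun j (of_int c / 2)) =
      even_fun (Suc j) (of_int (v (Suc i)) / 2) - even_fun (Suc j) (of_int (v i) / 2)" .
  qed
  also have "\<dots> = even_det (Suc n) v"
    unfolding even_det_def by (rule D_row_differences_const) simp
  finally show ?thesis .
qed

text \<open>
  Summation over the tuples \<open>v\<close> that interlace with \<open>x\<close>, where \<open>x 0 = - 1\<close> is not the abscissa of a removed cell but
  marks the wall.  Only \<open>v 0\<close> can be at the wall.  The factor 1/2 halves the term for \<open>c = 0\<close>, and because \<open>odd_fun j\<close> is odd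
  this cancels the lower boundary term of the telescoping sum in the first row.
\<close>

lemma sum_even_det:
  fixes x :: "nat \<Rightarrow> int"
  assumes x: "\<And>i. i < m \<Longrightarrow> x i < x (Suc i)" "\<And>i. i \<le> m \<Longrightarrow> odd (x i)" and x0: "x 0 = - 1"
  shows "(\<Sum>v\<in>PiE {..<m} (\<lambda>i. {c\<in>{x i<..<x (Suc i)}. even c}).
      (if 0 \<in> v ` {..<m} then 1 / 2 else 1) * even_det m v) = odd_det m (\<lambda>i. x (Suc i))"
proof -
  let ?A = "\<lambda>i. {c\<in>{x i<..<x (Suc i)}. even c}"
  let ?w = "\<lambda>c :: int. if c = 0 then 1 / 2 else 1 :: real"
  have pos: "0 < x i" if "0 < i" "i \<le> m" for i
  proof -
    have "- 1 < x i" using strict_chain[of m x 0 i] x x0 that by auto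
    moreover have "x i \<noteq> 0" using x(2)[of i] that by auto
    ultimately show ?thesis by simp
  qed
  have w: "(if 0 \<in> v ` {..<m} then 1 / 2 else 1) = (\<Prod>i<m. ?w (v i))" if v: "v \<in> PiE {..<m} ?A" for v
  proof (cases m)
    case (Suc m')
    have "v (Suc i) \<noteq> 0" if "i < m'" for i
    proof -
      have "v (Suc i) \<in> ?A (Suc i)" using v that Suc by (auto simp: PiE_iff)
      then show ?thesis using pos[of "Suc i"] that Suc by auto
    qed
    then have 1: "(\<Prod>i<m'. ?w (v (Suc i))) = 1" "0 \<in> v ` {..<m} \<longleftrightarrow> v 0 = 0"
      unfolding Suc by (auto intro!: prod.neutral simp: image_iff Bex_def less_Suc_eq_0_disj)
    show ?thesis unfolding 1(2) unfolding Suc prod.lessThan_Suc_shift 1(1) by simp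
  qed simp
  have "(\<Sum>v\<in>PiE {..<m} ?A. (if 0 \<in> v ` {..<m} then 1 / 2 else 1) * even_det m v)
      = (\<Sum>v\<in>PiE {..<m} ?A. D m (\<lambda>i j. ?w (v i) * even_fun j (of_int (v i) / 2)))"
    by (rule sum.cong) (simp_all add: w D_scale_rows even_det_def)
  also have "\<dots> = D m (\<lambda>i j. \<Sum>c\<in>?A i. ?w c * even_fun j (of_int c / 2))"
    by (rule D_sum_rows[symmetric]) (rule finite_gap)
  also have "\<dots> = D m (\<lambda>i j. odd_fun j (of_int (x (Suc i)) / 2)
                 - (if i = 0 then 0 else odd_fun j (of_int (x (Suc (i - 1))) / 2)))"
  proof (rule D_cong)
    fix i j assume i: "i < m"
    have "(\<Sum>c\<in>?A i. even_fun j (of_int c / 2)) =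
      (\<Sum>c\<in>{c\<in>{x i<..<x (Suc i)}. odd (c - 1)}. odd_fun j (of_int (c + 1) / 2) - odd_fun j (of_int (c - 1) / 2))"
      by (rule sum.cong) (auto simp: even_fun_diff[symmetric] add_divide_distrib diff_divide_distrib)
    also have "\<dots> = odd_fun j (of_int (x (Suc i)) / 2) - odd_fun j (of_int (x i) / 2)"
      by (rule telescope_parity) (use x(1)[OF i] x(2)[of i] x(2)[of "Suc i"] i in auto)
    finally have tel: "(\<Sum>c\<in>?A i. even_fun j (of_int c / 2)) =
      odd_fun j (of_int (x (Suc i)) / 2) - odd_fun j (of_int (x i) / 2)" .
    show "(\<Sum>c\<in>?A i. ?w c * even_fun j (of_int c / 2)) = odd_fun j (of_int (x (Suc i)) / 2)
                 - (if i = 0 then 0 else odd_fun j (of_int (x (Suc (i - 1))) / 2))"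
    proof (cases "i = 0")
      case False
      then have "(\<Sum>c\<in>?A i. ?w c * even_fun j (of_int c / 2)) = (\<Sum>c\<in>?A i. even_fun j (of_int c / 2))"
        using pos[of i] i by (intro sum.cong) auto
      then show ?thesis using tel False by simp
    next
      case True
      have "0 \<in> ?A i" using True x0 pos[of 1] i by auto
      have "(\<Sum>c\<in>?A i. ?w c * even_fun j (of_int c / 2)) =
        (\<Sum>c\<in>?A i. even_fun j (of_int c / 2) - (if c = 0 then even_fun j 0 / 2 else 0))"
        by (rule sum.cong) auto
      also have "\<dots> = (\<Sum>c\<in>?A i. even_fun j (of_int c / 2)) - even_fun j 0 / 2"
        using \<open>0 \<in> ?A i\<close> finite_gap[of "x i" "x (Suc i)" even] by (simp add: sum_subtractf)
      \<comment> \<open>the halved term at the wall cancels the boundary term at \<open>x 0 / 2 = - 1 / 2\<close>\<close>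
      also have "even_fun j 0 = - 2 * odd_fun j (- 1 / 2)"
        using even_fun_diff[of j 0] odd_fun_minus[of j "1 / 2"] by simp
      finally show ?thesis using tel True x0 by simp
    qed
  qed
  also have "\<dots> = odd_det m (\<lambda>i. x (Suc i))"
    unfolding odd_det_def by (rule D_row_differences)
  finally show ?thesis .
qed

text \<open>
  The cells of the polygon with a zigzag of \<open>k\<close> periods in the west, a bottom side of length \<open>k + t\<close>, \<open>2 * k\<close> steps NW and
  a top side of length \<open>t\<close>.
\<close>

definition trap :: "nat \<Rightarrow> nat \<Rightarrow> node set" where
  "trap k t = {(q, c). - 2 * int k \<le> q \<and> q < 0 \<and> 0 \<le> c \<and> c \<le> 2 * int t - 1 - q}"

lemma finite_trap [simp]: "finite (trap k t)"
  by (rule finite_subset[of _ "{- 2 * int k..0} \<times> {0..2 * int t + 2 * int k}"]) (auto simp: trap_def)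

text \<open>
  The matching number of this trapezoid with the cells with abscissas in \<open>C\<close> removed from the lowest strip.  For \<open>k = 0\<close> there is no
  lowest strip, and only the removal of nothing is counted.
\<close>

definition trap_W :: "nat \<Rightarrow> nat \<Rightarrow> int set \<Rightarrow> real" where
  "trap_W k t C = (if k = 0 then (if C = {} then 1 else 0) else W (trap k t - {- 2 * int k} \<times> C))"

text \<open>
  The cut above the lowest strip.  The abscissas of the lozenges crossing it are even, so that their range
  may be taken to start at \<open>- 1\<close> instead of \<open>0\<close>.
\<close>

lemma trap_cut_lower:
  fixes k t :: nat
  assumes C: "\<And>c. c \<in> C \<Longrightarrow> odd c" "0 \<notin> C"
  defines "\<beta> \<equiv> 2 * int t + 2 * int k + 2"
  shows "trap_W (Suc k) t C = (\<Sum>V\<in>Pow {c\<in>{- 1..<\<beta>}. odd (c - 1)}.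
      W ({- 2 * int k - 2} \<times> ({0..<\<beta>} - C - V)) *
       ((if 0 \<in> V then 1 / 2 else 1) *
        W ({(q, c) \<in> trap (Suc k) t. - 2 * int k - 1 \<le> q} - {- 2 * int k - 1} \<times> V)))"
proof -
  let ?r = "- 2 * int k - 1"
  let ?A = "{(q, c) \<in> trap (Suc k) t. ?r \<le> q}"
  let ?B = "{?r - 1} \<times> ({0..<\<beta>} - C)"
  have fA: "finite ?A" by (rule finite_subset[OF _ finite_trap[of "Suc k" t]]) auto
  have eq: "trap (Suc k) t - {- 2 * int (Suc k)} \<times> C = ?A \<union> ?B"
    by (auto simp: trap_def \<beta>_def)
  have idx: "{c. odd (c - ?r) \<and> (?r, c) \<in> ?A \<and> (?r - 1, c) \<in> ?B} = {c\<in>{- 1..<\<beta>}. odd (c - 1)}"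
  proof (intro equalityI subsetI)
    fix c assume c: "c \<in> {c\<in>{- 1..<\<beta>}. odd (c - 1)}"
    then have "even c" "- 1 \<le> c" "c < \<beta>" by auto
    moreover then have "c \<noteq> - 1" "c \<noteq> \<beta> - 1" by (auto simp: \<beta>_def)
    ultimately show "c \<in> {c. odd (c - ?r) \<and> (?r, c) \<in> ?A \<and> (?r - 1, c) \<in> ?B}"
      using C by (auto simp: trap_def \<beta>_def)
  qed (auto simp: trap_def \<beta>_def)
  have "W (?A \<union> ?B) = (\<Sum>V\<in>Pow {c. odd (c - ?r) \<and> (?r, c) \<in> ?A \<and> (?r - 1, c) \<in> ?B}.
           (if 0 \<in> V then 1/2 else 1) * (W (?A - {?r} \<times> V) * W (?B - {?r - 1} \<times> V)))"
    by (rule W_level_cut) (use fA in auto)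
  also have "\<dots> = (\<Sum>V\<in>Pow {c\<in>{- 1..<\<beta>}. odd (c - 1)}.
      W ({- 2 * int k - 2} \<times> ({0..<\<beta>} - C - V)) * ((if 0 \<in> V then 1 / 2 else 1) * W (?A - {?r} \<times> V)))"
    unfolding idx
  proof (rule sum.cong[OF refl])
    fix V
    have "?B - {?r - 1} \<times> V = {- 2 * int k - 2} \<times> ({0..<\<beta>} - C - V)" by auto
    then show "(if 0 \<in> V then 1/2 else 1) * (W (?A - {?r} \<times> V) * W (?B - {?r - 1} \<times> V)) =
      W ({- 2 * int k - 2} \<times> ({0..<\<beta>} - C - V)) * ((if 0 \<in> V then 1 / 2 else 1) * W (?A - {?r} \<times> V))"
      by simp
  qed
  finally show ?thesis unfolding trap_W_def eq[symmetric] by simp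
qed

lemma trap_cut_upper:
  fixes k t :: nat
  assumes V: "\<And>c. c \<in> V \<Longrightarrow> even c"
  defines "\<beta> \<equiv> 2 * int t + 2 * int k + 1"
  shows "W ({(q, c) \<in> trap (Suc k) t. - 2 * int k - 1 \<le> q} - {- 2 * int k - 1} \<times> V) =
    (\<Sum>Y\<in>Pow {c\<in>{0..<\<beta>}. odd (c - 0)}. W ({- 2 * int k - 1} \<times> ({0..<\<beta>} - V - Y)) * trap_W k t Y)"
proof (cases "k = 0")
  case True
  let ?P = "{c\<in>{0..<\<beta>}. odd (c - 0)}"
  have fP: "finite ?P" by (rule finite_subset[of _ "{0..<\<beta>}"]) auto
  have "(\<Sum>Y\<in>Pow ?P. W ({- 2 * int k - 1} \<times> ({0..<\<beta>} - V - Y)) * trap_W k t Y)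
     = (\<Sum>Y\<in>Pow ?P. if Y = {} then W ({- 2 * int k - 1} \<times> ({0..<\<beta>} - V - Y)) else 0)"
    by (rule sum.cong) (auto simp: trap_W_def True)
  also have "\<dots> = W ({- 2 * int k - 1} \<times> ({0..<\<beta>} - V))"
    using fP by (simp add: sum.delta)
  also have "{- 2 * int k - 1} \<times> ({0..<\<beta>} - V) = {(q, c) \<in> trap (Suc k) t. - 2 * int k - 1 \<le> q} - {- 2 * int k - 1} \<times> V"
    by (auto simp: trap_def True \<beta>_def)
  finally show ?thesis by simp
next
  case False
  let ?r = "- 2 * int k"
  let ?B = "{?r - 1} \<times> ({0..<\<beta>} - V)"
  have eq: "{(q, c) \<in> trap (Suc k) t. - 2 * int k - 1 \<le> q} - {- 2 * int k - 1} \<times> V = trap k t \<union> ?B"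
    by (auto simp: trap_def \<beta>_def)
  have idx: "{c. odd (c - ?r) \<and> (?r, c) \<in> trap k t \<and> (?r - 1, c) \<in> ?B} = {c\<in>{0..<\<beta>}. odd (c - 0)}"
  proof (intro equalityI subsetI)
    fix c assume c: "c \<in> {c\<in>{0..<\<beta>}. odd (c - 0)}"
    then have "odd c" "0 \<le> c" "c < \<beta>" by auto
    moreover then have "c \<noteq> \<beta> - 1" by (auto simp: \<beta>_def)
    ultimately show "c \<in> {c. odd (c - ?r) \<and> (?r, c) \<in> trap k t \<and> (?r - 1, c) \<in> ?B}"
      using V False by (auto simp: trap_def \<beta>_def)
  qed (auto simp: trap_def \<beta>_def)
  have "W (trap k t \<union> ?B) = (\<Sum>Y\<in>Pow {c. odd (c - ?r) \<and> (?r, c) \<in> trap k t \<and> (?r - 1, c) \<in> ?B}.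
           (if 0 \<in> Y then 1/2 else 1) * (W (trap k t - {?r} \<times> Y) * W (?B - {?r - 1} \<times> Y)))"
    by (rule W_level_cut) (simp_all, auto simp: trap_def)
  also have "\<dots> = (\<Sum>Y\<in>Pow {c\<in>{0..<\<beta>}. odd (c - 0)}. W ({- 2 * int k - 1} \<times> ({0..<\<beta>} - V - Y)) * trap_W k t Y)"
    unfolding idx
  proof (rule sum.cong[OF refl])
    fix Y assume Y: "Y \<in> Pow {c\<in>{0..<\<beta>}. odd (c - 0)}"
    then have "0 \<notin> Y" by auto
    moreover have "?B - {?r - 1} \<times> Y = {- 2 * int k - 1} \<times> ({0..<\<beta>} - V - Y)" by auto
    ultimately show "(if 0 \<in> Y then 1/2 else 1) * (W (trap k t - {?r} \<times> Y) * W (?B - {?r - 1} \<times> Y)) =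
      W ({- 2 * int k - 1} \<times> ({0..<\<beta>} - V - Y)) * trap_W k t Y"
      using False by (simp add: trap_W_def)
  qed
  finally show ?thesis unfolding eq .
qed

lemma trap_step:
  fixes x :: "nat \<Rightarrow> int"
  assumes x: "\<And>i. i < m \<Longrightarrow> x i < x (Suc i)" "\<And>i. i \<le> m \<Longrightarrow> odd (x i)" and x0: "x 0 = - 1"
    and xm: "x m < 2 * int t + 2 * int (Suc k)"
  shows "trap_W (Suc k) t (x ` {1..m}) =
    (\<Sum>v\<in>PiE {..<m} (\<lambda>i. {c\<in>{x i<..<x (Suc i)}. even c}).
      (if 0 \<in> v ` {..<m} then 1 / 2 else 1) *
      W ({(q, c) \<in> trap (Suc k) t. - 2 * int k - 1 \<le> q} - {- 2 * int k - 1} \<times> v ` {..<m}))"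
proof -
  define \<beta> where "\<beta> = 2 * int t + 2 * int k + 2"
  let ?g = "\<lambda>V. (if 0 \<in> V then 1 / 2 else 1) *
      W ({(q, c) \<in> trap (Suc k) t. - 2 * int k - 1 \<le> q} - {- 2 * int k - 1} \<times> V)"
  have xs: "{0..<\<beta>} - x ` {1..m} = {- 1..<\<beta>} - x ` {..m}"
  proof -
    have "{..m} = insert 0 {1..m}" by auto
    then have "x ` {..m} = insert (- 1) (x ` {1..m})" using x0 by auto
    then show ?thesis by auto
  qed
  have "trap_W (Suc k) t (x ` {1..m}) = (\<Sum>V\<in>Pow {c\<in>{- 1..<\<beta>}. odd (c - 1)}.
      W ({- 2 * int k - 2} \<times> ({0..<\<beta>} - x ` {1..m} - V)) * ?g V)"
    unfolding \<beta>_def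
  proof (rule trap_cut_lower)
    show "odd c" if "c \<in> x ` {1..m}" for c using that x(2) by auto
    then show "0 \<notin> x ` {1..m}" by (metis even_zero)
  qed
  also have "\<dots> = (\<Sum>y\<in>PiE {..<m} (\<lambda>i. {c\<in>{x i<..<x (Suc i)}. odd (c - 1)}). ?g (y ` {..<m}))"
    unfolding xs by (rule strip_sum) (use x x0 xm in \<open>auto simp: \<beta>_def\<close>)
  finally show ?thesis by simp
qed

lemma trap_step_upper:
  fixes v :: "nat \<Rightarrow> int"
  assumes v: "\<And>i. i < n \<Longrightarrow> v i < v (Suc i)" "\<And>i. i \<le> n \<Longrightarrow> even (v i)" and v0: "0 \<le> v 0"
    and vn: "v n < 2 * int t + 2 * int k + 1"
  shows "W ({(q, c) \<in> trap (Suc k) t. - 2 * int k - 1 \<le> q} - {- 2 * int k - 1} \<times> v ` {..<Suc n}) =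
    (\<Sum>u\<in>PiE {..<n} (\<lambda>i. {c\<in>{v i<..<v (Suc i)}. odd c}). trap_W k t (u ` {..<n}))"
proof -
  define \<beta> where "\<beta> = 2 * int t + 2 * int k + 1"
  have "W ({(q, c) \<in> trap (Suc k) t. - 2 * int k - 1 \<le> q} - {- 2 * int k - 1} \<times> v ` {..<Suc n}) =
    (\<Sum>Y\<in>Pow {c\<in>{0..<\<beta>}. odd (c - 0)}. W ({- 2 * int k - 1} \<times> ({0..<\<beta>} - v ` {..<Suc n} - Y)) * trap_W k t Y)"
    unfolding \<beta>_def by (rule trap_cut_upper) (use v(2) in auto)
  also have "\<dots> = (\<Sum>u\<in>PiE {..<n} (\<lambda>i. {c\<in>{v i<..<v (Suc i)}. odd (c - 0)}). trap_W k t (u ` {..<n}))"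
    unfolding lessThan_Suc_atMost
    by (rule strip_sum) (use v v0 vn in \<open>auto simp: \<beta>_def\<close>)
  finally show ?thesis by simp
qed

lemma trap_upper_empty:
  "W ({(q, c) \<in> trap (Suc k) t. - 2 * int k - 1 \<le> q} - {- 2 * int k - 1} \<times> {}) = 0"
proof -
  define \<beta> where "\<beta> = 2 * int t + 2 * int k + 1"
  have "W ({- 2 * int k - 1} \<times> ({0..<\<beta>} - {} - Y)) = 0" if Y: "Y \<in> Pow {c\<in>{0..<\<beta>}. odd (c - 0)}" for Y
  proof (rule ccontr)
    assume "W ({- 2 * int k - 1} \<times> ({0..<\<beta>} - {} - Y)) \<noteq> 0"
    then have z: "parity_sum ({0..<\<beta>} - {} - Y) = 0" by (intro W_strip_balanced) auto
    have "Y \<subseteq> {0..<\<beta>}" using Y by auto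
    then have fY: "finite Y" by (rule finite_subset) simp
    have "parity_sum {0..<\<beta>} = 1"
      using parity_sum_Suc[of 0 "0 + 2 * int (t + k)"] parity_sum_even_interval[of 0 "t + k"]
      by (simp add: \<beta>_def algebra_simps)
    moreover have "parity_sum ({0..<\<beta>} - Y) = parity_sum {0..<\<beta>} - parity_sum Y"
      unfolding parity_sum_def by (rule sum_diff) (use Y in auto)
    moreover have "parity_sum Y = (\<Sum>c\<in>Y. - 1)"
      unfolding parity_sum_def by (rule sum.cong) (use Y in auto)
    ultimately show False using z by simp
  qed
  then show ?thesis
    by (subst trap_cut_upper) (auto simp: \<beta>_def intro!: sum.neutral)
qed

text \<open>
  Two strips are peeled off in each step: \<open>trap_step\<close> sums over the vertical lozenges between them and \<open>trap_step_upper\<close>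
  over those above them.  The parities of the strips make the first sum a \<open>sum_even_det\<close> and the second one
  a \<open>sum_odd_det\<close>.
\<close>

theorem trap_W_det:
  assumes d: "\<And>i. Suc i < m \<Longrightarrow> d i < d (Suc i)" "\<And>i. i < m \<Longrightarrow> odd (d i) \<and> 0 < d i \<and> d i < 2 * int t + 2 * int k"
  shows "trap_W k t (d ` {..<m}) = (if m = k then odd_det m d else 0)"
  using d
proof (induction k arbitrary: m d)
  case 0
  then show ?case by (auto simp: trap_W_def odd_det_def lessThan_empty_iff)
next
  case (Suc k)
  \<comment> \<open>the dents, preceded by the marker \<open>- 1\<close> of the wall\<close>
  define x where "x = (\<lambda>i. if i = 0 then - 1 else d (i - 1))"
  have x: "x i < x (Suc i)" if "i < m" for i
    using Suc.prems(1)[of "i - 1"] Suc.prems(2)[of 0] that by (cases i) (auto simp: x_def)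
  have xo: "odd (x i)" if "i \<le> m" for i
    using Suc.prems(2)[of "i - 1"] that by (cases i) (auto simp: x_def)
  have x0: "x 0 = - 1" by (simp add: x_def)
  have xm: "x m < 2 * int t + 2 * int (Suc k)" using Suc.prems(2)[of "m - 1"] by (cases m) (auto simp: x_def)
  have img: "d ` {..<m} = x ` {1..m}"
    by (force simp: x_def image_iff Bex_def intro: exI[of _ "Suc _"])
  have step: "trap_W (Suc k) t (d ` {..<m}) =
    (\<Sum>v\<in>PiE {..<m} (\<lambda>i. {c\<in>{x i<..<x (Suc i)}. even c}).
      (if 0 \<in> v ` {..<m} then 1 / 2 else 1) *
      W ({(q, c) \<in> trap (Suc k) t. - 2 * int k - 1 \<le> q} - {- 2 * int k - 1} \<times> v ` {..<m}))"
    unfolding img by (rule trap_step[OF x xo x0 xm])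
  show ?case
  proof (cases m)
    case 0
    then show ?thesis using step trap_upper_empty[of k t] by simp
  next
    case (Suc n)
    let ?E = "PiE {..<m} (\<lambda>i. {c\<in>{x i<..<x (Suc i)}. even c})"
    have "trap_W (Suc k) t (d ` {..<m}) = (\<Sum>v\<in>?E. (if 0 \<in> v ` {..<m} then 1 / 2 else 1) *
       (if n = k then even_det m v else 0))"
    proof (subst step, rule sum.cong[OF refl])
      fix v assume v: "v \<in> ?E"
      have vi: "x i < v i" "v i < x (Suc i)" "even (v i)" if "i < m" for i using v that by (auto simp: PiE_iff)
      have v1: "v i < v (Suc i)" if "i < n" for i
        using vi(2)[of i] vi(1)[of "Suc i"] that Suc by auto
      have v2: "even (v i)" if "i \<le> n" for i using vi(3)[of i] that Suc by auto
      have v0: "0 \<le> v 0" using vi(1)[of 0] Suc x0 by auto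
      have vn: "v n < 2 * int t + 2 * int k + 1"
      proof -
        have "v n < x m" using vi(2)[of n] Suc by auto
        then have "v n < 2 * int t + 2 * int k + 2 - 1" using xm by auto
        then show ?thesis by auto
      qed
      have "W ({(q, c) \<in> trap (Suc k) t. - 2 * int k - 1 \<le> q} - {- 2 * int k - 1} \<times> v ` {..<m})
        = (\<Sum>u\<in>PiE {..<n} (\<lambda>i. {c\<in>{v i<..<v (Suc i)}. odd c}). trap_W k t (u ` {..<n}))"
        unfolding Suc by (rule trap_step_upper[OF v1 v2 v0 vn])
      also have "\<dots> = (\<Sum>u\<in>PiE {..<n} (\<lambda>i. {c\<in>{v i<..<v (Suc i)}. odd c}). if n = k then odd_det n u else 0)"
      proof (rule sum.cong[OF refl])
        fix u assume u: "u \<in> PiE {..<n} (\<lambda>i. {c\<in>{v i<..<v (Suc i)}. odd c})"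
        have ui: "v i < u i" "u i < v (Suc i)" "odd (u i)" if "i < n" for i using u that by (auto simp: PiE_iff)
        have b: "0 < u i \<and> u i < 2 * int t + 2 * int k" if "i < n" for i
        proof -
          have "v 0 \<le> v i" "v (Suc i) \<le> v n"
            using strict_chain[of n v 0 i] strict_chain[of n v "Suc i" n] v1 that
            by (cases "i = 0"; cases "Suc i = n"; auto)+
          then show ?thesis using ui[OF that] v0 vn by auto
        qed
        show "trap_W k t (u ` {..<n}) = (if n = k then odd_det n u else 0)"
        proof (rule Suc.IH)
          show "u i < u (Suc i)" if "Suc i < n" for i
            using ui(2)[of i] ui(1)[of "Suc i"] that by linarith
          show "odd (u i) \<and> 0 < u i \<and> u i < 2 * int t + 2 * int k" if "i < n" for i
            using ui(3) b that by blast
        qed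
      qed
      also have "\<dots> = (if n = k then (\<Sum>u\<in>PiE {..<n} (\<lambda>i. {c\<in>{v i<..<v (Suc i)}. odd c}). odd_det n u) else 0)"
        by simp
      also have "\<dots> = (if n = k then even_det m v else 0)"
        using sum_odd_det[of n v, OF v1 v2] unfolding Suc by (simp only:)
      finally show "(if 0 \<in> v ` {..<m} then 1 / 2 else 1) *
          W ({(q, c) \<in> trap (Suc k) t. - 2 * int k - 1 \<le> q} - {- 2 * int k - 1} \<times> v ` {..<m}) =
          (if 0 \<in> v ` {..<m} then 1 / 2 else 1) * (if n = k then even_det m v else 0)" by simp
    qed
    also have "\<dots> = (if n = k then odd_det m (\<lambda>i. x (Suc i)) else 0)"
      using sum_even_det[OF x xo x0] by simp
    finally show ?thesis using Suc by (simp add: x_def)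
  qed
qed

section \<open>The product formula for trapezoids with dents\<close>

text \<open>
  The product that gives the dependence of the tiling number of a trapezoid on its dents.  The position \<open>d\<close> of a
  dent, counted from \<open>1\<close> at the wall, corresponds to the abscissa \<open>d - 1 / 2\<close>, and
  \<open>(e - d) * (e + d - 1)\<close> is \<open>(e - 1 / 2)\<^sup>2 - (d - 1 / 2)\<^sup>2\<close>.
\<close>

definition V :: "nat set \<Rightarrow> real" where
  "V S = (\<Prod>d\<in>S. real d - 1 / 2) *
         (\<Prod>e\<in>S. \<Prod>d\<in>{d\<in>S. d < e}. (real e - real d) * (real e + real d - 1))"

text \<open>
  The leading coefficients of the polynomials \<open>odd_fun j\<close> for \<open>j < k\<close>.
\<close>

definition trap_const :: "nat \<Rightarrow> real" where
  "trap_const k = (\<Prod>j<k. 1 / fact (2 * j + 1))"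

text \<open>
  The weighted number of tilings of a trapezoid with \<open>2 * k\<close> strips whose dents are at the positions \<open>S\<close>.  Its
  width does not matter, as long as it contains \<open>S\<close>.
\<close>

definition trap_count :: "nat \<Rightarrow> nat set \<Rightarrow> real" where
  "trap_count k S = (if card S = k then trap_const k * V S else 0)"

text \<open>
  The doubled abscissas of the up-pointing triangles at the positions \<open>S\<close> of the bottom row.
\<close>

definition dents :: "nat set \<Rightarrow> int set" where
  "dents S = (\<lambda>d. 2 * int d - 1) ` S"

lemma odd_fun_product:
  "odd_fun j X = 1 / fact (2 * j + 1) * (X * (\<Prod>l<j. X ^ 2 + (- ((real l + 1) ^ 2))))"
proof -
  have "(\<Prod>i<2 * j + 1. X + real j - real i) = X * (\<Prod>l<j. X ^ 2 + (- ((real l + 1) ^ 2)))"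
  proof (induction j)
    case (Suc j)
    define Y where "Y = X + real j"
    have "(\<Prod>i<2 * Suc j + 1. X + real (Suc j) - real i) = (\<Prod>i<Suc (Suc (2 * j + 1)). Y + 1 - real i)"
      by (simp add: Y_def algebra_simps)
    also have "\<dots> = (Y + 1) * (\<Prod>i<Suc (2 * j + 1). Y - real i)"
      by (subst prod.lessThan_Suc_shift) simp
    also have "\<dots> = (Y + 1) * ((\<Prod>i<2 * j + 1. Y - real i) * (Y - real (2 * j + 1)))"
      by (subst prod.lessThan_Suc) simp
    finally have "(\<Prod>i<2 * Suc j + 1. X + real (Suc j) - real i) =
       (\<Prod>i<2 * j + 1. X + real j - real i) * ((Y + 1) * (Y - real (2 * j + 1)))"
      unfolding Y_def by (simp only: mult_ac)
    moreover have "(Y + 1) * (Y - real (2 * j + 1)) = X ^ 2 + (- ((real j + 1) ^ 2))"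
      by (simp add: Y_def power2_eq_square algebra_simps)
    ultimately show ?case using Suc by (simp only: prod.lessThan_Suc mult.assoc)
  qed simp
  then show ?thesis
    unfolding odd_fun_def gbinomial_prod_rev by (simp add: atLeast0LessThan)
qed

text \<open>
  Up to the factor \<open>X\<close> and its leading coefficient, \<open>odd_fun j X\<close> is a monic polynomial of degree \<open>j\<close> in \<open>X\<^sup>2\<close>.
\<close>

lemma odd_det_product:
  "odd_det k (\<lambda>i. 2 * int (d i) - 1) = trap_const k *
     ((\<Prod>i<k. real (d i) - 1 / 2) * (\<Prod>j<k. \<Prod>i<j. (real (d j) - real (d i)) * (real (d j) + real (d i) - 1)))"
proof -
  let ?X = "\<lambda>i. real (d i) - 1 / 2"
  have "odd_det k (\<lambda>i. 2 * int (d i) - 1) = D k (\<lambda>i j. 1 / fact (2 * j + 1) * (?X i * (\<Prod>l<j. (?X i) ^ 2 + (- ((real l + 1) ^ 2)))))"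
    unfolding odd_det_def by (rule D_cong) (simp add: odd_fun_product diff_divide_distrib)
  also have "\<dots> = trap_const k * ((\<Prod>i<k. ?X i) * (\<Prod>j<k. \<Prod>i<j. (?X j) ^ 2 - (?X i) ^ 2))"
    unfolding D_scale_cols D_scale_rows D_monic_products trap_const_def ..
  also have "(\<Prod>j<k. \<Prod>i<j. (?X j) ^ 2 - (?X i) ^ 2) = (\<Prod>j<k. \<Prod>i<j. (real (d j) - real (d i)) * (real (d j) + real (d i) - 1))"
    by (intro prod.cong refl) (simp add: power2_eq_square algebra_simps)
  finally show ?thesis .
qed

lemma sorted_enumeration:
  fixes S :: "nat set"
  assumes "finite S"
  obtains d where "bij_betw d {..<card S} S" "\<And>i j. i < j \<Longrightarrow> j < card S \<Longrightarrow> d i < d j"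
proof
  let ?xs = "sorted_list_of_set S"
  show "bij_betw (\<lambda>i. ?xs ! i) {..<card S} S"
    using assms by (intro bij_betw_nth) auto
  show "?xs ! i < ?xs ! j" if "i < j" "j < card S" for i j
    using that assms sorted_wrt_nth_less[of "(<)" ?xs i j] by (auto simp: strict_sorted_list_of_set)
qed

lemma V_enumeration:
  fixes d :: "nat \<Rightarrow> nat"
  assumes d: "bij_betw d {..<m} S" "\<And>i j. i < j \<Longrightarrow> j < m \<Longrightarrow> d i < d j"
  shows "V S = (\<Prod>i<m. real (d i) - 1 / 2) * (\<Prod>j<m. \<Prod>i<j. (real (d j) - real (d i)) * (real (d j) + real (d i) - 1))"
proof -
  have inj: "inj_on d {..<m}" and img: "S = d ` {..<m}" using d(1) by (auto simp: bij_betw_def)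
  have re: "prod h S = (\<Prod>j<m. h (d j))" for h :: "nat \<Rightarrow> real"
    by (rule prod.reindex_bij_betw[OF d(1), symmetric])
  have "(\<Prod>e\<in>S. \<Prod>c\<in>{c\<in>S. c < e}. (real e - real c) * (real e + real c - 1)) =
     (\<Prod>j<m. \<Prod>c\<in>{c\<in>S. c < d j}. (real (d j) - real c) * (real (d j) + real c - 1))"
    by (rule re)
  also have "\<dots> = (\<Prod>j<m. \<Prod>i<j. (real (d j) - real (d i)) * (real (d j) + real (d i) - 1))"
  proof (rule prod.cong[OF refl])
    fix j assume j: "j \<in> {..<m}"
    have lt: "d i < d j \<longleftrightarrow> i < j" if "i < m" for i
      using d(2)[of i j] d(2)[of j i] j that by (cases rule: linorder_cases[of i j]) auto
    have "{c\<in>S. c < d j} = d ` {..<j}" using lt j by (auto simp: img)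
    moreover have "inj_on d {..<j}" using inj j by (auto intro: inj_on_subset)
    ultimately show "(\<Prod>c\<in>{c\<in>S. c < d j}. (real (d j) - real c) * (real (d j) + real c - 1)) =
       (\<Prod>i<j. (real (d j) - real (d i)) * (real (d j) + real (d i) - 1))"
      by (simp add: prod.reindex)
  qed
  finally show ?thesis unfolding V_def using re[of "\<lambda>d. real d - 1 / 2"] by simp
qed

theorem trap_dents:
  assumes S: "S \<subseteq> {1..k + t}"
  shows "trap_W k t (dents S) = trap_count k S"
proof -
  have fin: "finite S" using S finite_subset by blast
  obtain d where d: "bij_betw d {..<card S} S" "\<And>i j. i < j \<Longrightarrow> j < card S \<Longrightarrow> d i < d j"
    using sorted_enumeration[OF fin] by metis
  have r: "1 \<le> d i \<and> d i \<le> k + t" if "i < card S" for i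
  proof -
    have "d i \<in> S" using bij_betwE[OF d(1)] that by blast
    then show ?thesis using S by auto
  qed
  have "dents S = (\<lambda>i. 2 * int (d i) - 1) ` {..<card S}"
    using bij_betw_imp_surj_on[OF d(1)] by (force simp: dents_def)
  also have "trap_W k t \<dots> = (if card S = k then odd_det (card S) (\<lambda>i. 2 * int (d i) - 1) else 0)"
  proof (rule trap_W_det)
    show "2 * int (d i) - 1 < 2 * int (d (Suc i)) - 1" if "Suc i < card S" for i using d(2)[of i "Suc i"] that by simp
    show "odd (2 * int (d i) - 1) \<and> 0 < 2 * int (d i) - 1 \<and> 2 * int (d i) - 1 < 2 * int t + 2 * int k"
      if "i < card S" for i using r[OF that] by auto
  qed
  also have "\<dots> = trap_count k S"
    by (simp add: trap_count_def odd_det_product V_enumeration[OF d])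
  finally show ?thesis .
qed

section \<open>Removed triangles and forced lozenges\<close>

text \<open>
  The abscissas of \<open>n\<close> consecutive cells of the same orientation, starting at \<open>a\<close>.
\<close>

definition base :: "int \<Rightarrow> nat \<Rightarrow> int set" where
  "base a n = (\<lambda>i. a + 2 * int i) ` {..<n}"

text \<open>
  The cells of the up-pointing triangle of side \<open>n\<close> whose bottom side lies on level \<open>q\<close> and whose leftmost cell in the
  bottom row is \<open>(q, a)\<close> (if \<open>a - q\<close> is odd).
\<close>

definition triangle :: "int \<Rightarrow> int \<Rightarrow> nat \<Rightarrow> node set" where
  "triangle q a n = {(r, c). q \<le> r \<and> r < q + int n \<and> a + (r - q) \<le> c \<and> c \<le> a + 2 * (int n - 1) - (r - q)}"

text \<open>
  The product of the weights of the lozenges that are forced in a triangle of side \<open>n\<close> starting at abscissa \<open>a\<close> by the removal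
  of its bottom row of up-pointing unit triangles: row by row one vertical lozenge less, each row shifted by one.
\<close>

fun wall_factor :: "int \<Rightarrow> nat \<Rightarrow> real" where
  "wall_factor a 0 = 1"
| "wall_factor a (Suc n) = (if 0 \<in> base (a + 1) n then 1 / 2 else 1) * wall_factor (a + 1) n"

lemma base_iff: "c \<in> base a n \<longleftrightarrow> a \<le> c \<and> c \<le> a + 2 * (int n - 1) \<and> even (c - a)"
proof
  assume r: "a \<le> c \<and> c \<le> a + 2 * (int n - 1) \<and> even (c - a)"
  then obtain i where "c = a + 2 * int i" using even_diff_obtain[of a c] by blast
  then show "c \<in> base a n" using r by (auto simp: base_def)
qed (auto simp: base_def)

lemma wall_factor_pos: "0 \<le> a \<Longrightarrow> wall_factor a n = 1"
  by (induction n arbitrary: a) (auto simp: base_iff)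

text \<open>
  A triangle of side \<open>2 * m\<close> that is halved by the wall meets it in \<open>m\<close> vertical lozenges.
\<close>

lemma wall_factor_half: "wall_factor (1 - 2 * int m) (2 * m) = (1 / 2) ^ m"
proof (induction m)
  case (Suc m)
  have e: "2 * Suc m = Suc (Suc (2 * m))" by simp
  have "1 - 2 * int (Suc m) + 1 + 1 = 1 - 2 * int m" by simp
  then show ?case unfolding e wall_factor.simps using Suc by (simp add: base_iff)
qed simp

text \<open>
  A set \<open>P\<close> of cells in strip \<open>q\<close> both of whose neighbours in the strip are missing: the vertical lozenges at \<open>P\<close> are forced.
\<close>

lemma W_forced_row:
  assumes "finite P" "finite R"
    and "\<And>c. c \<in> P \<Longrightarrow> (q, c) \<in> R \<and> (q + 1, c) \<in> R \<and> (q, c - 1) \<notin> R \<and> (q, c + 1) \<notin> R \<and> even (c - q)"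
  shows "W R = (if 0 \<in> P then 1 / 2 else 1) * W (R - {q, q + 1} \<times> P)"
  using assms
proof (induction P arbitrary: R rule: finite_induct)
  case (insert c P)
  note c = insert.prems(2)[of c, simplified]
  have "W R = wall_weight {(q, c), (q + 1, c)} * W (R - {(q, c), (q + 1, c)})"
  proof (rule W_forced)
    fix u assume u: "u \<in> R" "adjacent_pair {(q, c), u}"
    obtain r d where [simp]: "u = (r, d)" by fastforce
    show "u = (q + 1, c)" using u c by (auto simp: adjacent_pair_iff)
  qed (use c insert.prems(1) in \<open>auto simp: adjacent_pair_iff\<close>)
  also have "W (R - {(q, c), (q + 1, c)}) = (if 0 \<in> P then 1 / 2 else 1) * W (R - {(q, c), (q + 1, c)} - {q, q + 1} \<times> P)"
  proof (rule insert.IH)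
    fix d assume d: "d \<in> P"
    then have "d \<noteq> c" using insert.hyps by auto
    then show "(q, d) \<in> R - {(q, c), (q + 1, c)} \<and> (q + 1, d) \<in> R - {(q, c), (q + 1, c)} \<and>
       (q, d - 1) \<notin> R - {(q, c), (q + 1, c)} \<and> (q, d + 1) \<notin> R - {(q, c), (q + 1, c)} \<and> even (d - q)"
      using insert.prems(2)[of d] d by auto
  qed (use insert.prems in auto)
  also have "R - {(q, c), (q + 1, c)} - {q, q + 1} \<times> P = R - {q, q + 1} \<times> insert c P" by auto
  finally show ?case using insert.hyps by (auto simp: wall_weight_iff)
qed simp

text \<open>
  Removing the up-pointing unit triangles along the bottom side of a triangle is, up to the weights of forced lozenges, the same as
  removing the whole triangle.  The triangle may extend beyond the wall, where the region has no cells.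
\<close>

lemma W_fill:
  assumes "finite R" "\<And>r c. (r, c) \<in> R \<Longrightarrow> 0 \<le> c" "odd (a - q)"
    "\<And>r c. (r, c) \<in> triangle q a n \<Longrightarrow> 0 \<le> c \<Longrightarrow> (r, c) \<in> R"
  shows "W (R - {q} \<times> base a n) = wall_factor a n * W (R - triangle q a n)"
  using assms
proof (induction n arbitrary: q a R)
  case 0
  moreover have "triangle q a 0 = {}" by (auto simp: triangle_def)
  ultimately show ?case by (simp add: base_def)
next
  case (Suc n)
  let ?P = "base (a + 1) n \<inter> {0..}"
  let ?R2 = "R - {q} \<times> {a..a + 2 * int n}"
  have fP: "finite ?P" by (simp add: base_def)
  have "W (R - {q} \<times> base a (Suc n)) = (if 0 \<in> ?P then 1 / 2 else 1) *
      W (R - {q} \<times> base a (Suc n) - {q, q + 1} \<times> ?P)"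
  proof (rule W_forced_row[OF fP])
    fix c assume c: "c \<in> ?P"
    then have c': "a + 1 \<le> c" "c \<le> a + 1 + 2 * (int n - 1)" "even (c - (a + 1))" "0 \<le> c"
      by (auto simp: base_iff)
    have par: "odd (c - a)" "even (c - 1 - a)" "even (c + 1 - a)" using c'(3) by auto
    have "(q, c) \<in> R" "(q + 1, c) \<in> R"
      using Suc.prems(4)[of q c] Suc.prems(4)[of "q + 1" c] c' by (auto simp: triangle_def)
    moreover have "c \<notin> base a (Suc n)" using par by (auto simp: base_iff)
    moreover have "c - 1 \<in> base a (Suc n)" "c + 1 \<in> base a (Suc n)" using par c' by (auto simp: base_iff)
    moreover have "even (c - q)" using par(1) Suc.prems(3) by auto
    ultimately show "(q, c) \<in> R - {q} \<times> base a (Suc n) \<and> (q + 1, c) \<in> R - {q} \<times> base a (Suc n) \<and>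
      (q, c - 1) \<notin> R - {q} \<times> base a (Suc n) \<and> (q, c + 1) \<notin> R - {q} \<times> base a (Suc n) \<and> even (c - q)"
      by auto
  qed (use Suc.prems(1) in simp)
  also have "R - {q} \<times> base a (Suc n) - {q, q + 1} \<times> ?P = ?R2 - {q + 1} \<times> base (a + 1) n"
  proof -
    have "c \<in> base a (Suc n) \<or> c \<in> base (a + 1) n \<longleftrightarrow> a \<le> c \<and> c \<le> a + 2 * int n" for c
      by (cases "even (c - a)") (auto simp: base_iff, presburger+)
    then show ?thesis using Suc.prems(2) by fastforce
  qed
  also have "W (?R2 - {q + 1} \<times> base (a + 1) n) = wall_factor (a + 1) n * W (?R2 - triangle (q + 1) (a + 1) n)"
    by (rule Suc.IH) (use Suc.prems in \<open>auto simp: triangle_def\<close>)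
  also have "?R2 - triangle (q + 1) (a + 1) n = R - triangle q a (Suc n)"
    by (auto simp: triangle_def)
  finally show ?case by simp
qed

lemma dents_block: "dents {p<..p + l} = base (2 * int p + 1) l"
proof (intro equalityI subsetI)
  fix c assume "c \<in> base (2 * int p + 1) l"
  then obtain i where "i < l" "c = 2 * int p + 1 + 2 * int i" by (auto simp: base_def)
  then have "p + 1 + i \<in> {p<..p + l}" "c = 2 * int (p + 1 + i) - 1" by auto
  then show "c \<in> dents {p<..p + l}" unfolding dents_def by blast
qed (auto simp: dents_def base_iff)

text \<open>
  A cell of doubled abscissa \<open>c\<close> lies above the bottom position \<open>(c + 1) div 2\<close>.  This separates triangles
  whose bottom sides are disjoint.
\<close>

lemma triangle_block_position:
  assumes "(r, c) \<in> triangle q (2 * int p + 1) l"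
  shows "nat ((c + 1) div 2) \<in> {p<..p + l}" "0 < c"
  using assms by (auto simp: triangle_def)

lemma dents_position: "c \<in> dents S \<Longrightarrow> nat ((c + 1) div 2) \<in> S"
  by (auto simp: dents_def)

lemma half_triangle_position:
  assumes "(r, c) \<in> triangle q (1 - 2 * int a) (2 * a)" "0 < c"
  shows "nat ((c + 1) div 2) \<in> {1..a}"
  using assms by (auto simp: triangle_def)

text \<open>
  The tiling number of a trapezoid from whose bottom the half triangle of side \<open>2 * a\<close> at the wall, the triangles of sides \<open>l i\<close>
  after the positions \<open>p i\<close>, and unit triangles at the positions \<open>S\<close> have been removed.
\<close>

theorem trap_fern:
  assumes fin: "finite I" and a: "a \<le> k" and l: "\<And>i. i \<in> I \<Longrightarrow> l i \<le> 2 * k"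
    and blk: "\<And>i. i \<in> I \<Longrightarrow> {p i<..p i + l i} \<subseteq> {1..k + t}"
    and dis: "\<And>i j. i \<in> I \<Longrightarrow> j \<in> I \<Longrightarrow> i \<noteq> j \<Longrightarrow> {p i<..p i + l i} \<inter> {p j<..p j + l j} = {}"
    and disa: "\<And>i. i \<in> I \<Longrightarrow> {p i<..p i + l i} \<inter> {1..a} = {}"
    and S: "S \<subseteq> {1..k + t}" "S \<inter> {1..a} = {}" "\<And>i. i \<in> I \<Longrightarrow> S \<inter> {p i<..p i + l i} = {}"
    and k0: "k = 0 \<Longrightarrow> S = {}"
  shows "W (trap k t - triangle (- 2 * int k) (1 - 2 * int a) (2 * a)
            - (\<Union>i\<in>I. triangle (- 2 * int k) (2 * int (p i) + 1) (l i)) - {- 2 * int k} \<times> dents S)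
       = 2 ^ a * trap_count k ({1..a} \<union> (\<Union>i\<in>I. {p i<..p i + l i}) \<union> S)"
proof (cases "k = 0")
  case True
  then have "a = 0" "S = {}" "\<And>i. i \<in> I \<Longrightarrow> l i = 0" "trap k t = {}"
    using a l k0 by (auto simp: trap_def)
  then show ?thesis using True by (simp add: trap_count_def trap_const_def V_def)
next
  case False
  let ?q = "- 2 * int k"
  let ?B = "\<lambda>i. {p i<..p i + l i}"
  let ?T = "\<lambda>i. triangle ?q (2 * int (p i) + 1) (l i)"
  let ?H = "triangle ?q (1 - 2 * int a) (2 * a)"
  let ?U = "trap k t - {?q} \<times> dents S"
  have nn: "0 \<le> c" if "(r, c) \<in> trap k t" for r c using that by (auto simp: trap_def)
  have Ttrap: "?T i \<subseteq> trap k t" if i: "i \<in> I" for i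
  proof
    fix u assume u: "u \<in> ?T i"
    obtain r c where rc: "u = (r, c)" by fastforce
    have ur: "?q \<le> r" "r < ?q + int (l i)" "2 * int (p i) + 1 + (r - ?q) \<le> c"
      "c \<le> 2 * int (p i) + 1 + 2 * (int (l i) - 1) - (r - ?q)"
      using u by (auto simp: rc triangle_def)
    then have "p i + l i \<in> ?B i" by auto
    from subsetD[OF blk[OF i] this] have "p i + l i \<le> k + t" by simp
    then show "u \<in> trap k t" using ur l[OF i] by (auto simp: rc trap_def)
  qed
  \<comment> \<open>the triangles away from the wall are filled one after the other\<close>
  have main: "W (?U - {?q} \<times> dents {1..a} - {?q} \<times> (\<Union>i\<in>I. dents (?B i)))
     = W (?U - {?q} \<times> dents {1..a} - (\<Union>i\<in>J. ?T i) - {?q} \<times> (\<Union>i\<in>I - J. dents (?B i)))"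
    if "J \<subseteq> I" for J
    using finite_subset[OF that fin] that
  proof (induction J rule: finite_induct)
    case (insert j J)
    let ?R = "?U - {?q} \<times> dents {1..a} - (\<Union>i\<in>J. ?T i) - {?q} \<times> (\<Union>i\<in>I - insert j J. dents (?B i))"
    have j: "j \<in> I" using insert by auto
    have "?U - {?q} \<times> dents {1..a} - (\<Union>i\<in>J. ?T i) - {?q} \<times> (\<Union>i\<in>I - J. dents (?B i))
        = ?R - {?q} \<times> base (2 * int (p j) + 1) (l j)"
      using insert j unfolding dents_block[symmetric] by auto
    moreover have "W (?R - {?q} \<times> base (2 * int (p j) + 1) (l j)) =
       wall_factor (2 * int (p j) + 1) (l j) * W (?R - ?T j)"
    proof (rule W_fill)
      fix r c assume T: "(r, c) \<in> ?T j"
      let ?d = "nat ((c + 1) div 2)"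
      have d: "?d \<in> ?B j" "0 < c" using triangle_block_position[OF T] by auto
      show "(r, c) \<in> ?R"
      proof (intro DiffI UN_I notI)
        show "(r, c) \<in> trap k t" using Ttrap[OF j] T by auto
        show False if "(r, c) \<in> {?q} \<times> dents S" using dents_position[of c S] that d S(3)[OF j] by auto
        show False if "(r, c) \<in> {?q} \<times> dents {1..a}" using dents_position[of c "{1..a}"] that d disa[OF j] by auto
        show False if "(r, c) \<in> (\<Union>i\<in>J. ?T i)"
        proof -
          obtain i where i: "i \<in> J" "(r, c) \<in> ?T i" using \<open>(r, c) \<in> (\<Union>i\<in>J. ?T i)\<close> by blast
          then have "?d \<in> ?B i" "i \<in> I" "i \<noteq> j" using triangle_block_position[OF i(2)] insert by auto
          then show False using dis[of i j] d j by blast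
        qed
        show False if h: "(r, c) \<in> {?q} \<times> (\<Union>i\<in>I - insert j J. dents (?B i))"
        proof -
          obtain i where i: "i \<in> I - insert j J" "c \<in> dents (?B i)" using h by blast
          then have "?d \<in> ?B i" using dents_position by blast
          then show False using dis[of i j] d j i by blast
        qed
      qed
    qed (use nn in \<open>auto simp: finite_Diff\<close>)
    moreover have "wall_factor (2 * int (p j) + 1) (l j) = 1" by (rule wall_factor_pos) simp
    moreover have "?R - ?T j = ?U - {?q} \<times> dents {1..a} - (\<Union>i\<in>insert j J. ?T i) - {?q} \<times> (\<Union>i\<in>I - insert j J. dents (?B i))"
      by auto
    ultimately show ?case using insert by simp
  qed simp
  let ?R = "?U - (\<Union>i\<in>I. ?T i)"
  \<comment> \<open>the half triangle is a whole one continued beyond the wall\<close>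
  have half: "W (?R - {?q} \<times> base (1 - 2 * int a) (2 * a)) = wall_factor (1 - 2 * int a) (2 * a) * W (?R - ?H)"
  proof (rule W_fill)
    fix r c assume T: "(r, c) \<in> ?H" and c0: "0 \<le> c"
    show "(r, c) \<in> ?R"
    proof (intro DiffI notI)
      show "(r, c) \<in> trap k t" using T c0 a by (auto simp: triangle_def trap_def)
      show False if h: "(r, c) \<in> {?q} \<times> dents S"
      proof -
        have "odd c" using h by (auto simp: dents_def)
        then have "c \<noteq> 0" by auto
        then show False using half_triangle_position[OF T] dents_position[of c S] h c0 S(2) by auto
      qed
      show False if h: "(r, c) \<in> (\<Union>i\<in>I. ?T i)"
      proof -
        obtain i where i: "i \<in> I" "(r, c) \<in> ?T i" using h by blast
        then show False using triangle_block_position[OF i(2)] half_triangle_position[OF T] disa[OF i(1)] by blast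
      qed
    qed
  qed (use nn in \<open>auto simp: finite_Diff\<close>)
  have baseH: "?R - {?q} \<times> base (1 - 2 * int a) (2 * a) = ?R - {?q} \<times> dents {1..a}"
  proof -
    have "c \<in> base (1 - 2 * int a) (2 * a) \<longleftrightarrow> c \<in> dents {1..a}" if "0 \<le> c" for c
    proof -
      have "{1..a} = {0<..0 + a}" by auto
      then have "dents {1..a} = base 1 a" using dents_block[of 0 a] by simp
      then show ?thesis using that by (cases "c = 0") (auto simp: base_iff)
    qed
    then show ?thesis using nn by fastforce
  qed
  have "W (trap k t - {?q} \<times> dents ({1..a} \<union> (\<Union>i\<in>I. ?B i) \<union> S)) =
      W (?U - {?q} \<times> dents {1..a} - {?q} \<times> (\<Union>i\<in>I. dents (?B i)))"
    by (rule arg_cong[where f = W]) (auto simp: dents_def)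
  also have "\<dots> = W (?U - {?q} \<times> dents {1..a} - (\<Union>i\<in>I. ?T i))"
    using main[of I] by simp
  also have "?U - {?q} \<times> dents {1..a} - (\<Union>i\<in>I. ?T i) = ?R - {?q} \<times> base (1 - 2 * int a) (2 * a)"
    unfolding baseH by auto
  also have "W \<dots> = (1 / 2) ^ a * W (?R - ?H)"
    unfolding half wall_factor_half ..
  also have "?R - ?H = trap k t - ?H - (\<Union>i\<in>I. ?T i) - {?q} \<times> dents S" by auto
  finally have e: "W (trap k t - {?q} \<times> dents ({1..a} \<union> (\<Union>i\<in>I. ?B i) \<union> S)) =
     (1 / 2) ^ a * W (trap k t - ?H - (\<Union>i\<in>I. ?T i) - {?q} \<times> dents S)" .
  have "{1..a} \<union> (\<Union>i\<in>I. ?B i) \<union> S \<subseteq> {1..k + t}" using a blk S(1) by force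
  from trap_dents[OF this] e False
  have "trap_count k ({1..a} \<union> (\<Union>i\<in>I. ?B i) \<union> S) = (1 / 2) ^ a * W (trap k t - ?H - (\<Union>i\<in>I. ?T i) - {?q} \<times> dents S)"
    by (simp add: trap_W_def)
  then show ?thesis by (simp add: power_one_over field_simps)
qed

section \<open>From lozenge tilings to matchings of cells\<close>

text \<open>
  The cell of a unit triangle; \<open>tri_of\<close> is the inverse map.
\<close>

fun node_of :: "tri \<Rightarrow> node" where
  "node_of t = (lower_level t, twice_x (anchor t) + 1)"

definition tri_of :: "node \<Rightarrow> tri" where
  "tri_of = (\<lambda>(q, c). if odd (c - q) then Up ((c - 1 - q) div 2, q) else Down ((c - 2 - q) div 2, q + 1))"

lemma tri_of_node_of [simp]: "tri_of (node_of t) = t"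
  by (cases t) (auto simp: tri_of_def)

lemma node_of_tri_of [simp]: "node_of (tri_of u) = u"
  by (cases u) (auto simp: tri_of_def elim!: evenE oddE)

declare node_of.simps [simp del]

lemma inj_node_of: "inj node_of"
  by (metis injI tri_of_node_of)

lemma node_of_image_eqI:
  assumes "\<And>t. t \<in> X \<longleftrightarrow> node_of t \<in> Y"
  shows "node_of ` X = Y"
  using assms by (auto simp: image_iff) (metis node_of_tri_of)

lemma card_Int_three:
  assumes "a \<noteq> b" "b \<noteq> c" "a \<noteq> c"
  shows "card ({a, b, c} \<inter> B) = of_bool (a \<in> B) + of_bool (b \<in> B) + of_bool (c \<in> B)"
  using assms by (auto simp: Int_insert_left)

lemma vertices_simps:
  "vertices (Up (p, q)) = {(p, q), (p + 1, q), (p, q + 1)}"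
  "vertices (Down (p, q)) = {(p, q), (p + 1, q), (p + 1, q - 1)}"
  by auto

text \<open>
  Unit triangles have exactly two common vertices if and only if they share a side, that is, if their cells form an adjacent pair.
\<close>

lemma common_edge_iff:
  "card (vertices s \<inter> vertices t) = 2 \<longleftrightarrow> adjacent_pair {node_of s, node_of t}"
proof -
  obtain p q where pq: "anchor s = (p, q)" by fastforce
  obtain p' q' where pq': "anchor t = (p', q')" by fastforce
  obtain i j where ij: "p' = p + i" "q' = q + j" by (metis add.commute diff_add_cancel)
  have ob: "of_bool P + of_bool Q + of_bool R = (2 :: nat) \<longleftrightarrow>
      (P \<and> Q \<and> \<not> R) \<or> (P \<and> \<not> Q \<and> R) \<or> (\<not> P \<and> Q \<and> R)" for P Q R
    by (cases P; cases Q; cases R) auto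
  consider "s = Up (p, q)" "t = Up (p', q')" | "s = Up (p, q)" "t = Down (p', q')"
    | "s = Down (p, q)" "t = Up (p', q')" | "s = Down (p, q)" "t = Down (p', q')"
    using pq pq' by (cases s; cases t) auto
  then show ?thesis
  proof cases
    case 1
    show ?thesis unfolding 1 ij vertices_simps
      by (subst card_Int_three; simp add: ob adjacent_pair_iff node_of.simps; presburger?)
  next
    case 2
    show ?thesis unfolding 2 ij vertices_simps
      by (subst card_Int_three; simp add: ob adjacent_pair_iff node_of.simps; presburger?)
  next
    case 3
    show ?thesis unfolding 3 ij vertices_simps
      by (subst card_Int_three; simp add: ob adjacent_pair_iff node_of.simps; presburger?)
  next
    case 4
    show ?thesis unfolding 4 ij vertices_simps
      by (subst card_Int_three; simp add: ob adjacent_pair_iff node_of.simps; presburger?)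
  qed
qed

lemma lozenge_iff: "lozenge l \<longleftrightarrow> adjacent_pair (node_of ` l)"
proof
  assume "lozenge l"
  then obtain s t where "l = {s, t}" "card (vertices s \<inter> vertices t) = 2" by (auto simp: lozenge_def)
  then show "adjacent_pair (node_of ` l)" by (simp add: common_edge_iff)
next
  assume a: "adjacent_pair (node_of ` l)"
  then obtain q c q' c' where e: "node_of ` l = {(q, c), (q', c')}" by (rule adjacent_pairE)
  have "l = tri_of ` node_of ` l" by (simp add: image_image)
  also have "\<dots> = {tri_of (q, c), tri_of (q', c')}" unfolding e by simp
  finally have l: "l = {tri_of (q, c), tri_of (q', c')}" .
  moreover have "card (vertices (tri_of (q, c)) \<inter> vertices (tri_of (q', c'))) = 2"
    unfolding common_edge_iff using a e by simp
  ultimately show "lozenge l" unfolding lozenge_def by blast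
qed

lemma partition_on_inj_image:
  assumes "inj f"
  shows "partition_on (f ` A) ((`) f ` P) \<longleftrightarrow> partition_on A P"
proof -
  have "\<Union>((`) f ` P) = f ` \<Union>P" by auto
  moreover have "disjoint ((`) f ` P) \<longleftrightarrow> disjoint P"
    using assms by (auto simp: disjoint_def inj_image_eq_iff simp flip: image_Int)
  moreover have "{} \<in> (`) f ` P \<longleftrightarrow> {} \<in> P" by auto
  ultimately show ?thesis
    using inj_image_eq_iff[OF assms] by (auto simp: partition_on_def)
qed

lemma M_eq_W:
  assumes wt: "\<And>l. lozenge l \<Longrightarrow> l \<subseteq> R \<Longrightarrow> wt l = wall_weight (node_of ` l)"
  shows "M wt R = W (node_of ` R)"
proof -
  have im: "(`) tri_of ` (`) node_of ` T = T" "(`) node_of ` (`) tri_of ` T' = T'" for T T'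
    by (simp_all add: image_image)
  have tile: "T \<in> tilings R \<longleftrightarrow> (`) node_of ` T \<in> matchings (node_of ` R)" for T
    by (auto simp: tilings_def matchings_def partition_on_inj_image[OF inj_node_of] lozenge_iff)
  show ?thesis unfolding M_def W_def
  proof (rule sum.reindex_bij_witness[where i = "\<lambda>T. (`) tri_of ` T" and j = "\<lambda>T. (`) node_of ` T"])
    fix T assume T: "T \<in> tilings R"
    have "inj_on ((`) node_of) T" using inj_image_eq_iff[OF inj_node_of] by (auto simp: inj_on_def)
    then have "(\<Prod>l\<in>(`) node_of ` T. wall_weight l) = (\<Prod>l\<in>T. wall_weight (node_of ` l))"
      by (simp add: prod.reindex)
    also have "\<dots> = (\<Prod>l\<in>T. wt l)"
      using T by (intro prod.cong refl wt[symmetric]) (auto simp: tilings_def partition_on_def)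
    finally show "(\<Prod>l\<in>(`) node_of ` T. wall_weight l) = (\<Prod>l\<in>T. wt l)" .
  qed (use tile im in auto)
qed

lemma edges_append: "edges v (ss @ ss') = edges v ss @ edges (fold move ss v) ss'"
  by (induction ss arbitrary: v) auto

lemma zigzag_edges:
  "(v, w) \<in> set (edges (p, r) (zigzag m)) \<longleftrightarrow>
    (\<exists>i<m. (v = (p + int i, r - 2 * int i) \<and> w = (p + int i, r - 2 * int i - 1)) \<or>
           (v = (p + int i, r - 2 * int i - 1) \<and> w = (p + int i + 1, r - 2 * int i - 2)))"
proof (induction m arbitrary: p r)
  case (Suc m)
  have z: "zigzag (Suc m) = [SW, SE] @ zigzag m" by (simp add: zigzag_def)
  show ?case unfolding z edges_append using Suc[of "p + 1" "r - 2"]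
    by (simp add: Ex_less_Suc2 algebra_simps)
qed (simp add: zigzag_def)

text \<open>
  For a lozenge whose cells on the line \<open>c = 0\<close> lie in the range of the zigzag, having both left sides on the zigzag
  means being vertical and centred at \<open>c = 0\<close>.
\<close>

lemma zigzag_weight_eq:
  assumes l: "lozenge l" and c: "\<And>q. (q, 0) \<in> node_of ` l \<Longrightarrow> - 2 * int m \<le> q \<and> q < 0"
  shows "zigzag_weight m l = wall_weight (node_of ` l)"
proof -
  have "(\<exists>v. l = {Up v, Down v} \<and> (move NE v, v) \<in> set (edges (0, 0) (zigzag m)) \<and>
           (v, move SE v) \<in> set (edges (0, 0) (zigzag m))) \<longleftrightarrow> (\<exists>q. node_of ` l = {(q, 0), (q - 1, 0)})"
    (is "?L \<longleftrightarrow> ?R")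
  proof
    assume ?L
    then obtain p q where l': "l = {Up (p, q), Down (p, q)}"
      and "(move NE (p, q), (p, q)) \<in> set (edges (0, 0) (zigzag m))" by auto
    then have "2 * p + q + 1 = 0" by (auto simp: zigzag_edges)
    then show ?R using l' by (auto simp: node_of.simps)
  next
    assume ?R
    then obtain q where q: "node_of ` l = {(q, 0), (q - 1, 0)}" by blast
    have odd: "odd q"
    proof -
      have "adjacent_pair {(q, 0), (q - 1, 0)}" using l q by (simp add: lozenge_iff)
      then show ?thesis by (simp add: adjacent_pair_iff)
    qed
    have r: "- 2 * int m \<le> q - 1" "q < 0" using c[of q] c[of "q - 1"] q by auto
    obtain i where i: "q = - 2 * int i - 1"
    proof -
      obtain j where "q = 2 * j + 1" using odd by (rule oddE)
      then have "q = - 2 * int (nat (- j - 1)) - 1" using r by auto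
      then show ?thesis by (rule that)
    qed
    have im: "i < m" using r i by auto
    let ?v = "(int i, q)"
    have "l = tri_of ` node_of ` l" by (simp add: image_image)
    also have "\<dots> = {Up ?v, Down ?v}" unfolding q i by (auto simp: tri_of_def)
    finally have "l = {Up ?v, Down ?v}" .
    moreover have "(move NE ?v, ?v) \<in> set (edges (0, 0) (zigzag m))" "(?v, move SE ?v) \<in> set (edges (0, 0) (zigzag m))"
      using im i by (auto simp: zigzag_edges intro!: exI[of _ i])
    ultimately show ?L by blast
  qed
  then show ?thesis by (simp add: zigzag_weight_def wall_weight_def)
qed

lemma M_zigzag_eq_W:
  assumes "\<And>q. (q, 0) \<in> node_of ` R \<Longrightarrow> - 2 * int m \<le> q \<and> q < 0"
  shows "M (zigzag_weight m) R = W (node_of ` R)"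
proof (rule M_eq_W)
  fix l assume "lozenge l" "l \<subseteq> R"
  then show "zigzag_weight m l = wall_weight (node_of ` l)"
    using assms by (intro zigzag_weight_eq) blast+
qed

text \<open>
  The sum that defines enclosed triangles, as a function that is additive under concatenation of paths.
\<close>

definition winding :: "tri \<Rightarrow> point \<Rightarrow> step list \<Rightarrow> int" where
  "winding t v ss = (\<Sum>e\<leftarrow>edges v ss. crossing t e)"

lemma winding_Nil [simp]: "winding t v [] = 0"
  by (simp add: winding_def)

lemma winding_Cons: "winding t v (s # ss) = crossing t (v, move s v) + winding t (move s v) ss"
  by (simp add: winding_def)

lemma winding_append: "winding t v (ss @ ss') = winding t v ss + winding t (fold move ss v) ss'"
  by (simp add: winding_def edges_append)

lemma fold_move_replicate:
  "fold move (replicate n East) (p, r) = (p + int n, r)"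
  "fold move (replicate n West) (p, r) = (p - int n, r)"
  "fold move (replicate n NE) (p, r) = (p, r + int n)"
  "fold move (replicate n NW) (p, r) = (p - int n, r + int n)"
  "fold move (replicate n SE) (p, r) = (p + int n, r - int n)"
  "fold move (replicate n SW) (p, r) = (p, r - int n)"
  "fold move (zigzag n) (p, r) = (p + int n, r - 2 * int n)"
  by (induction n arbitrary: p r) (auto simp: zigzag_def)

text \<open>
  Each slanted side and each zigzag contributes on the strips it passes if it runs to the west of the
  triangle.  The contribution is negative for the upward sides.
\<close>

lemma winding_replicate:
  assumes t: "node_of t = (q, c)"
  shows "winding t (p, r) (replicate n East) = 0"
    "winding t (p, r) (replicate n West) = 0"
    "winding t (p, r) (replicate n NE) = (if r \<le> q \<and> q < r + int n \<and> 2 * p + q < c then - 1 else 0)"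
    "winding t (p, r) (replicate n NW) = (if r \<le> q \<and> q < r + int n \<and> 2 * p + 2 * r - q - 1 < c then - 1 else 0)"
    "winding t (p, r) (replicate n SE) = (if r - int n \<le> q \<and> q < r \<and> 2 * p + 2 * r - q - 1 < c then 1 else 0)"
    "winding t (p, r) (replicate n SW) = (if r - int n \<le> q \<and> q < r \<and> 2 * p + q < c then 1 else 0)"
    "winding t (p, r) (zigzag n) = (if r - 2 * int n \<le> q \<and> q < r \<and> 2 * p + r \<le> c then 1 else 0)"
proof -
  have cr: "crossing t (v, w) = (if twice_x v + twice_x w < 2 * c then
       (if snd v = q + 1 \<and> snd w = q then 1 else if snd v = q \<and> snd w = q + 1 then - 1 else 0) else 0)" for v w
    using t by (simp add: crossing_def node_of.simps)
  show "winding t (p, r) (replicate n East) = 0" "winding t (p, r) (replicate n West) = 0"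
    by (induction n arbitrary: p r) (auto simp: winding_Cons cr)
  show "winding t (p, r) (replicate n NE) = (if r \<le> q \<and> q < r + int n \<and> 2 * p + q < c then - 1 else 0)"
    by (induction n arbitrary: p r) (auto simp: winding_Cons cr)
  show "winding t (p, r) (replicate n NW) = (if r \<le> q \<and> q < r + int n \<and> 2 * p + 2 * r - q - 1 < c then - 1 else 0)"
    by (induction n arbitrary: p r) (auto simp: winding_Cons cr)
  show "winding t (p, r) (replicate n SE) = (if r - int n \<le> q \<and> q < r \<and> 2 * p + 2 * r - q - 1 < c then 1 else 0)"
    by (induction n arbitrary: p r) (auto simp: winding_Cons cr)
  show "winding t (p, r) (replicate n SW) = (if r - int n \<le> q \<and> q < r \<and> 2 * p + q < c then 1 else 0)"
    by (induction n arbitrary: p r) (auto simp: winding_Cons cr)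
  show "winding t (p, r) (zigzag n) = (if r - 2 * int n \<le> q \<and> q < r \<and> 2 * p + r \<le> c then 1 else 0)"
  proof (induction n arbitrary: p r)
    case (Suc n)
    have z: "zigzag (Suc n) = SW # SE # zigzag n" by (simp add: zigzag_def)
    show ?case unfolding z winding_Cons move.simps Suc by (auto simp: cr)
  qed (simp add: zigzag_def)
qed

lemma enclosed_iff: "t \<in> enclosed v ss \<longleftrightarrow> winding t v ss = 1"
  by (simp add: enclosed_def winding_def)

lemma one_iff:
  "(if A then - 1 else 0) + (if B then 1 else 0) = (1 :: int) \<longleftrightarrow> B \<and> \<not> A"
  "(if B then 1 else 0) + (if A then - 1 else 0) = (1 :: int) \<longleftrightarrow> B \<and> \<not> A"
  by auto

lemma node_of_up_triangle: "node_of ` up_triangle (p, r) n = triangle r (2 * p + r + 1) n"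
proof (rule node_of_image_eqI)
  fix t obtain q c where t: "node_of t = (q, c)" by fastforce
  show "t \<in> up_triangle (p, r) n \<longleftrightarrow> node_of t \<in> triangle r (2 * p + r + 1) n"
    unfolding up_triangle_def enclosed_iff winding_append fold_move_replicate winding_replicate[OF t] one_iff add_0_left
    unfolding t triangle_def by auto
qed

lemma node_of_down_triangle:
  "node_of ` down_triangle (p, r) n = {(q, c). r - int n \<le> q \<and> q < r \<and> 2 * p + 2 * r - q \<le> c \<and> c \<le> 2 * p + 2 * int n + q}"
proof (rule node_of_image_eqI)
  fix t obtain q c where t: "node_of t = (q, c)" by fastforce
  show "t \<in> down_triangle (p, r) n \<longleftrightarrow> node_of t \<in> {(q, c). r - int n \<le> q \<and> q < r \<and> 2 * p + 2 * r - q \<le> c \<and> c \<le> 2 * p + 2 * int n + q}"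
    unfolding down_triangle_def enclosed_iff winding_append fold_move_replicate winding_replicate[OF t]
    unfolding t by auto
qed

lemma node_of_P_polygon:
  assumes "a \<le> b"
  shows "node_of ` polygon (zigzag a @ replicate (b - a) SE @ replicate c East @ replicate a NE @ replicate b NW @ replicate c West) =
    {(q, e). - int a - int b \<le> q \<and> q < 0 \<and> (- 2 * int a \<le> q \<longrightarrow> 0 \<le> e) \<and> (q < - 2 * int a \<longrightarrow> - 2 * int a - q \<le> e) \<and>
      (q < - int b \<longrightarrow> e \<le> 2 * int b + 2 * int c + q) \<and> (- int b \<le> q \<longrightarrow> e \<le> 2 * int c - 1 - q)}"
proof (rule node_of_image_eqI, goal_cases)
  case (1 t)
  obtain q e where t: "node_of t = (q, e)" by fastforce
  obtain d where b: "b = a + d" using assms le_Suc_ex by blast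
  show ?case
    unfolding polygon_def enclosed_iff winding_append fold_move_replicate winding_replicate[OF t]
    unfolding t b by (cases "q < - 2 * int a"; cases "q < - int (a + d)"; simp; auto)
qed

lemma node_of_Q_polygon:
  "node_of ` polygon (zigzag k @ replicate (k + t) East @ replicate (2 * k) NW @ replicate t West) = trap k t"
proof (rule node_of_image_eqI, goal_cases)
  case (1 u)
  obtain q e where u: "node_of u = (q, e)" by fastforce
  show ?case
    unfolding polygon_def enclosed_iff winding_append fold_move_replicate winding_replicate[OF u]
    unfolding u trap_def by auto
qed

lemma node_of_H3_polygon:
  assumes "2 * h = b + c"
  shows "node_of ` polygon (zigzag h @ replicate w East @ replicate b NE @ replicate c NW @ replicate w' West) =
    {(q, e). - 2 * int h \<le> q \<and> q < 0 \<and> 0 \<le> e \<and> (q < - int c \<longrightarrow> e \<le> 2 * int h + 2 * int w + q) \<and>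
      (- int c \<le> q \<longrightarrow> e \<le> 2 * int w + 2 * int b - 2 * int h - 1 - q)}"
proof (rule node_of_image_eqI, goal_cases)
  case (1 t)
  obtain q e where t: "node_of t = (q, e)" by fastforce
  have h: "int c = 2 * int h - int b" using assms by linarith
  show ?case
    unfolding polygon_def enclosed_iff winding_append fold_move_replicate winding_replicate[OF t]
    unfolding t h by (cases "q < - (2 * int h - int b)"; simp; auto)
qed

section \<open>Ferns and the numbers P' and Q'\<close>

lemma triangle_empty: "triangle q a 0 = {}"
  by (auto simp: triangle_def)

lemma s_sum_Suc: "s_sum (Suc m) t = s_sum m t + entry t (Suc m)"
  by (simp add: s_sum_def)

lemma s_sum_mono: "m \<le> m' \<Longrightarrow> s_sum m t \<le> s_sum m' t"
  unfolding s_sum_def by (rule sum_mono2) auto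

text \<open>
  The positions covered by the \<open>i\<close>-th segment, when the unit steps along the line are numbered from \<open>1\<close>.
\<close>

definition fern_block :: "nat list \<Rightarrow> nat \<Rightarrow> nat set" where
  "fern_block t i = {s_sum (i - 1) t<..s_sum (i - 1) t + entry t i}"

lemma fern_block_end: "1 \<le> i \<Longrightarrow> s_sum (i - 1) t + entry t i = s_sum i t"
  using s_sum_Suc[of "i - 1" t] by simp

lemma fern_block_disjoint:
  assumes "1 \<le> i" "1 \<le> j" "i \<noteq> j"
  shows "fern_block t i \<inter> fern_block t j = {}"
proof -
  have *: "fern_block t i \<inter> fern_block t j = {}" if "1 \<le> i" "i < j" for i j
  proof -
    have "i \<le> j - 1" using that by simp
    from s_sum_mono[OF this, of t] show ?thesis
      using fern_block_end[OF that(1), of t] by (auto simp: fern_block_def)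
  qed
  show ?thesis using *[of i j] *[of j i] assms by (cases "i < j") auto
qed

lemma fern_block_subset: "1 \<le> i \<Longrightarrow> i \<le> length t \<Longrightarrow> fern_block t i \<subseteq> {1..s_sum (length t) t}"
  using s_sum_mono[of i "length t" t] fern_block_end[of i t] by (auto simp: fern_block_def)

lemma fern_blocks_cover: "(\<Union>i\<in>{1..m}. fern_block t i) = {1..s_sum m t}"
proof (induction m)
  case (Suc m)
  have "{1..Suc m} = insert (Suc m) {1..m}" by auto
  then have "(\<Union>i\<in>{1..Suc m}. fern_block t i) = fern_block t (Suc m) \<union> {1..s_sum m t}" using Suc by simp
  also have "\<dots> = {1..s_sum (Suc m) t}" by (auto simp: fern_block_def s_sum_Suc)
  finally show ?case .
qed (simp add: s_sum_def)

text \<open>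
  The positions covered by the segments whose index satisfies \<open>P\<close>.
\<close>

definition fern :: "nat list \<Rightarrow> (nat \<Rightarrow> bool) \<Rightarrow> nat set" where
  "fern t P = (\<Union>i\<in>{i\<in>{1..length t}. P i}. fern_block t i)"

lemma finite_fern [simp]: "finite (fern t P)"
  by (auto simp: fern_def fern_block_def)

lemma card_fern: "card (fern t P) = (\<Sum>i\<in>{i\<in>{1..length t}. P i}. entry t i)"
  unfolding fern_def
  by (subst card_UN_disjoint) (use fern_block_disjoint in \<open>auto simp: fern_block_def\<close>)

lemma odd_sum_add_even_sum: "odd_sum t + even_sum t = s_sum (length t) t"
proof -
  have "{1..length t} = {i. i \<in> {1..length t} \<and> odd i} \<union> {i. i \<in> {1..length t} \<and> even i}" by auto
  then have "s_sum (length t) t = (\<Sum>i\<in>{i. i \<in> {1..length t} \<and> odd i} \<union> {i. i \<in> {1..length t} \<and> even i}. entry t i)"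
    unfolding s_sum_def by (rule arg_cong)
  also have "\<dots> = odd_sum t + even_sum t"
    unfolding odd_sum_def even_sum_def by (rule sum.union_disjoint) auto
  finally show ?thesis by simp
qed

lemma entry_le_odd_sum: "odd i \<Longrightarrow> entry t i \<le> odd_sum t"
  unfolding odd_sum_def
  by (cases "1 \<le> i \<and> i \<le> length t") (auto intro!: member_le_sum simp: entry_def)

lemma entry_le_even_sum: "even i \<Longrightarrow> entry t i \<le> even_sum t"
  unfolding even_sum_def
  by (cases "1 \<le> i \<and> i \<le> length t") (auto intro!: member_le_sum simp: entry_def)

text \<open>
  The polygon of \<open>P'\<close> is a trapezoid with \<open>y + A\<close> periods of the zigzag, without a half triangle of side \<open>2 * A\<close> at the lower left and without
  a triangle of side \<open>y\<close> at the lower right.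
\<close>

theorem P_num_eq:
  "P_num y (y + 2 * A) B = 2 ^ A * trap_count (y + A) ({1..A} \<union> {A + B<..A + B + y})"
proof -
  let ?k = "y + A"
  let ?R = "polygon (zigzag y @ replicate (y + 2 * A - y) SE @ replicate B East @ replicate y NE
               @ replicate (y + 2 * A) NW @ replicate B West)"
  note img = node_of_P_polygon[of y "y + 2 * A" B]
  have "P_num y (y + 2 * A) B = W (node_of ` ?R)"
    unfolding P_num_def by (rule M_zigzag_eq_W) (subst (asm) img, auto)
  also have "node_of ` ?R = trap ?k B - triangle (- 2 * int ?k) (1 - 2 * int A) (2 * A)
            - (\<Union>i\<in>{0 :: nat}. triangle (- 2 * int ?k) (2 * int (A + B) + 1) y) - {- 2 * int ?k} \<times> dents {}"
    by (subst img) (auto simp: trap_def triangle_def dents_def)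
  also have "W \<dots> = 2 ^ A * trap_count ?k ({1..A} \<union> (\<Union>i\<in>{0 :: nat}. {A + B<..A + B + y}) \<union> {})"
    by (rule trap_fern) auto
  finally show ?thesis by simp
qed

theorem Q_num_eq: "Q_num t = trap_count (even_sum t) (fern t even)"
proof -
  let ?k = "even_sum t" and ?s = "odd_sum t"
  let ?I = "{i \<in> {1..length t}. even i}"
  have reg: "node_of ` Q_region t = trap ?k ?s - triangle (- 2 * int ?k) (1 - 2 * int 0) (2 * 0)
    - (\<Union>i\<in>?I. triangle (- 2 * int ?k) (2 * int (s_sum (i - 1) t) + 1) (entry t i)) - {- 2 * int ?k} \<times> dents {}"
  proof -
    have "node_of ` Q_region t = node_of ` polygon (zigzag ?k @ replicate (?k + ?s) East @ replicate (2 * ?k) NW @ replicate ?s West)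
       - (\<Union>i\<in>?I. node_of ` up_triangle (int ?k + int (s_sum (i - 1) t), - 2 * int ?k) (entry t i))"
      unfolding Q_region_def Let_def image_set_diff[OF inj_node_of] image_UN ..
    also have "\<dots> = trap ?k ?s - (\<Union>i\<in>?I. triangle (- 2 * int ?k) (2 * int (s_sum (i - 1) t) + 1) (entry t i))"
      unfolding node_of_Q_polygon node_of_up_triangle by (simp add: algebra_simps)
    finally show ?thesis by (simp add: triangle_empty dents_def)
  qed
  have "Q_num t = W (node_of ` Q_region t)"
    unfolding Q_num_def proof (rule M_zigzag_eq_W)
    fix q assume "(q, 0) \<in> node_of ` Q_region t"
    then have "(q, 0) \<in> trap ?k ?s" unfolding reg by blast
    then show "- 2 * int ?k \<le> q \<and> q < 0" by (simp add: trap_def)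
  qed
  also have "\<dots> = 2 ^ 0 * trap_count ?k ({1..0} \<union> (\<Union>i\<in>?I. {s_sum (i - 1) t<..s_sum (i - 1) t + entry t i}) \<union> {})"
    unfolding reg
  proof (rule trap_fern)
    fix i assume i: "i \<in> ?I"
    show "entry t i \<le> 2 * ?k" using entry_le_even_sum[of i t] i by auto
    have "fern_block t i \<subseteq> {1..s_sum (length t) t}" using fern_block_subset[of i t] i by auto
    then show "{s_sum (i - 1) t<..s_sum (i - 1) t + entry t i} \<subseteq> {1..?k + ?s}"
      unfolding fern_block_def odd_sum_add_even_sum[symmetric] by (simp add: add.commute)
    fix j assume "j \<in> ?I" "i \<noteq> j"
    then show "{s_sum (i - 1) t<..s_sum (i - 1) t + entry t i} \<inter> {s_sum (j - 1) t<..s_sum (j - 1) t + entry t j} = {}"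
      using fern_block_disjoint[of i j t] i by (auto simp: fern_block_def)
  qed auto
  finally show ?thesis by (simp add: fern_def fern_block_def)
qed

text \<open>
  The reflection that exchanges the strips \<open>q\<close> and \<open>\<kappa> - 1 - q\<close>.  For even \<open>\<kappa>\<close> it exchanges the two
  orientations of triangles and preserves adjacency.
\<close>

definition reflect :: "int \<Rightarrow> node \<Rightarrow> node" where
  "reflect \<kappa> = (\<lambda>(q, c). (\<kappa> - 1 - q, c))"

lemma reflect_reflect [simp]: "reflect \<kappa> (reflect \<kappa> u) = u"
  by (cases u) (simp add: reflect_def)

lemma W_reflect:
  assumes "even \<kappa>"
  shows "W (reflect \<kappa> ` R) = W R"
proof -
  have inj: "inj (reflect \<kappa>)" by (metis injI reflect_reflect)
  have im: "(`) (reflect \<kappa>) ` (`) (reflect \<kappa>) ` T = T" for T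
    by (simp add: image_image)
  have pair: "adjacent_pair {(\<kappa> - 1 - q, c), (\<kappa> - 1 - q', c')} \<longleftrightarrow> adjacent_pair {(q, c), (q', c')}" for q c q' c'
  proof -
    obtain k where "\<kappa> = 2 * k" using assms by (rule evenE)
    then show ?thesis unfolding adjacent_pair_iff by presburger
  qed
  have adj: "adjacent_pair (reflect \<kappa> ` l)" if "adjacent_pair l" for l
    by (rule adjacent_pairE[OF that]) (simp add: reflect_def pair)
  have adj': "adjacent_pair (reflect \<kappa> ` l) \<longleftrightarrow> adjacent_pair l" for l
    using adj[of l] adj[of "reflect \<kappa> ` l"] by (auto simp: image_image)
  have wt: "wall_weight (reflect \<kappa> ` l) = wall_weight l" if "adjacent_pair l" for l
    by (rule adjacent_pairE[OF that]) (auto simp: reflect_def wall_weight_iff)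
  have m: "T \<in> matchings R \<longleftrightarrow> (`) (reflect \<kappa>) ` T \<in> matchings (reflect \<kappa> ` R)" for T
    by (auto simp: matchings_def partition_on_inj_image[OF inj] adj')
  show ?thesis unfolding W_def
  proof (rule sum.reindex_bij_witness[where i = "\<lambda>T. (`) (reflect \<kappa>) ` T" and j = "\<lambda>T. (`) (reflect \<kappa>) ` T"])
    fix T assume T: "T \<in> matchings (reflect \<kappa> ` R)"
    have "inj_on ((`) (reflect \<kappa>)) T" using inj_image_eq_iff[OF inj] by (auto simp: inj_on_def)
    then have "(\<Prod>l\<in>(`) (reflect \<kappa>) ` T. wall_weight l) = (\<Prod>l\<in>T. wall_weight (reflect \<kappa> ` l))"
      by (simp add: prod.reindex)
    also have "\<dots> = (\<Prod>l\<in>T. wall_weight l)"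
      using T by (intro prod.cong refl wt) (auto simp: matchings_def)
    finally show "(\<Prod>l\<in>(`) (reflect \<kappa>) ` T. wall_weight l) = (\<Prod>l\<in>T. wall_weight l)" .
  next
    fix T assume T: "T \<in> matchings (reflect \<kappa> ` R)"
    have "(`) (reflect \<kappa>) ` (`) (reflect \<kappa>) ` T \<in> matchings (reflect \<kappa> ` R)"
      using T im by simp
    then show "(`) (reflect \<kappa>) ` T \<in> matchings R" using m by blast
  qed (use m im in auto)
qed

section \<open>Cutting the region H along the line L\<close>

lemma node_of_half_plane:
  "node_of ` {t. \<forall>(p, q) \<in> vertices t. - 2 * m \<le> q \<and> p + q \<le> - m + int a} =
    {(q, c). - 2 * m \<le> q \<and> c + q + 1 \<le> 2 * int a - 2 * m}"
proof (rule node_of_image_eqI)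
  fix t
  obtain p q where "t = Up (p, q) \<or> t = Down (p, q)" by (cases t) auto
  then show "t \<in> {t. \<forall>(p, q) \<in> vertices t. - 2 * m \<le> q \<and> p + q \<le> - m + int a} \<longleftrightarrow>
     node_of t \<in> {(q, c). - 2 * m \<le> q \<and> c + q + 1 \<le> 2 * int a - 2 * m}"
    by (auto simp: node_of.simps)
qed

lemma triangle_row_iff:
  "(q, 2 * int d - 1) \<in> triangle q (2 * int p + 1) l \<longleftrightarrow> d \<in> {p<..p + l}"
  by (auto simp: triangle_def)

lemma half_triangle_row_iff:
  "(q, 2 * int d - 1) \<in> triangle q (1 - 2 * int a) (2 * a) \<longleftrightarrow> 1 - int a \<le> int d \<and> d \<le> a"
  by (auto simp: triangle_def)

lemma fern_odd_split:
  "fern t odd = {1..entry t 1} \<union> (\<Union>i\<in>{i\<in>{3..length t}. odd i}. fern_block t i)"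
proof -
  have 1: "fern_block t 1 = {1..entry t 1}" by (auto simp: fern_block_def s_sum_def)
  show ?thesis
  proof (cases "length t = 0")
    case True
    then show ?thesis by (simp add: fern_def entry_def)
  next
    case False
    have len: "1 \<le> length t" using False by linarith
    have "i = 1 \<or> 3 \<le> i" if "odd i" "1 \<le> i" for i :: nat using that by presburger
    then have "i \<in> {i\<in>{1..length t}. odd i} \<longleftrightarrow> i \<in> insert 1 {i\<in>{3..length t}. odd i}" for i
      using len by (cases "i = 1") auto
    then have "{i\<in>{1..length t}. odd i} = insert 1 {i\<in>{3..length t}. odd i}" by blast
    then show ?thesis unfolding fern_def by (simp only: UN_insert 1)
  qed
qed

context
  fixes x y z :: nat and a :: "nat list"
begin

abbreviation (input) "Od \<equiv> odd_sum a"
abbreviation (input) "Ev \<equiv> even_sum a"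
abbreviation (input) "n0 \<equiv> s_sum (length a) a"
text \<open>
  Index \<open>0\<close> stands for one more triangle, at the eastern end of \<open>L\<close>: the trapezoid above \<open>L\<close> is longer
  than the polygon by a triangle of side \<open>y - z\<close> if \<open>z < y\<close>, and the one below \<open>L\<close> by a triangle of side \<open>z - y\<close>
  if \<open>y < z\<close>.
\<close>

abbreviation (input) "upos i \<equiv> if i = 0 then n0 + x + z else s_sum (i - 1) a"
abbreviation (input) "ulen i \<equiv> if i = 0 then y - z else entry a i"
abbreviation (input) "lpos i \<equiv> if i = 0 then n0 + x + y else s_sum (i - 1) a"
abbreviation (input) "llen i \<equiv> if i = 0 then z - y else entry a i"
abbreviation (input) "uidx \<equiv> insert 0 {i\<in>{3..length a}. odd i}"
abbreviation (input) "lidx \<equiv> insert 0 {i\<in>{1..length a}. even i}"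

text \<open>
  The part of the region \<open>H\<close> above \<open>L\<close>.
\<close>

definition upper :: "node set" where
  "upper = trap (y + Od) (x + Ev) - triangle (- 2 * int (y + Od)) (1 - 2 * int (entry a 1)) (2 * entry a 1)
     - (\<Union>i\<in>uidx. triangle (- 2 * int (y + Od)) (2 * int (upos i) + 1) (ulen i))"

text \<open>
  The mirror image of the part of the region \<open>H\<close> below \<open>L\<close>, moved so that its strips end at level \<open>0\<close>.  The half triangle of side \<open>0\<close>
  is included to match \<open>trap_fern\<close>.
\<close>

definition lower :: "node set" where
  "lower = trap (z + Ev) (x + Od) - triangle (- 2 * int (z + Ev)) (1 - 2 * int 0) (2 * 0)
     - (\<Union>i\<in>lidx. triangle (- 2 * int (z + Ev)) (2 * int (lpos i) + 1) (llen i))"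

lemma upper_block: "i \<in> uidx \<Longrightarrow> {upos i<..upos i + ulen i} = (if i = 0 then {n0 + x + z<..n0 + x + y} else fern_block a i)"
  by (auto simp: fern_block_def)

lemma lower_block: "i \<in> lidx \<Longrightarrow> {lpos i<..lpos i + llen i} = (if i = 0 then {n0 + x + y<..n0 + x + z} else fern_block a i)"
  by (auto simp: fern_block_def)

lemma n0_eq: "n0 = Od + Ev"
  by (simp add: odd_sum_add_even_sum)

lemma W_upper:
  assumes S: "S \<subseteq> {n0<..n0 + x + min y z}" and k0: "y + Od = 0 \<Longrightarrow> S = {}"
  shows "W (upper - {- 2 * int (y + Od)} \<times> dents S) =
    2 ^ entry a 1 * trap_count (y + Od) (fern a odd \<union> {n0 + x + z<..n0 + x + y} \<union> S)"
proof -
  have b: "fern_block a i \<subseteq> {1..n0}" if "i \<in> uidx" "i \<noteq> 0" for i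
    using fern_block_subset[of i a] that by auto
  have ub: "{upos i<..upos i + ulen i} \<subseteq> {1..y + Od + (x + Ev)}" if "i \<in> uidx" for i
    unfolding upper_block[OF that] using b[OF that] n0_eq by (auto dest!: subsetD)
  have "W (upper - {- 2 * int (y + Od)} \<times> dents S) =
    2 ^ entry a 1 * trap_count (y + Od) ({1..entry a 1} \<union> (\<Union>i\<in>uidx. {upos i<..upos i + ulen i}) \<union> S)"
    unfolding upper_def
  proof (rule trap_fern)
    show "entry a 1 \<le> y + Od" using entry_le_odd_sum[of 1 a] by simp
    show "ulen i \<le> 2 * (y + Od)" if "i \<in> uidx" for i
      using entry_le_odd_sum[of i a] that by auto
    show "{upos i<..upos i + ulen i} \<subseteq> {1..y + Od + (x + Ev)}" if "i \<in> uidx" for i by (rule ub[OF that])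
    show "{upos i<..upos i + ulen i} \<inter> {upos j<..upos j + ulen j} = {}" if ij: "i \<in> uidx" "j \<in> uidx" "i \<noteq> j" for i j
    proof (cases "i = 0 \<or> j = 0")
      case True
      then show ?thesis unfolding upper_block[OF ij(1)] upper_block[OF ij(2)] using b[OF ij(1)] b[OF ij(2)] ij(3) by fastforce
    next
      case False
      then show ?thesis unfolding upper_block[OF ij(1)] upper_block[OF ij(2)]
        using fern_block_disjoint[of i j a] ij by simp
    qed
    show "{upos i<..upos i + ulen i} \<inter> {1..entry a 1} = {}" if i: "i \<in> uidx" for i
    proof (cases "i = 0")
      case True
      have "entry a 1 \<le> n0" using entry_le_odd_sum[of 1 a] n0_eq by simp
      then show ?thesis unfolding upper_block[OF i] using True by auto
    next
      case False
      have "fern_block a 1 = {1..entry a 1}" by (auto simp: fern_block_def s_sum_def)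
      then show ?thesis unfolding upper_block[OF i] using fern_block_disjoint[of i 1 a] False i by auto
    qed
    show "S \<subseteq> {1..y + Od + (x + Ev)}" by (rule order_trans[OF S]) (use n0_eq in auto)
    have "entry a 1 \<le> n0" using entry_le_odd_sum[of 1 a] n0_eq by simp
    then show "S \<inter> {1..entry a 1} = {}" using S by auto
    show "S \<inter> {upos i<..upos i + ulen i} = {}" if i: "i \<in> uidx" for i
    proof (cases "i = 0")
      case True then show ?thesis unfolding upper_block[OF i] using S by auto
    next
      case False then show ?thesis unfolding upper_block[OF i] using S b[OF i] by fastforce
    qed
  qed (use k0 in auto)
  also have "(\<Union>i\<in>uidx. {upos i<..upos i + ulen i}) = {n0 + x + z<..n0 + x + y} \<union> (\<Union>i\<in>{i\<in>{3..length a}. odd i}. fern_block a i)"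
    using upper_block by (simp add: UN_insert) (auto simp: fern_block_def)
  also have "{1..entry a 1} \<union> ({n0 + x + z<..n0 + x + y} \<union> (\<Union>i\<in>{i\<in>{3..length a}. odd i}. fern_block a i)) \<union> S =
    fern a odd \<union> {n0 + x + z<..n0 + x + y} \<union> S"
    unfolding fern_odd_split by blast
  finally show ?thesis .
qed

lemma W_lower:
  assumes S: "S \<subseteq> {n0<..n0 + x + min y z}" and k0: "z + Ev = 0 \<Longrightarrow> S = {}"
  shows "W (lower - {- 2 * int (z + Ev)} \<times> dents S) =
    trap_count (z + Ev) (fern a even \<union> {n0 + x + y<..n0 + x + z} \<union> S)"
proof -
  have b: "fern_block a i \<subseteq> {1..n0}" if "i \<in> lidx" "i \<noteq> 0" for i
    using fern_block_subset[of i a] that by auto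
  have ub: "{lpos i<..lpos i + llen i} \<subseteq> {1..z + Ev + (x + Od)}" if "i \<in> lidx" for i
    unfolding lower_block[OF that] using b[OF that] n0_eq by (auto dest!: subsetD)
  have "W (lower - {- 2 * int (z + Ev)} \<times> dents S) =
    2 ^ 0 * trap_count (z + Ev) ({1..0} \<union> (\<Union>i\<in>lidx. {lpos i<..lpos i + llen i}) \<union> S)"
    unfolding lower_def
  proof (rule trap_fern)
    show "llen i \<le> 2 * (z + Ev)" if "i \<in> lidx" for i
      using entry_le_even_sum[of i a] that by auto
    show "{lpos i<..lpos i + llen i} \<subseteq> {1..z + Ev + (x + Od)}" if "i \<in> lidx" for i by (rule ub[OF that])
    show "{lpos i<..lpos i + llen i} \<inter> {lpos j<..lpos j + llen j} = {}" if ij: "i \<in> lidx" "j \<in> lidx" "i \<noteq> j" for i j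
    proof (cases "i = 0 \<or> j = 0")
      case True
      then show ?thesis unfolding lower_block[OF ij(1)] lower_block[OF ij(2)] using b[OF ij(1)] b[OF ij(2)] ij(3) by fastforce
    next
      case False
      then show ?thesis unfolding lower_block[OF ij(1)] lower_block[OF ij(2)]
        using fern_block_disjoint[of i j a] ij by simp
    qed
    show "S \<subseteq> {1..z + Ev + (x + Od)}" by (rule order_trans[OF S]) (use n0_eq in auto)
    show "S \<inter> {lpos i<..lpos i + llen i} = {}" if i: "i \<in> lidx" for i
    proof (cases "i = 0")
      case True then show ?thesis unfolding lower_block[OF i] using S by auto
    next
      case False then show ?thesis unfolding lower_block[OF i] using S b[OF i] by fastforce
    qed
  qed (use k0 in auto)
  also have "(\<Union>i\<in>lidx. {lpos i<..lpos i + llen i}) = {n0 + x + y<..n0 + x + z} \<union> fern a even"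
    using lower_block by (simp add: UN_insert) (auto simp: fern_block_def fern_def)
  also have "{1..0} \<union> ({n0 + x + y<..n0 + x + z} \<union> fern a even) \<union> S =
    fern a even \<union> {n0 + x + y<..n0 + x + z} \<union> S"
    by auto
  finally show ?thesis by simp
qed

text \<open>
  The up-pointing triangles on \<open>L\<close> that belong to the region.
\<close>

lemma upper_row:
  assumes "1 \<le> d" "0 < y + Od"
  shows "(- 2 * int (y + Od), 2 * int d - 1) \<in> upper \<longleftrightarrow>
    d \<le> n0 + x + y \<and> d \<notin> fern a odd \<and> d \<notin> {n0 + x + z<..n0 + x + y}"
proof -
  have 1: "(- 2 * int (y + Od), 2 * int d - 1) \<in> trap (y + Od) (x + Ev) \<longleftrightarrow> d \<le> n0 + x + y"
    using assms n0_eq by (auto simp: trap_def)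
  have 2: "(- 2 * int (y + Od), 2 * int d - 1) \<in> triangle (- 2 * int (y + Od)) (1 - 2 * int (entry a 1)) (2 * entry a 1)
      \<longleftrightarrow> d \<in> {1..entry a 1}"
    unfolding half_triangle_row_iff using assms(1) by auto
  have 3: "(- 2 * int (y + Od), 2 * int d - 1) \<in> (\<Union>i\<in>uidx. triangle (- 2 * int (y + Od)) (2 * int (upos i) + 1) (ulen i))
      \<longleftrightarrow> (\<exists>i\<in>uidx. d \<in> {upos i<..upos i + ulen i})"
    using triangle_row_iff by blast
  have 4: "(\<exists>i\<in>uidx. d \<in> {upos i<..upos i + ulen i}) \<longleftrightarrow> d \<in> {n0 + x + z<..n0 + x + y} \<or> d \<in> (\<Union>i\<in>{i\<in>{3..length a}. odd i}. fern_block a i)"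
    using upper_block by (simp add: bex_simps; auto simp: fern_block_def)
  show ?thesis unfolding upper_def Diff_iff 1 2 3 4 fern_odd_split Un_iff by blast
qed

lemma lower_row:
  assumes "1 \<le> d" "0 < z + Ev"
  shows "(- 2 * int (z + Ev), 2 * int d - 1) \<in> lower \<longleftrightarrow>
    d \<le> n0 + x + z \<and> d \<notin> fern a even \<and> d \<notin> {n0 + x + y<..n0 + x + z}"
proof -
  have 1: "(- 2 * int (z + Ev), 2 * int d - 1) \<in> trap (z + Ev) (x + Od) \<longleftrightarrow> d \<le> n0 + x + z"
    using assms n0_eq by (auto simp: trap_def)
  have 2: "(- 2 * int (z + Ev), 2 * int d - 1) \<in> triangle (- 2 * int (z + Ev)) (1 - 2 * int 0) (2 * 0) \<longleftrightarrow> False"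
    by (simp add: triangle_empty)
  have 3: "(- 2 * int (z + Ev), 2 * int d - 1) \<in> (\<Union>i\<in>lidx. triangle (- 2 * int (z + Ev)) (2 * int (lpos i) + 1) (llen i))
      \<longleftrightarrow> (\<exists>i\<in>lidx. d \<in> {lpos i<..lpos i + llen i})"
    using triangle_row_iff by blast
  have 4: "(\<exists>i\<in>lidx. d \<in> {lpos i<..lpos i + llen i}) \<longleftrightarrow> d \<in> {n0 + x + y<..n0 + x + z} \<or> d \<in> fern a even"
    using lower_block by (simp add: bex_simps; auto simp: fern_block_def fern_def)
  show ?thesis unfolding lower_def Diff_iff 1 2 3 4  by blast
qed

text \<open>
  Below \<open>L\<close> the polygon bounds, the removed triangles and the zigzag are those of \<open>lower\<close> read upside down.
\<close>

lemma H3_cells: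
  "node_of ` H3_region x y z a = upper \<union> reflect (- 2 * int (y + z + Ev + Od)) ` lower"
proof -
  define h where "h = y + z + Ev + Od"
  define m where "m = int (y + Od)"
  define U where "U = (\<Union>i \<in> {i \<in> {3..length a}. odd i}. triangle (- 2 * m) (2 * int (s_sum (i - 1) a) + 1) (entry a i))"
  define L where "L = (\<Union>i \<in> {i \<in> {1..length a}. even i}.
     {(q, c). - 2 * m - int (entry a i) \<le> q \<and> q < - 2 * m \<and> 2 * (m + int (s_sum (i - 1) a)) + 2 * (- 2 * m) - q \<le> c \<and>
        c \<le> 2 * (m + int (s_sum (i - 1) a)) + 2 * int (entry a i) + q})"
  define L' where "L' = (\<Union>i \<in> {i \<in> {1..length a}. even i}. triangle (- 2 * int (z + Ev)) (2 * int (s_sum (i - 1) a) + 1) (entry a i))"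
  have hb: "2 * h = (y + z + 2 * Ev) + (y + z + 2 * Od)" by (simp add: h_def)
  have reg: "node_of ` H3_region x y z a =
     {(q, e). - 2 * int h \<le> q \<and> q < 0 \<and> 0 \<le> e \<and> (q < - int (y + z + 2 * Od) \<longrightarrow> e \<le> 2 * int h + 2 * int (x + Od) + q) \<and>
      (- int (y + z + 2 * Od) \<le> q \<longrightarrow> e \<le> 2 * int (x + Od) + 2 * int (y + z + 2 * Ev) - 2 * int h - 1 - q)}
     - {(q, c). - 2 * m \<le> q \<and> c + q + 1 \<le> 2 * int (entry a 1) - 2 * m} - U - L"
    unfolding H3_region_def Let_def image_set_diff[OF inj_node_of] image_UN
      node_of_H3_polygon[OF hb, unfolded h_def] node_of_half_plane node_of_up_triangle node_of_down_triangle
    unfolding h_def m_def U_def L_def by (simp add: algebra_simps)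
  have up: "upper = trap (y + Od) (x + Ev) - triangle (- 2 * m) (1 - 2 * int (entry a 1)) (2 * entry a 1)
      - triangle (- 2 * m) (2 * int (n0 + x + z) + 1) (y - z) - U"
    unfolding upper_def U_def m_def by (simp add: Diff_eq Int_assoc)
  have lo: "lower = trap (z + Ev) (x + Od) - triangle (- 2 * int (z + Ev)) (2 * int (n0 + x + y) + 1) (z - y) - L'"
    unfolding lower_def L'_def by (simp add: triangle_empty Diff_eq Int_assoc)
  have mU: "- 2 * m \<le> q" if "(q, c) \<in> U" for q c using that by (auto simp: U_def triangle_def)
  have mL: "q < - 2 * m" if "(q, c) \<in> L" for q c using that by (auto simp: L_def)
  have LL: "(- 2 * int h - 1 - q, c) \<in> L' \<longleftrightarrow> (q, c) \<in> L" for q c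
  proof -
    have "(- 2 * int h - 1 - q, c) \<in> triangle (- 2 * int (z + Ev)) (2 * int s + 1) l \<longleftrightarrow>
      - 2 * m - int l \<le> q \<and> q < - 2 * m \<and> 2 * (m + int s) + 2 * (- 2 * m) - q \<le> c \<and> c \<le> 2 * (m + int s) + 2 * int l + q"
      for s l by (auto simp: triangle_def h_def m_def)
    then show ?thesis unfolding L'_def L_def by blast
  qed
  have refl: "(q, c) \<in> reflect (- 2 * int h) ` lower \<longleftrightarrow> (- 2 * int h - 1 - q, c) \<in> lower" for q c
  proof
    assume "(q, c) \<in> reflect (- 2 * int h) ` lower"
    then obtain u where "u \<in> lower" "(q, c) = reflect (- 2 * int h) u" by blast
    then show "(- 2 * int h - 1 - q, c) \<in> lower" by (cases u) (simp add: reflect_def)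
  next
    assume "(- 2 * int h - 1 - q, c) \<in> lower"
    moreover have "(q, c) = reflect (- 2 * int h) (- 2 * int h - 1 - q, c)" by (simp add: reflect_def)
    ultimately show "(q, c) \<in> reflect (- 2 * int h) ` lower" by blast
  qed
  \<comment> \<open>the two truncated differences of \<open>y\<close> and \<open>z\<close> in terms of which the case distinctions become linear\<close>
  define d1 d2 where "d1 = int (y - z)" and "d2 = int (z - y)"
  have d: "int y - int z = d1 - d2" "0 \<le> d1" "0 \<le> d2" "d1 = 0 \<or> d2 = 0" by (auto simp: d1_def d2_def)
  have n: "int n0 = int Od + int Ev" using n0_eq by simp
  have a1: "int (entry a 1) \<le> int Od" using entry_le_odd_sum[of 1 a] by simp
  have "(q, c) \<in> node_of ` H3_region x y z a \<longleftrightarrow> (q, c) \<in> upper \<union> reflect (- 2 * int h) ` lower" for q c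
  proof (cases "- 2 * m \<le> q")
    case True
    have "(- 2 * int h - 1 - q, c) \<notin> lower"
      using True unfolding lo by (auto simp: trap_def h_def m_def)
    moreover have "(q, c) \<notin> L" using mL True by force
    moreover have "(q, c) \<in> node_of ` H3_region x y z a \<longleftrightarrow> (q, c) \<in> upper" if "(q, c) \<notin> L"
      unfolding reg up using that True d n a1
      by (simp add: trap_def triangle_def flip: d1_def) (simp add: m_def h_def; linarith)
    ultimately show ?thesis unfolding Un_iff refl by blast
  next
    case False
    have "(q, c) \<notin> upper"
      using False unfolding up by (auto simp: trap_def m_def)
    moreover have "(q, c) \<notin> U" using mU False by force
    moreover have "(q, c) \<in> node_of ` H3_region x y z a \<longleftrightarrow> (- 2 * int h - 1 - q, c) \<in> lower" if "(q, c) \<notin> U"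
      unfolding reg lo using that False d n LL[of q c]
      by (simp add: trap_def triangle_def flip: d2_def) (simp add: m_def h_def; linarith)
    ultimately show ?thesis unfolding Un_iff refl by blast
  qed
  then show ?thesis unfolding h_def by (auto simp del: Un_iff)
qed

text \<open>
  The vertical lozenges crossing \<open>L\<close> are at positions \<open>S\<close> not covered by any segment or by the triangle at the eastern end.
  They act as dents of both halves.
\<close>

theorem M_H3_eq:
  "M_H3 x y z a = 2 ^ entry a 1 * (\<Sum>S\<in>Pow {n0<..n0 + x + min y z}.
     trap_count (y + Od) (fern a odd \<union> {n0 + x + z<..n0 + x + y} \<union> S) *
     trap_count (z + Ev) (fern a even \<union> {n0 + x + y<..n0 + x + z} \<union> S))"
proof -
  let ?T = "{n0<..n0 + x + min y z}"
  let ?r = "- 2 * int (y + Od)"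
  let ?\<kappa> = "- 2 * int (y + z + Ev + Od)"
  let ?B = "reflect ?\<kappa> ` lower"
  let ?f = "\<lambda>S. trap_count (y + Od) (fern a odd \<union> {n0 + x + z<..n0 + x + y} \<union> S) *
     trap_count (z + Ev) (fern a even \<union> {n0 + x + y<..n0 + x + z} \<union> S)"
  let ?avail = "{c. odd (c - ?r) \<and> (?r, c) \<in> upper \<and> (?r - 1, c) \<in> ?B}"
  have fu: "finite upper" and fl: "finite lower"
    unfolding upper_def lower_def by (intro finite_Diff finite_trap)+
  have ub: "?r \<le> q \<and> q < 0 \<and> 0 \<le> c" if "(q, c) \<in> upper" for q c
    using that unfolding upper_def by (auto simp: trap_def)
  have lb: "- 2 * int (z + Ev) \<le> q \<and> q < 0 \<and> 0 \<le> c" if "(q, c) \<in> lower" for q c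
    using that unfolding lower_def by (auto simp: trap_def)
  have refl: "(q, c) \<in> ?B \<longleftrightarrow> (?\<kappa> - 1 - q, c) \<in> lower" for q c
  proof
    assume "(q, c) \<in> ?B"
    then obtain u where "u \<in> lower" "(q, c) = reflect ?\<kappa> u" by blast
    then show "(?\<kappa> - 1 - q, c) \<in> lower" by (cases u) (simp add: reflect_def)
  next
    assume "(?\<kappa> - 1 - q, c) \<in> lower"
    moreover have "(q, c) = reflect ?\<kappa> (?\<kappa> - 1 - q, c)" by (simp add: reflect_def)
    ultimately show "(q, c) \<in> ?B" by blast
  qed
  have Bb: "?\<kappa> \<le> q \<and> q < ?r" if "(q, c) \<in> ?B" for q c
    using lb[of "?\<kappa> - 1 - q" c] that unfolding refl by auto
  have M: "M_H3 x y z a = W (upper \<union> ?B)"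
    unfolding M_H3_def H3_cells[symmetric]
  proof (rule M_zigzag_eq_W)
    fix q assume "(q, 0) \<in> node_of ` H3_region x y z a"
    then have "(q, 0) \<in> upper \<or> (q, 0) \<in> ?B" unfolding H3_cells by blast
    then show "- 2 * int (y + z + Ev + Od) \<le> q \<and> q < 0" using ub[of q 0] Bb[of q 0] by auto
  qed
  have cut: "W (upper \<union> ?B) = (\<Sum>C\<in>Pow ?avail.
      (if 0 \<in> C then 1/2 else 1) * (W (upper - {?r} \<times> C) * W (?B - {?r - 1} \<times> C)))"
    by (rule W_level_cut) (use fu fl ub Bb in \<open>blast | auto\<close>)+
  have term_eq: "(if 0 \<in> dents S then 1/2 else 1) * (W (upper - {?r} \<times> dents S) * W (?B - {?r - 1} \<times> dents S))
      = 2 ^ entry a 1 * ?f S"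
    if S: "S \<subseteq> ?T" and S0: "y + Od = 0 \<Longrightarrow> S = {}" "z + Ev = 0 \<Longrightarrow> S = {}" for S
  proof -
    have "odd c" if "c \<in> dents S" for c using that by (auto simp: dents_def)
    then have 0: "0 \<notin> dents S" by (metis even_zero)
    have "?B - {?r - 1} \<times> dents S = reflect ?\<kappa> ` (lower - {- 2 * int (z + Ev)} \<times> dents S)"
    proof -
      have inj: "inj (reflect ?\<kappa>)" by (metis injI reflect_reflect)
      have "reflect ?\<kappa> ` ({- 2 * int (z + Ev)} \<times> dents S) = {?r - 1} \<times> dents S"
        by (force simp: reflect_def image_iff)
      then show ?thesis unfolding image_set_diff[OF inj] by simp
    qed
    then have "W (?B - {?r - 1} \<times> dents S) = W (lower - {- 2 * int (z + Ev)} \<times> dents S)"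
      using W_reflect[of ?\<kappa>] by simp
    then show ?thesis
      using 0 W_upper[OF S S0(1)] W_lower[OF S S0(2)] by simp
  qed
  show ?thesis
  \<comment> \<open>one of the halves can be empty, and then no lozenge crosses \<open>L\<close>\<close>
  proof (cases "y + Od = 0 \<or> z + Ev = 0")
    case True
    have e: "?avail = {}"
    proof (rule equals0I)
      fix c assume c: "c \<in> ?avail"
      then have "(?r, c) \<in> upper" "(?\<kappa> - 1 - (?r - 1), c) \<in> lower" unfolding refl by auto
      from ub[OF this(1)] lb[OF this(2)] True show False by auto
    qed
    have "?f S = 0" if "S \<in> Pow ?T - {{}}" for S
    proof -
      have S: "finite S" "S \<noteq> {}" using that finite_subset[of S ?T] by auto
      have "trap_count 0 (A \<union> S) = 0" if "finite A" for A
        using S that by (simp add: trap_count_def)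
      then have "trap_count 0 (fern a odd \<union> {n0 + x + z<..n0 + x + y} \<union> S) = 0"
        "trap_count 0 (fern a even \<union> {n0 + x + y<..n0 + x + z} \<union> S) = 0"
        by (simp_all only: finite_fern finite_Un finite_greaterThanAtMost simp_thms)
      with True show ?thesis by (elim disjE) (simp_all only: mult_zero_left mult_zero_right)
    qed
    then have "(\<Sum>S\<in>Pow ?T. ?f S) = (\<Sum>S\<in>{{}}. ?f S)"
      by (intro sum.mono_neutral_right) auto
    moreover have "dents {} = {}" by (simp add: dents_def)
    ultimately show ?thesis unfolding M cut e using term_eq[of "{}"] by simp
  next
    case False
    then have pos: "0 < y + Od" "0 < z + Ev" by auto
    have k: "?\<kappa> - 1 - (?r - 1) = - 2 * int (z + Ev)" by simp
    have row: "2 * int d - 1 \<in> ?avail \<longleftrightarrow> d \<in> ?T" if d: "1 \<le> d" for d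
    proof -
      have "fern a odd \<union> fern a even = (\<Union>i\<in>{1..length a}. fern_block a i)"
        unfolding fern_def by blast
      then have "d \<in> fern a odd \<or> d \<in> fern a even \<longleftrightarrow> d \<in> {1..n0}"
        unfolding fern_blocks_cover by blast
      moreover have "2 * int d - 1 \<in> ?avail \<longleftrightarrow> (d \<le> n0 + x + y \<and> d \<notin> fern a odd \<and> d \<notin> {n0 + x + z<..n0 + x + y})
         \<and> (d \<le> n0 + x + z \<and> d \<notin> fern a even \<and> d \<notin> {n0 + x + y<..n0 + x + z})"
        unfolding mem_Collect_eq refl k upper_row[OF d pos(1)] lower_row[OF d pos(2)] by simp
      ultimately show ?thesis using d by auto
    qed
    have avail: "?avail = dents ?T"
    proof (intro equalityI subsetI)
      fix c assume c: "c \<in> ?avail"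
      then have "odd c" "0 \<le> c" using ub by auto
      then obtain j where "c = 2 * j + 1" by (elim oddE)
      then have d: "c = 2 * int (nat (j + 1)) - 1" "1 \<le> nat (j + 1)" using \<open>0 \<le> c\<close> by auto
      have "nat (j + 1) \<in> ?T" using row[OF d(2)] c unfolding d(1)[symmetric] by blast
      then show "c \<in> dents ?T" unfolding dents_def using d(1) by blast
    next
      fix c assume "c \<in> dents ?T"
      then obtain d where "c = 2 * int d - 1" "d \<in> ?T" by (auto simp: dents_def)
      then show "c \<in> ?avail" using row[of d] by auto
    qed
    have inj: "inj (\<lambda>d. 2 * int d - 1)" by (auto simp: inj_def)
    have P: "Pow (dents ?T) = dents ` Pow ?T"
      unfolding dents_def by (simp add: image_Pow_surj)
    have "inj_on dents (Pow ?T)"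
      unfolding dents_def using inj_image_eq_iff[OF inj] by (auto simp: inj_on_def)
    then have "W (upper \<union> ?B) = (\<Sum>S\<in>Pow ?T.
      (if 0 \<in> dents S then 1/2 else 1) * (W (upper - {?r} \<times> dents S) * W (?B - {?r - 1} \<times> dents S)))"
      unfolding cut avail P by (simp add: sum.reindex)
    also have "\<dots> = (\<Sum>S\<in>Pow ?T. 2 ^ entry a 1 * ?f S)"
      using pos by (intro sum.cong refl term_eq) auto
    finally show ?thesis unfolding M by (simp add: sum_distrib_left)
  qed
qed

end

section \<open>The dent product of unions and intervals\<close>

text \<open>
  The interaction of the positions \<open>d\<close> and \<open>e\<close> in \<open>V\<close>, and that of two sets of positions.  The absolute value makes it symmetric.
\<close>

definition pair :: "nat \<Rightarrow> nat \<Rightarrow> real" where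
  "pair d e = \<bar>(real e - real d) * (real e + real d - 1)\<bar>"

definition link :: "nat set \<Rightarrow> nat set \<Rightarrow> real" where
  "link A B = (\<Prod>a\<in>A. \<Prod>b\<in>B. pair a b)"

lemma pair_commute: "pair d e = pair e d"
  by (simp add: pair_def abs_mult abs_minus_commute add.commute)

lemma pair_less: "1 \<le> d \<Longrightarrow> d < e \<Longrightarrow> pair d e = (real e - real d) * (real e + real d - 1)"
  by (simp add: pair_def)

lemma pair_pos: "1 \<le> d \<Longrightarrow> 1 \<le> e \<Longrightarrow> d \<noteq> e \<Longrightarrow> 0 < pair d e"
  by (auto simp: pair_def)

lemma link_commute: "link A B = link B A"
  unfolding link_def by (subst prod.swap) (simp add: pair_commute)

lemma link_Un_left: "finite A \<Longrightarrow> finite B \<Longrightarrow> A \<inter> B = {} \<Longrightarrow> link (A \<union> B) C = link A C * link B C"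
  unfolding link_def by (rule prod.union_disjoint)

lemma link_empty [simp]: "link {} B = 1" "link A {} = 1"
  by (simp_all add: link_def)

lemma V_pair:
  assumes "S \<subseteq> {1..}"
  shows "V S = (\<Prod>d\<in>S. real d - 1 / 2) * (\<Prod>e\<in>S. \<Prod>d\<in>{d\<in>S. d < e}. pair d e)"
  unfolding V_def by (intro arg_cong2[where f = "(*)"] refl prod.cong) (use assms in \<open>auto simp: pair_less\<close>)

lemma V_pos: "S \<subseteq> {1..} \<Longrightarrow> 0 < V S"
  unfolding V_pair by (intro mult_pos_pos prod_pos pair_pos) force+

lemma V_Un:
  assumes fin: "finite A" "finite B" and dis: "A \<inter> B = {}" and pos: "A \<subseteq> {1..}" "B \<subseteq> {1..}"
  shows "V (A \<union> B) = V A * V B * link A B"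
proof -
  let ?in = "\<lambda>A B. \<Prod>e\<in>A. \<Prod>d\<in>{d\<in>B. d < e}. pair d e"
  have split: "(\<Prod>d\<in>{d\<in>A \<union> B. d < e}. pair d e) = (\<Prod>d\<in>{d\<in>A. d < e}. pair d e) * (\<Prod>d\<in>{d\<in>B. d < e}. pair d e)" for e
  proof -
    have "{d\<in>A \<union> B. d < e} = {d\<in>A. d < e} \<union> {d\<in>B. d < e}" by auto
    then show ?thesis using fin dis by (simp add: prod.union_disjoint disjoint_iff)
  qed
  have "?in (A \<union> B) (A \<union> B) = ?in A (A \<union> B) * ?in B (A \<union> B)"
    using fin dis by (rule prod.union_disjoint)
  also have "\<dots> = ?in A A * ?in A B * (?in B A * ?in B B)"
    by (simp only: split prod.distrib)
  finally have 1: "?in (A \<union> B) (A \<union> B) = ?in A A * ?in B B * (?in A B * ?in B A)" by simp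
  have "?in B A = (\<Prod>a\<in>A. \<Prod>b\<in>{b\<in>B. a < b}. pair a b)"
    using fin(2,1) by (rule prod.swap_restrict)
  moreover have "link A B = (\<Prod>a\<in>A. (\<Prod>b\<in>{b\<in>B. b < a}. pair b a) * (\<Prod>b\<in>{b\<in>B. a < b}. pair a b))"
    unfolding link_def
  proof (rule prod.cong[OF refl])
    fix a assume a: "a \<in> A"
    have "B = {b\<in>B. b < a} \<union> {b\<in>B. a < b}" using a dis by (auto simp: neq_iff)
    then have "(\<Prod>b\<in>B. pair a b) = (\<Prod>b\<in>{b\<in>B. b < a} \<union> {b\<in>B. a < b}. pair a b)" by simp
    also have "\<dots> = (\<Prod>b\<in>{b\<in>B. b < a}. pair a b) * (\<Prod>b\<in>{b\<in>B. a < b}. pair a b)"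
      using fin(2) by (intro prod.union_disjoint) auto
    finally show "(\<Prod>b\<in>B. pair a b) = (\<Prod>b\<in>{b\<in>B. b < a}. pair b a) * (\<Prod>b\<in>{b\<in>B. a < b}. pair a b)"
      using pair_commute[of a] by (simp cong: prod.cong)
  qed
  ultimately have 2: "?in A B * ?in B A = link A B" by (simp add: prod.distrib)
  have "(\<Prod>d\<in>A \<union> B. real d - 1 / 2) = (\<Prod>d\<in>A. real d - 1 / 2) * (\<Prod>d\<in>B. real d - 1 / 2)"
    using fin dis by (rule prod.union_disjoint)
  then show ?thesis
    unfolding V_pair[OF pos(1)] V_pair[OF pos(2)] V_pair[OF Un_least[OF pos]] 1 2[symmetric]
    by (simp only: mult_ac)
qed

text \<open>
  Superfactorials, and their analogue for the quotients \<open>(2 * i)! / i!\<close>, that is, for \<open>4 ^ i * (1 / 2)\<^sub>i\<close>.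
\<close>

definition sf :: "nat \<Rightarrow> real" where "sf n = (\<Prod>i<n. fact i)"

definition hs :: "nat \<Rightarrow> real" where "hs n = (\<Prod>i<n. fact (2 * i) / fact i)"

lemma sf_pos [simp]: "0 < sf n" and hs_pos [simp]: "0 < hs n"
  by (auto simp: sf_def hs_def intro!: prod_pos)

lemma sf_nonzero [simp]: "sf n \<noteq> 0" and hs_nonzero [simp]: "hs n \<noteq> 0"
  using sf_pos[of n] hs_pos[of n] by linarith+

lemma sf_Suc: "sf (Suc n) = sf n * fact n" and hs_Suc: "hs (Suc n) = hs n * (fact (2 * n) / fact n)"
  by (simp_all add: sf_def hs_def)

lemma prod_fact_shift: "(\<Prod>l<m. fact (w + l)) = sf (w + m) / sf w"
  by (induction m) (auto simp: sf_Suc)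

lemma prod_hs_shift: "(\<Prod>l<m. fact (2 * (w + l)) / fact (w + l)) = hs (w + m) / hs w"
proof (induction m)
  case (Suc m)
  then show ?case by (simp add: hs_Suc)
qed simp

lemma sf_double: "sf (2 * m) = sf m ^ 2 * hs m * hs (Suc m) / 2 ^ m"
proof (induction m)
  case (Suc m)
  define F G H c P :: real where "F = fact (2 * m)" and "G = fact m" and "H = fact (2 * Suc m)"
    and "c = real m + 1" and "P = 2 ^ m"
  have nz: "F \<noteq> 0" "G \<noteq> 0" "H \<noteq> 0" "c \<noteq> 0" "P \<noteq> 0"
    by (auto simp: F_def G_def H_def c_def P_def)
  have "fact (2 * m + 1) = H / (2 * c)" by (simp add: H_def c_def field_simps)
  then have 1: "sf (2 * Suc m) = sf (2 * m) * F * (H / (2 * c))" by (simp add: sf_Suc F_def)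
  have 2: "sf (Suc m) = sf m * G" "hs (Suc m) = hs m * (F / G)" by (simp_all add: sf_Suc hs_Suc F_def G_def)
  have "fact (Suc m) = c * G" by (simp add: c_def G_def)
  then have 3: "hs (Suc (Suc m)) = hs m * (F / G) * (H / (c * G))"
    unfolding hs_Suc[of "Suc m"] 2 H_def by simp
  have 4: "2 ^ Suc m = 2 * P" by (simp add: P_def)
  show ?case unfolding 1 3 4 Suc unfolding 2 P_def[symmetric]
    using nz by (simp add: field_simps power2_eq_square)
qed (simp add: sf_def hs_def)

lemma prod_greaterThanAtMost_shift: "(\<Prod>t\<in>{p<..p + q}. f t) = (\<Prod>j<q. f (p + j + 1))" for f :: "nat \<Rightarrow> real"
  by (rule prod.reindex_bij_witness[where i = "\<lambda>j. p + j + 1" and j = "\<lambda>t. t - p - 1"]) auto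

text \<open>
  The closed form of \<open>V\<close> for an interval of positions.
\<close>

lemma V_block:
  "V {p<..p + q} = hs (p + q + 1) / hs (p + 1) * sf q * sf (p + q) * sf (2 * p) / (sf p * sf (2 * p + q) * 4 ^ q)"
proof (induction q)
  case 0
  show ?case by (simp add: V_def sf_def)
next
  case (Suc q)
  have e: "{p<..p + Suc q} = {p<..p + q} \<union> {p + q + 1}" by auto
  have "V {p + q + 1} = real (p + q + 1) - 1 / 2"
  proof -
    have "(\<Prod>e\<in>{p + q + 1}. \<Prod>d\<in>{d\<in>{p + q + 1}. d < e}. (real e - real d) * (real e + real d - 1)) = 1"
      by (intro prod.neutral ballI) auto
    then show ?thesis unfolding V_def by (simp only: prod.insert prod.empty finite.emptyI empty_iff) simp
  qed
  moreover have "link {p<..p + q} {p + q + 1} = fact q * (fact (2 * p + 2 * q) / fact (2 * p + q))"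
  proof -
    have "link {p<..p + q} {p + q + 1} = (\<Prod>j<q. real (q - j) * real (2 * p + q + j + 1))"
      unfolding link_def prod_greaterThanAtMost_shift
      by (rule prod.cong) (auto simp: pair_less of_nat_diff algebra_simps)
    also have "\<dots> = (\<Prod>j<q. real (q - j)) * (\<Prod>j<q. real (2 * p + q + j + 1))"
      by (rule prod.distrib)
    also have "(\<Prod>j<q. real (q - j)) = fact q"
      by (simp add: fact_prod_rev atLeast0LessThan)
    also have "(\<Prod>j<r. real (w + j + 1)) = fact (w + r) / fact w" for r w
    proof (induction r)
      case (Suc r)
      have "fact (w + Suc r) = real (w + r + 1) * fact (w + r)" by simp
      then show ?case unfolding prod.lessThan_Suc Suc by simp
    qed simp
    finally show ?thesis by (simp add: algebra_simps mult_2)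
  qed
  ultimately have 1: "V {p<..p + Suc q} = V {p<..p + q} * (real (p + q + 1) - 1 / 2) * (fact q * (fact (2 * p + 2 * q) / fact (2 * p + q)))"
    unfolding e by (subst V_Un) auto
  have "fact (2 * (p + q + 1)) / fact (p + q + 1) = 4 * (real (p + q + 1) - 1 / 2) * (fact (2 * p + 2 * q) / fact (p + q))"
  proof -
    define F G c :: real where "F = fact (2 * p + 2 * q)" and "G = fact (p + q)" and "c = real (p + q + 1)"
    have e: "fact (2 * (p + q + 1)) = (2 * c) * (2 * c - 1) * F" "fact (p + q + 1) = c * G"
      by (simp_all add: F_def G_def c_def algebra_simps)
    have nz: "c \<noteq> 0" "G \<noteq> 0" by (simp_all add: c_def G_def)
    show ?thesis unfolding e F_def[symmetric] G_def[symmetric] c_def[symmetric]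
      using nz by (simp add: field_simps)
  qed
  then have 2: "hs (p + Suc q + 1) = hs (p + q + 1) * (4 * (real (p + q + 1) - 1 / 2) * (fact (2 * p + 2 * q) / fact (p + q)))"
    using hs_Suc[of "p + q + 1"] by simp
  have 3: "sf (Suc q) = sf q * fact q" "sf (p + Suc q) = sf (p + q) * fact (p + q)"
    "sf (2 * p + Suc q) = sf (2 * p + q) * fact (2 * p + q)" "(4 :: real) ^ Suc q = 4 * 4 ^ q"
    by (simp_all add: sf_Suc)
  define c F2 Fq F F3 :: real where "c = real (p + q + 1) - 1 / 2" and "F2 = fact (2 * p + 2 * q)"
    and "Fq = fact q" and "F = fact (p + q)" and "F3 = fact (2 * p + q)"
  have "F2 \<noteq> 0" "Fq \<noteq> 0" "F \<noteq> 0" "F3 \<noteq> 0" by (simp_all add: F2_def Fq_def F_def F3_def)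
  then show ?case
    unfolding 1 Suc 2 3 c_def[symmetric] F2_def[symmetric] Fq_def[symmetric] F_def[symmetric] F3_def[symmetric]
    by (simp add: field_simps)
qed

text \<open>
  The interaction of a set of positions in \<open>{1..n}\<close> with all positions up to \<open>n + c\<close>, apart from a normalisation that does not depend on \<open>c\<close>:
  see \<open>link_interval\<close>.
\<close>

definition K :: "nat \<Rightarrow> nat \<Rightarrow> nat set \<Rightarrow> real" where
  "K n c S = (\<Prod>s\<in>S. fact (n + c - s) * fact (n + c + s - 1))"

lemma K_pos: "0 < K n c S"
  unfolding K_def by (intro prod_pos) auto

lemma K_nonzero [simp]: "K n c S \<noteq> 0"
  using K_pos[of n c S] by simp

lemma K_Un: "finite A \<Longrightarrow> finite B \<Longrightarrow> A \<inter> B = {} \<Longrightarrow> K n c (A \<union> B) = K n c A * K n c B"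
  unfolding K_def by (rule prod.union_disjoint)

lemma link_interval:
  assumes A: "A \<subseteq> {1..n}" and pq: "p \<le> q"
  shows "link A {n + p<..n + q} = K n q A / K n p A"
proof -
  have *: "(\<Prod>t\<in>{n + p<..n + p + r}. pair s t) =
      fact (n + p + r - s) * fact (n + p + r + s - 1) / (fact (n + p - s) * fact (n + p + s - 1))"
    if s: "1 \<le> s" "s \<le> n" for r s
  proof (induction r)
    case (Suc r)
    have "{n + p<..n + p + Suc r} = insert (n + p + Suc r) {n + p<..n + p + r}" by auto
    then have "(\<Prod>t\<in>{n + p<..n + p + Suc r}. pair s t) = pair s (n + p + Suc r) * (\<Prod>t\<in>{n + p<..n + p + r}. pair s t)"
      by simp
    moreover have "fact (n + p + Suc r - s) = (real (n + p + Suc r) - real s) * fact (n + p + r - s)"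
      using s by (simp add: Suc_diff_le of_nat_diff)
    moreover have "fact (n + p + Suc r + s - 1) = (real (n + p + Suc r) + real s - 1) * fact (n + p + r + s - 1)"
      using s by (cases s) auto
    ultimately show ?case using Suc s by (simp add: pair_less)
  qed simp
  obtain r where r: "q = p + r" using pq le_Suc_ex by blast
  have "link A {n + p<..n + q} = (\<Prod>s\<in>A. fact (n + q - s) * fact (n + q + s - 1) / (fact (n + p - s) * fact (n + p + s - 1)))"
    unfolding link_def r add.assoc[symmetric] by (rule prod.cong[OF refl], rule *) (use A in auto)
  then show ?thesis by (simp add: K_def prod_dividef)
qed

lemma K_interval:
  assumes "p + m \<le> n + c"
  shows "K n c {p<..p + m} = (\<Prod>l<m. fact (n + c - p - m + l)) * (\<Prod>l<m. fact (n + c + p + l))"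
proof -
  have "K n c {p<..p + m} = (\<Prod>l<m. fact (n + c - p - Suc l)) * (\<Prod>l<m. fact (n + c + p + l))"
    unfolding K_def prod_greaterThanAtMost_shift by (simp add: prod.distrib algebra_simps)
  also have "(\<Prod>l<m. fact (n + c - p - Suc l)) = (\<Prod>l<m. fact (n + c - p - m + (m - Suc l)) :: real)"
    by (rule prod.cong) (use assms in \<open>auto intro!: arg_cong[where f = fact]\<close>)
  also have "\<dots> = (\<Prod>l<m. fact (n + c - p - m + l))"
    by (rule prod.nat_diff_reindex)
  finally show ?thesis .
qed

section \<open>The Andreief identity and a binomial determinant\<close>

text \<open>
  The Andreief (discrete Cauchy--Binet) identity.  The map \<open>e\<close> enumerates each set \<open>S\<close>; any enumeration will do, as
  the two determinants on the right change sign together.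
\<close>

lemma D_Andreief:
  fixes p q :: "nat \<Rightarrow> nat \<Rightarrow> real" and w :: "nat \<Rightarrow> real"
  assumes T: "finite T"
    and e: "\<And>S. S \<subseteq> T \<Longrightarrow> card S = m \<Longrightarrow> bij_betw (e S) {..<m} S"
  shows "D m (\<lambda>i j. \<Sum>s\<in>T. w s * p i s * q j s) =
    (\<Sum>S | S \<subseteq> T \<and> card S = m. (\<Prod>s\<in>S. w s) * D m (\<lambda>i j. p j (e S i)) * D m (\<lambda>i j. q j (e S i)))"
proof -
  let ?F = "\<lambda>y. (\<Prod>i<m. w (y i) * p i (y i)) * D m (\<lambda>i j. q j (y i))"
  let ?E = "PiE {..<m} (\<lambda>_. T)"
  let ?SS = "{S. S \<subseteq> T \<and> card S = m}"
  have fE: "finite ?E" by (rule finite_PiE) (use T in auto)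
  have fSS: "finite ?SS" by (rule finite_subset[of _ "Pow T"]) (use T in auto)
  have "D m (\<lambda>i j. \<Sum>s\<in>T. w s * p i s * q j s) = (\<Sum>y\<in>?E. D m (\<lambda>i j. (w (y i) * p i (y i)) * q j (y i)))"
    by (rule D_sum_rows) (use T in auto)
  also have "\<dots> = (\<Sum>y\<in>?E. ?F y)" by (simp only: D_scale_rows)
  also have "\<dots> = (\<Sum>y\<in>{y\<in>?E. inj_on y {..<m}}. ?F y)"
  proof (rule sum.mono_neutral_right[OF fE])
    \<comment> \<open>tuples with a repetition give a determinant with two equal rows\<close>
    show "\<forall>y\<in>?E - {y\<in>?E. inj_on y {..<m}}. ?F y = 0"
    proof
      fix y assume "y \<in> ?E - {y\<in>?E. inj_on y {..<m}}"
      then obtain i k where "i < m" "k < m" "i \<noteq> k" "y i = y k" by (auto simp: inj_on_def)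
      then have "D m (\<lambda>i j. q j (y i)) = 0" by (intro D_identical_rows[of i m k]) auto
      then show "?F y = 0" by simp
    qed
  qed auto
  also have "\<dots> = (\<Sum>S\<in>?SS. \<Sum>y\<in>{y\<in>{y\<in>?E. inj_on y {..<m}}. y ` {..<m} = S}. ?F y)"
  proof (rule sum.group[symmetric])
    show "finite {y\<in>?E. inj_on y {..<m}}" using fE by auto
    show "(\<lambda>y. y ` {..<m}) ` {y\<in>?E. inj_on y {..<m}} \<subseteq> ?SS"
      by (auto simp: card_image PiE_iff)
  qed (rule fSS)
  also have "\<dots> = (\<Sum>S\<in>?SS. (\<Prod>s\<in>S. w s) * D m (\<lambda>i j. p j (e S i)) * D m (\<lambda>i j. q j (e S i)))"
  proof (rule sum.cong[OF refl])
    fix S assume "S \<in> ?SS"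
    then have S: "S \<subseteq> T" "card S = m" by auto
    note b = e[OF S]
    have inj: "inj_on (e S) {..<m}" and img: "e S ` {..<m} = S" using b by (auto simp: bij_betw_def)
    have "(\<Sum>y\<in>{y\<in>{y\<in>?E. inj_on y {..<m}}. y ` {..<m} = S}. ?F y) =
      (\<Sum>\<pi> | \<pi> permutes {..<m}. (\<Prod>s\<in>S. w s) * (signof \<pi> * (\<Prod>i<m. p i (e S (\<pi> i)))) * D m (\<lambda>i j. q j (e S i)))"
    proof (rule sum.reindex_bij_witness[symmetric, where
          j = "\<lambda>\<pi>. restrict (\<lambda>i. e S (\<pi> i)) {..<m}" and
          i = "\<lambda>y i. if i < m then inv_into {..<m} (e S) (y i) else i"])
      fix \<pi> assume "\<pi> \<in> {\<pi>. \<pi> permutes {..<m}}"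
      then have \<pi>: "\<pi> permutes {..<m}" by simp
      have im: "\<pi> i < m \<longleftrightarrow> i < m" for i using permutes_in_image[OF \<pi>] by auto
      show "(\<lambda>i. if i < m then inv_into {..<m} (e S) (restrict (\<lambda>i. e S (\<pi> i)) {..<m} i) else i) = \<pi>"
        using inj im permutes_not_in[OF \<pi>] by (auto simp: fun_eq_iff)
      have "restrict (\<lambda>i. e S (\<pi> i)) {..<m} ` {..<m} = e S ` \<pi> ` {..<m}" by (simp add: image_image)
      also have "\<dots> = S" using permutes_image[OF \<pi>] img by simp
      finally have 1: "restrict (\<lambda>i. e S (\<pi> i)) {..<m} ` {..<m} = S" .
      have 2: "inj_on (restrict (\<lambda>i. e S (\<pi> i)) {..<m}) {..<m}"
        by (rule eq_card_imp_inj_on) (use 1 S in auto)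
      show "restrict (\<lambda>i. e S (\<pi> i)) {..<m} \<in> {y\<in>{y\<in>?E. inj_on y {..<m}}. y ` {..<m} = S}"
        using 1 2 S(1) by auto
      have "(\<Prod>i<m. w (e S (\<pi> i))) = (\<Prod>i<m. w (e S i))"
        by (rule prod.reindex_bij_betw) (rule permutes_imp_bij[OF \<pi>])
      also have "\<dots> = (\<Prod>s\<in>S. w s)" by (rule prod.reindex_bij_betw[OF b])
      finally have 3: "(\<Prod>i<m. w (e S (\<pi> i))) = (\<Prod>s\<in>S. w s)" .
      have "D m (\<lambda>i j. q j (restrict (\<lambda>i. e S (\<pi> i)) {..<m} i)) = D m (\<lambda>i j. q j (e S (\<pi> i)))"
        by (rule D_cong) simp
      also have "\<dots> = signof \<pi> * D m (\<lambda>i j. q j (e S i))"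
        by (rule D_permute_rows[OF \<pi>])
      finally show "?F (restrict (\<lambda>i. e S (\<pi> i)) {..<m}) =
        (\<Prod>s\<in>S. w s) * (signof \<pi> * (\<Prod>i<m. p i (e S (\<pi> i)))) * D m (\<lambda>i j. q j (e S i))"
        using 3 by (simp add: prod.distrib)
    next
      fix y assume "y \<in> {y\<in>{y\<in>?E. inj_on y {..<m}}. y ` {..<m} = S}"
      then have y: "y \<in> ?E" "inj_on y {..<m}" "y ` {..<m} = S" by auto
      let ?\<pi> = "\<lambda>i. if i < m then inv_into {..<m} (e S) (y i) else i"
      have yS: "y i \<in> e S ` {..<m}" if "i < m" for i using y(3) img that by auto
      show "restrict (\<lambda>i. e S (?\<pi> i)) {..<m} = y"
        by (rule ext) (use y(1) f_inv_into_f[OF yS] in \<open>auto simp: PiE_iff extensional_def\<close>)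
      have "bij_betw (inv_into {..<m} (e S)) S {..<m}" by (rule bij_betw_inv_into[OF b])
      moreover have "bij_betw y {..<m} S" using y by (auto simp: bij_betw_def)
      ultimately have "bij_betw (inv_into {..<m} (e S) \<circ> y) {..<m} {..<m}" by (rule bij_betw_trans[rotated])
      then have "bij_betw ?\<pi> {..<m} {..<m}" by (rule bij_betw_cong[THEN iffD1, rotated]) auto
      then show "?\<pi> \<in> {\<pi>. \<pi> permutes {..<m}}" unfolding mem_Collect_eq by (rule bij_imp_permutes) simp
    qed
    also have "\<dots> = (\<Prod>s\<in>S. w s) * (\<Sum>\<pi> | \<pi> permutes {..<m}. signof \<pi> * (\<Prod>i<m. p i (e S (\<pi> i)))) * D m (\<lambda>i j. q j (e S i))"
      by (simp add: sum_distrib_left sum_distrib_right)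
    also have "(\<Sum>\<pi> | \<pi> permutes {..<m}. signof \<pi> * (\<Prod>i<m. p i (e S (\<pi> i)))) = D m (\<lambda>i j. p j (e S i))"
      using D_transpose[of m "\<lambda>i j. p j (e S i)"] by (simp add: D_expand)
    finally show "(\<Sum>y\<in>{y\<in>{y\<in>?E. inj_on y {..<m}}. y ` {..<m} = S}. ?F y) =
      (\<Prod>s\<in>S. w s) * D m (\<lambda>i j. p j (e S i)) * D m (\<lambda>i j. q j (e S i))" .
  qed
  finally show ?thesis .
qed

lemma D_reverse:
  "D n (\<lambda>i j. f (n - Suc i) (n - Suc j)) = D n f"
proof -
  define \<pi> where "\<pi> = (\<lambda>i. if i < n then n - Suc i else i)"
  have \<pi>: "\<pi> permutes {..<n}"
  proof (rule bij_imp_permutes)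
    show "bij_betw \<pi> {..<n} {..<n}" by (rule bij_betw_byWitness[where f' = \<pi>]) (auto simp: \<pi>_def)
  qed (auto simp: \<pi>_def)
  have "D n (\<lambda>i j. f (n - Suc i) (n - Suc j)) = D n (\<lambda>i j. f (\<pi> i) (\<pi> j))"
    by (rule D_cong) (simp add: \<pi>_def)
  also have "\<dots> = signof \<pi> * D n (\<lambda>i j. f i (\<pi> j))" by (rule D_permute_rows[OF \<pi>])
  also have "D n (\<lambda>i j. f i (\<pi> j)) = D n (\<lambda>i j. f j (\<pi> i))" by (rule D_transpose[symmetric])
  also have "\<dots> = signof \<pi> * D n (\<lambda>i j. f j i)" by (rule D_permute_rows[OF \<pi>])
  also have "D n (\<lambda>i j. f j i) = D n f" by (rule D_transpose)
  also have "signof \<pi> * (signof \<pi> * D n f) = D n f"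
    by (simp add: sign_def)
  finally show ?thesis .
qed

text \<open>
  Multiplication by the unitriangular matrix of the numbers \<open>i choose k\<close> turns the Hankel matrix into one
  whose entries have, after removal of row and column factors, the form of monic polynomials in the row index.
\<close>

lemma D_binomial:
  fixes T :: real
  assumes mL: "m \<le> Suc L"
  shows "D m (\<lambda>i j. if i + j \<le> L then T gchoose (L - i - j) else 0) =
    (\<Prod>i<m. (- 1) ^ i * fact i * (\<Prod>r<Suc L - m. T + real i - real r) / fact (L - i))"
proof -
  let ?b = "\<lambda>i j. if i + j \<le> L then T gchoose (L - i - j) else 0"
  \<comment> \<open>the entries \<open>i choose k\<close> form a unitriangular matrix\<close>
  have "D m (\<lambda>i k. real i gchoose k) = 1"
    by (subst D_lower) (auto simp: binomial_gbinomial[symmetric] binomial_eq_0)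
  then have "D m ?b = D m (\<lambda>i j. \<Sum>k<m. (real i gchoose k) * ?b k j)"
    by (simp add: D_mult)
  also have "\<dots> = D m (\<lambda>i j. (real i + T) gchoose (L - j))"
  proof (rule D_cong)
    fix i j assume i: "i < m" and j: "j < m"
    have jL: "j \<le> L" using j mL by simp
    have z: "real i gchoose k = 0" if "i < k" for k
      using that by (simp add: binomial_gbinomial[symmetric] binomial_eq_0)
    have "(\<Sum>k<m. (real i gchoose k) * ?b k j) = (\<Sum>k\<in>{..<m} \<inter> {..L - j}. (real i gchoose k) * (T gchoose (L - j - k)))"
      using jL by (intro sum.mono_neutral_cong_right) (auto simp: algebra_simps)
    also have "\<dots> = (\<Sum>k\<le>L - j. (real i gchoose k) * (T gchoose (L - j - k)))"
    proof (rule sum.mono_neutral_left)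
      show "\<forall>k\<in>{..L - j} - {..<m} \<inter> {..L - j}. (real i gchoose k) * (T gchoose (L - j - k)) = 0"
      proof
        fix k assume "k \<in> {..L - j} - {..<m} \<inter> {..L - j}"
        then have "i < k" using i by auto
        then show "(real i gchoose k) * (T gchoose (L - j - k)) = 0" by (simp add: z)
      qed
    qed auto
    also have "\<dots> = (real i + T) gchoose (L - j)"
      using gbinomial_Vandermonde[of "real i" T "L - j"] by (simp add: atMost_atLeast0)
    finally show "(\<Sum>k<m. (real i gchoose k) * ?b k j) = (real i + T) gchoose (L - j)" .
  qed
  also have "\<dots> = D m (\<lambda>i j. (1 / fact (L - j)) * ((\<Prod>r<Suc L - m. T + real i - real r) *
      (\<Prod>k<m - Suc j. real i + (T - real (Suc L - m + k)))))"
  proof (rule D_cong)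
    fix i j assume i: "i < m" and j: "j < m"
    have e: "L - j = (Suc L - m) + (m - Suc j)" using j mL by simp
    have split: "(\<Prod>r<a + b. f r) = (\<Prod>r<a. f r) * (\<Prod>k<b. f (a + k))" for a b and f :: "nat \<Rightarrow> real"
      by (induction b) (auto simp: mult.assoc)
    have "(\<Prod>r<L - j. T + real i - real r) = (\<Prod>r<Suc L - m. T + real i - real r) *
      (\<Prod>k<m - Suc j. T + real i - real (Suc L - m + k))"
      unfolding e by (rule split)
    moreover have sh: "T + real i - real c = real i + (T - real c)" for c by simp
    ultimately have "(\<Prod>r<L - j. T + real i - real r) = (\<Prod>r<Suc L - m. T + real i - real r) *
      (\<Prod>k<m - Suc j. real i + (T - real (Suc L - m + k)))"
      by (simp only: sh)
    then show "(real i + T) gchoose (L - j) = (1 / fact (L - j)) * ((\<Prod>r<Suc L - m. T + real i - real r) *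
      (\<Prod>k<m - Suc j. real i + (T - real (Suc L - m + k))))"
      unfolding gbinomial_prod_rev by (simp add: atLeast0LessThan add.commute)
  qed
  also have "\<dots> = (\<Prod>j<m. 1 / fact (L - j)) * ((\<Prod>i<m. \<Prod>r<Suc L - m. T + real i - real r) *
      D m (\<lambda>i j. \<Prod>k<m - Suc j. real i + (T - real (Suc L - m + k))))"
    by (simp only: D_scale_cols D_scale_rows)
  also have "D m (\<lambda>i j. \<Prod>k<m - Suc j. real i + (T - real (Suc L - m + k))) =
    D m (\<lambda>i j. \<Prod>k<j. real (m - Suc i) + (T - real (Suc L - m + k)))"
    by (subst D_reverse[symmetric]) (rule D_cong, simp)
  also have "\<dots> = (\<Prod>j<m. \<Prod>i<j. real (m - Suc j) - real (m - Suc i))"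
    by (rule D_monic_products)
  also have "\<dots> = (\<Prod>j<m. (- 1) ^ j * fact j)"
  proof (rule prod.cong[OF refl])
    fix j assume j: "j \<in> {..<m}"
    have "(\<Prod>i<j. real (m - Suc j) - real (m - Suc i)) = (\<Prod>i<j. (- 1) * real (j - i))"
      by (rule prod.cong) (use j in \<open>auto simp: of_nat_diff\<close>)
    also have "\<dots> = (- 1) ^ j * fact j"
      unfolding prod.distrib by (simp add: fact_prod_rev atLeast0LessThan)
    finally show "(\<Prod>i<j. real (m - Suc j) - real (m - Suc i)) = (- 1) ^ j * fact j" .
  qed
  finally show ?thesis by (simp add: prod.distrib[symmetric] prod_dividef mult_ac)
qed

section \<open>A single sum on the quadratic lattice\<close>

text \<open>
  The quadratic lattice \<open>(s - 1 / 2)\<^sup>2\<close>, in terms of which \<open>pair\<close> is a difference.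
\<close>

definition sq :: "nat \<Rightarrow> real" where "sq s = (real s - 1 / 2) ^ 2"

lemma pair_sq: "1 \<le> d \<Longrightarrow> d < e \<Longrightarrow> pair d e = sq e - sq d"
  by (simp add: pair_less sq_def power2_eq_square algebra_simps)

text \<open>
  The weight on the quadratic lattice that comes from the factor \<open>s - 1 / 2\<close> and from the interactions of
  the position \<open>s\<close> with \<open>{1..n}\<close> and with \<open>{N<..C}\<close>.  It vanishes at these positions.
\<close>

definition racah_weight :: "nat \<Rightarrow> nat \<Rightarrow> nat \<Rightarrow> nat \<Rightarrow> real" where
  "racah_weight n N C s = sq s * (\<Prod>d\<in>{1..n}. sq s - sq d) * (\<Prod>e\<in>{N<..C}. sq e - sq s)"

definition racah_mass :: "nat \<Rightarrow> nat \<Rightarrow> nat \<Rightarrow> real" where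
  "racah_mass n N C = (\<Sum>s\<in>{n<..N}. racah_weight n N C s)"

text \<open>
  The rising factorial of 1/2.
\<close>

definition half_fact :: "nat \<Rightarrow> real" where "half_fact k = (\<Prod>l<k. 1 / 2 + real l)"

lemma half_fact_Suc: "half_fact (Suc k) = half_fact k * (real k + 1 / 2)"
  by (simp add: half_fact_def add.commute)

lemma half_fact_pos [simp]: "0 < half_fact k"
  by (simp add: half_fact_def prod_pos add_pos_nonneg)

lemma half_fact_nonzero [simp]: "half_fact k \<noteq> 0"
  using half_fact_pos[of k] by linarith

lemma half_fact_eq: "half_fact k = fact (2 * k) / fact k / 4 ^ k"
proof (induction k)
  case (Suc k)
  define F G c P :: real where "F = fact (2 * k)" and "G = fact k" and "c = real k + 1" and "P = 4 ^ k"
  have e: "fact (2 * Suc k) = (2 * c) * (2 * c - 1) * F" "fact (Suc k) = c * G" "4 ^ Suc k = 4 * P"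
    by (simp_all add: F_def G_def c_def P_def algebra_simps)
  have nz: "c \<noteq> 0" "G \<noteq> 0" "P \<noteq> 0" "F \<noteq> 0" by (simp_all add: c_def G_def P_def F_def)
  have k: "real k = c - 1" by (simp add: c_def)
  show ?case unfolding half_fact_Suc Suc e k F_def[symmetric] G_def[symmetric] P_def[symmetric]
    using nz by (simp add: field_simps)
qed (simp add: half_fact_def)

lemma racah_weight_shift_lower:
  "racah_weight (n + i) N C s = racah_weight n N C s * (\<Prod>k<i. sq s + (- sq (n + k + 1)))"
proof (induction i)
  case (Suc i)
  have "{1..n + Suc i} = insert (n + i + 1) {1..n + i}" by auto
  then have "racah_weight (n + Suc i) N C s = racah_weight (n + i) N C s * (sq s + (- sq (n + i + 1)))"
    by (simp add: racah_weight_def)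
  then show ?case using Suc by simp
qed simp

lemma racah_weight_shift_upper:
  assumes "N \<le> C"
  shows "j \<le> N \<Longrightarrow> racah_weight n (N - j) C s = racah_weight n N C s * (\<Prod>k<j. sq (N - k) - sq s)"
proof (induction j)
  case (Suc j)
  have "{N - Suc j<..C} = insert (N - j) {N - j<..C}" using Suc.prems assms by auto
  then have "racah_weight n (N - Suc j) C s = racah_weight n (N - j) C s * (sq (N - j) - sq s)"
    by (simp add: racah_weight_def)
  then show ?case using Suc by simp
qed simp

lemma racah_weight_zero_lower: "1 \<le> s \<Longrightarrow> s \<le> n \<Longrightarrow> racah_weight n N C s = 0"
  unfolding racah_weight_def by (subst prod_zero[of "{1..n}"]) auto

lemma racah_weight_zero_upper: "N < s \<Longrightarrow> s \<le> C \<Longrightarrow> racah_weight n N C s = 0"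
  unfolding racah_weight_def by (subst prod_zero[of "{N<..C}"]) auto

lemma racah_mass_extend:
  assumes "n' \<le> n" "N \<le> N'" "N' \<le> C"
  shows "(\<Sum>s\<in>{n'<..N'}. racah_weight n N C s) = racah_mass n N C"
  unfolding racah_mass_def
proof (rule sum.mono_neutral_right)
  show "\<forall>s\<in>{n'<..N'} - {n<..N}. racah_weight n N C s = 0"
    using assms racah_weight_zero_lower[of _ n N C] racah_weight_zero_upper[of N _ C n] by force
qed (use assms in auto)

text \<open>
  The factors \<open>sq s - sq (n + 1)\<close> and \<open>sq N - sq s\<close> that shift the parameters of the weight have a sum that does not depend on \<open>s\<close>.
\<close>

lemma racah_mass_contiguous:
  assumes "n < N" "N \<le> C"
  shows "(sq N - sq (n + 1)) * racah_mass n N C = racah_mass (n + 1) N C + racah_mass n (N - 1) C"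
proof -
  have "racah_mass (n + 1) N C + racah_mass n (N - 1) C =
     (\<Sum>s\<in>{n<..N}. racah_weight (n + 1) N C s) + (\<Sum>s\<in>{n<..N}. racah_weight n (N - 1) C s)"
    using assms by (simp add: racah_mass_extend)
  also have "\<dots> = (\<Sum>s\<in>{n<..N}. racah_weight n N C s * (sq s - sq (n + 1)) + racah_weight n N C s * (sq N - sq s))"
    using racah_weight_shift_lower[of n 1 N C] racah_weight_shift_upper[of N C 1 n] assms
    by (simp add: sum.distrib)
  also have "\<dots> = (\<Sum>s\<in>{n<..N}. (sq N - sq (n + 1)) * racah_weight n N C s)"
    by (rule sum.cong) (auto simp: algebra_simps)
  finally show ?thesis by (simp add: racah_mass_def sum_distrib_left)
qed

lemma prod_sq_lower: "(\<Prod>d\<in>{1..n}. sq (n + 1) - sq d) = fact (2 * n)"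
proof -
  have "(\<Prod>d\<in>{1..n}. sq (n + 1) - sq d) = (\<Prod>d\<in>{1..n}. real (n + 1 - d) * real (n + d))"
    by (rule prod.cong) (auto simp: sq_def power2_eq_square of_nat_diff algebra_simps)
  also have "\<dots> = (\<Prod>d\<in>{1..n}. real (n + 1 - d)) * (\<Prod>d\<in>{1..n}. real (n + d))" by (rule prod.distrib)
  also have "(\<Prod>d\<in>{1..n}. real (n + 1 - d)) = fact n"
    unfolding fact_prod of_nat_prod
    by (rule prod.reindex_bij_witness[where i = "\<lambda>d. n + 1 - d" and j = "\<lambda>d. n + 1 - d"]) auto
  also have "(\<Prod>d\<in>{1..r}. real (n + d)) = fact (n + r) / fact n" for r
    by (induction r) (simp_all add: algebra_simps)
  finally show ?thesis by (simp add: mult_2)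
qed

lemma prod_sq_upper:
  "(\<Prod>e\<in>{N<..N + r}. sq e - sq N) = fact r * fact (2 * N + r - 1) / fact (2 * N - 1)" if "1 \<le> N"
proof (induction r)
  case (Suc r)
  have "{N<..N + Suc r} = insert (N + Suc r) {N<..N + r}" by auto
  then have "(\<Prod>e\<in>{N<..N + Suc r}. sq e - sq N) = (sq (N + Suc r) - sq N) * (\<Prod>e\<in>{N<..N + r}. sq e - sq N)"
    by simp
  also have "sq (N + Suc r) - sq N = real (Suc r) * real (2 * N + r)"
    by (simp add: sq_def power2_eq_square algebra_simps)
  finally have 1: "(\<Prod>e\<in>{N<..N + Suc r}. sq e - sq N) = real (Suc r) * real (2 * N + r) * (\<Prod>e\<in>{N<..N + r}. sq e - sq N)" .
  have 2: "fact (2 * N + Suc r - 1) = real (2 * N + r) * fact (2 * N + r - 1)"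
    using that fact_reduce[of "2 * N + r"] by simp
  have 3: "fact (Suc r) = real (Suc r) * fact r" by simp
  show ?case unfolding 1 2 3 Suc by (simp only: times_divide_eq_right mult_ac)
qed simp

lemma racah_mass_closed:
  "n + 1 + L \<le> C \<Longrightarrow> racah_mass n (n + 1 + L) C =
    fact (n + C) * fact (C - (n + 1 + L)) * half_fact (n + 1) / (2 * half_fact (n + L)) * ((real C + 1 / 2) gchoose L)"
proof (induction L arbitrary: n)
  case 0
  have s: "{n<..n + 1 + 0} = {n + 1}" by auto
  obtain r where r: "C = n + 1 + r" using 0 le_Suc_ex[of "n + 1" C] by auto
  have "racah_mass n (n + 1 + 0) C = sq (n + 1) * fact (2 * n) * (fact r * fact (2 * (n + 1) + r - 1) / fact (2 * (n + 1) - 1))"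
    using prod_sq_lower[of n] prod_sq_upper[of "n + 1" r]
    unfolding racah_mass_def s racah_weight_def r by simp
  also have "fact (2 * (n + 1) - 1) = (2 * real n + 1) * fact (2 * n)" by simp
  also have "2 * (n + 1) + r - 1 = n + C" using r by simp
  also have "sq (n + 1) * fact (2 * n) * (fact r * fact (n + C) / ((2 * real n + 1) * fact (2 * n))) =
      fact (n + C) * fact r * ((real n + 1 / 2) / 2)"
  proof -
    define c F :: real where "c = real n + 1 / 2" and "F = fact (2 * n)"
    have e: "sq (n + 1) = c * c" "2 * real n + 1 = 2 * c" by (simp_all add: sq_def c_def power2_eq_square algebra_simps)
    have "c \<noteq> 0" "F \<noteq> 0" by (simp_all add: c_def F_def)
    then show ?thesis unfolding e F_def[symmetric] c_def[symmetric] by (simp add: field_simps)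
  qed
  finally show ?case using r by (simp add: half_fact_Suc)
next
  case (Suc L)
  obtain r where r: "C = n + 1 + Suc L + r" using Suc.prems le_Suc_ex[of "n + 1 + Suc L" C] by auto
  define T g where "T = real C + 1 / 2" and "g = T gchoose L"
  define F G A B :: real where "F = fact (n + C)" and "G = fact r" and "A = half_fact (n + 1)" and "B = half_fact (n + L)"
  have nz: "F \<noteq> 0" "G \<noteq> 0" "A \<noteq> 0" "B \<noteq> 0" by (simp_all add: F_def G_def A_def B_def)
  have p: "real n + real L + 1 / 2 \<noteq> 0" "real L + 1 \<noteq> 0" "2 * real n + real L + 2 \<noteq> 0" by linarith+
  have g': "T gchoose Suc L = g * (T - real L) / (real L + 1)"
    using gbinomial_absorption'[of "Suc L" T] gbinomial_mult_1[of T L] by (simp add: g_def field_simps)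
  have "racah_mass (n + 1) (n + 1 + Suc L) C = racah_mass (n + 1) (n + 1 + 1 + L) C" by simp
  also have "\<dots> = fact (n + 1 + C) * fact (C - (n + 1 + 1 + L)) * half_fact (n + 1 + 1) / (2 * half_fact (n + 1 + L)) * g"
    unfolding g_def T_def by (rule Suc.IH) (use Suc.prems in simp)
  also have "\<dots> = ((real n + 1 + real C) * F) * G * (A * (real n + 3 / 2)) / (2 * (B * (real n + real L + 1 / 2))) * g"
    using r half_fact_Suc[of "n + 1"] half_fact_Suc[of "n + L"] by (simp add: F_def G_def A_def B_def algebra_simps)
  finally have 1: "racah_mass (n + 1) (n + 1 + Suc L) C = ((real n + 1 + real C) * F) * G * (A * (real n + 3 / 2)) / (2 * (B * (real n + real L + 1 / 2))) * g" .
  have "racah_mass n (n + 1 + Suc L - 1) C = racah_mass n (n + 1 + L) C" by simp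
  also have "\<dots> = fact (n + C) * fact (C - (n + 1 + L)) * half_fact (n + 1) / (2 * half_fact (n + L)) * g"
    unfolding g_def T_def by (rule Suc.IH) (use Suc.prems in simp)
  also have "C - (n + 1 + L) = Suc r" using r by simp
  finally have 2: "racah_mass n (n + 1 + Suc L - 1) C = F * ((real r + 1) * G) * A / (2 * B) * g"
    by (simp add: F_def G_def A_def B_def algebra_simps)
  have sq: "sq (n + 1 + Suc L) - sq (n + 1) = (real L + 1) * (2 * real n + real L + 2)"
    by (simp add: sq_def power2_eq_square algebra_simps)
  have key: "(real n + 1 + real C) * (real n + 3 / 2) + (real r + 1) * (real n + real L + 1 / 2) = (T - real L) * (2 * real n + real L + 2)"
    unfolding T_def r by (simp add: field_simps)
  have gen1: "(u * F) * G * (A * v) / (2 * (B * w)) * g + F * (r1 * G) * A / (2 * B) * g =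
      F * G * A * g / (2 * B * w) * (u * v + r1 * w)" if "w \<noteq> 0" for u v w r1 :: real
    using that nz by (simp add: field_simps)
  have gen2: "F * G * A * g / (2 * B * w) * (l * t) = (l1 * t) * (F * G * A / (2 * (B * w)) * (g * l / l1))"
    if "w \<noteq> 0" "l1 \<noteq> 0" for w l t l1 :: real
    using that nz by (simp add: field_simps)
  have "(real L + 1) * (2 * real n + real L + 2) * racah_mass n (n + 1 + Suc L) C =
      racah_mass (n + 1) (n + 1 + Suc L) C + racah_mass n (n + 1 + Suc L - 1) C"
    using racah_mass_contiguous[of n "n + 1 + Suc L" C] Suc.prems unfolding sq by simp
  also have "\<dots> = (real L + 1) * (2 * real n + real L + 2) *
     (F * G * A / (2 * (B * (real n + real L + 1 / 2))) * (g * (T - real L) / (real L + 1)))"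
    unfolding 1 2 gen1[OF p(1)] key gen2[OF p(1,2)] ..
  finally have eq: "(real L + 1) * (2 * real n + real L + 2) * racah_mass n (n + 1 + Suc L) C =
    (real L + 1) * (2 * real n + real L + 2) *
     (F * G * A / (2 * (B * (real n + real L + 1 / 2))) * (T gchoose Suc L))"
    unfolding g' .
  have "(real L + 1) * (2 * real n + real L + 2) \<noteq> 0" using p by simp
  from mult_left_cancel[OF this, THEN iffD1, OF eq]
  have "racah_mass n (n + 1 + Suc L) C = F * G * A / (2 * (B * (real n + real L + 1 / 2))) * (T gchoose Suc L)" .
  then show ?case using r half_fact_Suc[of "n + L"]
    by (simp add: F_def G_def A_def B_def T_def algebra_simps)
qed

section \<open>The discrete Selberg sum\<close>

text \<open>
  The sum over the positions \<open>S\<close> of the crossing lozenges when \<open>{1..n}\<close> is covered by the fern and \<open>{N<..C}\<close> by the triangle at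
  the eastern end.
\<close>

definition racah_selberg :: "nat \<Rightarrow> nat \<Rightarrow> nat \<Rightarrow> nat \<Rightarrow> real" where
  "racah_selberg n N C m = (\<Sum>S | S \<subseteq> {n<..N} \<and> card S = m. V S ^ 2 * link {1..n} S * link S {N<..C})"

lemma link_singleton_sq:
  assumes "n < s" "s \<le> N"
  shows "(\<Prod>d\<in>{1..n}. pair d s) = (\<Prod>d\<in>{1..n}. sq s - sq d)"
    "(\<Prod>e\<in>{N<..C}. pair s e) = (\<Prod>e\<in>{N<..C}. sq e - sq s)"
  by (rule prod.cong; use assms in \<open>auto simp: pair_sq\<close>)+

lemma prod_racah_weight:
  assumes S: "S \<subseteq> {n<..N}"
  shows "(\<Prod>s\<in>S. racah_weight n N C s) = (\<Prod>s\<in>S. sq s) * link {1..n} S * link S {N<..C}"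
proof -
  have "(\<Prod>s\<in>S. racah_weight n N C s) = (\<Prod>s\<in>S. sq s * (\<Prod>d\<in>{1..n}. pair d s) * (\<Prod>e\<in>{N<..C}. pair s e))"
  proof (rule prod.cong[OF refl])
    fix s assume "s \<in> S"
    then have "n < s" "s \<le> N" using S by auto
    then show "racah_weight n N C s = sq s * (\<Prod>d\<in>{1..n}. pair d s) * (\<Prod>e\<in>{N<..C}. pair s e)"
      unfolding racah_weight_def by (simp only: link_singleton_sq)
  qed
  also have "\<dots> = (\<Prod>s\<in>S. sq s) * link S {1..n} * link S {N<..C}"
    unfolding link_def by (simp add: prod.distrib pair_commute)
  finally show ?thesis by (simp add: link_commute)
qed

lemma V_square_det:
  fixes d :: "nat \<Rightarrow> nat"
  assumes d: "bij_betw d {..<m} S" "\<And>i j. i < j \<Longrightarrow> j < m \<Longrightarrow> d i < d j"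
  shows "V S ^ 2 = (\<Prod>s\<in>S. sq s) * (\<Prod>j<m. \<Prod>i<j. sq (d j) - sq (d i)) ^ 2"
proof -
  have "(\<Prod>s\<in>S. sq s) = (\<Prod>i<m. sq (d i))" by (rule prod.reindex_bij_betw[OF d(1), symmetric])
  moreover have "sq (d j) - sq (d i) = (real (d j) - real (d i)) * (real (d j) + real (d i) - 1)" for i j
    by (simp add: sq_def power2_eq_square algebra_simps)
  ultimately have e: "(\<Prod>s\<in>S. sq s) * (\<Prod>j<m. \<Prod>i<j. sq (d j) - sq (d i)) ^ 2 =
     (\<Prod>i<m. (real (d i) - 1 / 2) ^ 2) * (\<Prod>j<m. \<Prod>i<j. (real (d j) - real (d i)) * (real (d j) + real (d i) - 1)) ^ 2"
    by (simp only: sq_def)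
  have v: "V S = (\<Prod>i<m. real (d i) - 1 / 2) * (\<Prod>j<m. \<Prod>i<j. (real (d j) - real (d i)) * (real (d j) + real (d i) - 1))"
    by (rule V_enumeration) (use d in auto)
  show ?thesis unfolding e v power_mult_distrib prod_power_distrib[of _ "{..<m}", symmetric] ..
qed

lemma prod_half_fact_range:
  "(\<Prod>r<R. real c + 1 / 2 - real r) = half_fact (c + 1) / half_fact (c + 1 - R)" if "R \<le> c + 1"
  using that
proof (induction R)
  case (Suc R)
  define x where "x = real c - real R + 1 / 2"
  have x: "x \<noteq> 0" "real c + 1 / 2 - real R = x" using Suc.prems by (simp_all add: x_def)
  have "c + 1 - R = Suc (c + 1 - Suc R)" using Suc.prems by simp
  then have h: "half_fact (c + 1 - R) = half_fact (c + 1 - Suc R) * x"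
    using Suc.prems by (simp add: half_fact_Suc of_nat_diff x_def)
  have "(\<Prod>r<R. real c + 1 / 2 - real r) = half_fact (c + 1) / half_fact (c + 1 - R)"
    using Suc by simp
  then show ?case unfolding prod.lessThan_Suc h x(2) using x(1) by (simp only: nonzero_divide_mult_cancel_right times_divide_eq_left) simp
qed simp

text \<open>
  By \<open>V_square_det\<close>, \<open>V S ^ 2\<close> is a squared Vandermonde determinant with additional factors \<open>sq s\<close>.  Its two copies are written in the monic bases
  that raise the lower and lower the upper parameter of the weight, so that the Andreief identity leads to the
  determinant of the single sums \<open>racah_mass (n + i) (N - j) C\<close>.
\<close>

theorem racah_selberg_product:
  assumes mL: "m \<le> Suc L" and C: "n + 1 + L \<le> C"
  shows "racah_selberg n (n + 1 + L) C m =
    (\<Prod>i<m. fact (n + C + i) * fact (C - (n + 1 + L) + i) * fact i / (2 * fact (L - i)) *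
       (half_fact (n + 1 + i) * half_fact (C + 1 + i) / (half_fact (n + L - i) * half_fact (C + i - L + m))))"
proof -
  define N where "N = n + 1 + L"
  \<comment> \<open>the increasing enumeration of a finite set\<close>
  define e where "e = (\<lambda>S. SOME d :: nat \<Rightarrow> nat. bij_betw d {..<card S} S \<and> (\<forall>i j. i < j \<longrightarrow> j < card S \<longrightarrow> d i < d j))"
  have e: "bij_betw (e S) {..<card S} S \<and> (\<forall>i j. i < j \<longrightarrow> j < card S \<longrightarrow> e S i < e S j)" if "finite S" for S
  proof -
    obtain d where "bij_betw d {..<card S} S" "\<And>i j. i < j \<Longrightarrow> j < card S \<Longrightarrow> d i < d j"
      using sorted_enumeration[OF \<open>finite S\<close>] by metis
    then have "\<exists>d :: nat \<Rightarrow> nat. bij_betw d {..<card S} S \<and> (\<forall>i j. i < j \<longrightarrow> j < card S \<longrightarrow> d i < d j)"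
      by blast
    then show ?thesis unfolding e_def by (rule someI_ex)
  qed
  let ?p = "\<lambda>i s. \<Prod>k<i. sq s + (- sq (n + k + 1))"
  let ?q = "\<lambda>j s. \<Prod>k<j. sq (N - k) - sq s"
  let ?sgn = "\<Prod>j<m. (- 1 :: real) ^ j"
  have sgn2: "?sgn * ?sgn = 1" by (simp add: prod.distrib[symmetric] power_mult_distrib[symmetric])
  have Dq: "D m (\<lambda>i j. ?q j (x i)) = ?sgn * (\<Prod>j<m. \<Prod>i<j. sq (x j) - sq (x i))" for x
  proof -
    have "D m (\<lambda>i j. ?q j (x i)) = D m (\<lambda>i j. (- 1) ^ j * (\<Prod>k<j. sq (x i) + (- sq (N - k))))"
    proof (rule D_cong)
      fix i j
      have "?q j (x i) = (\<Prod>k<j. (- 1) * (sq (x i) + (- sq (N - k))))" by simp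
      also have "\<dots> = (- 1) ^ j * (\<Prod>k<j. sq (x i) + (- sq (N - k)))"
        unfolding prod.distrib by simp
      finally show "?q j (x i) = (- 1) ^ j * (\<Prod>k<j. sq (x i) + (- sq (N - k)))" .
    qed
    also have "\<dots> = ?sgn * D m (\<lambda>i j. \<Prod>k<j. sq (x i) + (- sq (N - k)))" by (rule D_scale_cols)
    finally show ?thesis by (simp only: D_monic_products[of m "\<lambda>i. sq (x i)"])
  qed
  have "D m (\<lambda>i j. \<Sum>s\<in>{n<..N}. racah_weight n N C s * ?p i s * ?q j s) =
    (\<Sum>S | S \<subseteq> {n<..N} \<and> card S = m. (\<Prod>s\<in>S. racah_weight n N C s) * D m (\<lambda>i j. ?p j (e S i)) * D m (\<lambda>i j. ?q j (e S i)))"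
  proof (rule D_Andreief)
    fix S assume "S \<subseteq> {n<..N}" "card S = m"
    then show "bij_betw (e S) {..<m} S" using e[of S] finite_subset by blast
  qed simp
  also have "\<dots> = (\<Sum>S | S \<subseteq> {n<..N} \<and> card S = m. ?sgn * (V S ^ 2 * link {1..n} S * link S {N<..C}))"
  proof (rule sum.cong[OF refl])
    fix S assume "S \<in> {S. S \<subseteq> {n<..N} \<and> card S = m}"
    then have S: "S \<subseteq> {n<..N}" "card S = m" by auto
    then have "finite S" using finite_subset by blast
    then have b: "bij_betw (e S) {..<m} S" "\<And>i j. i < j \<Longrightarrow> j < m \<Longrightarrow> e S i < e S j"
      using e[of S] S(2) by auto
    have v: "V S ^ 2 = (\<Prod>s\<in>S. sq s) * (\<Prod>j<m. \<Prod>i<j. sq (e S j) - sq (e S i)) ^ 2"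
      by (rule V_square_det) (use b in auto)
    show "(\<Prod>s\<in>S. racah_weight n N C s) * D m (\<lambda>i j. ?p j (e S i)) * D m (\<lambda>i j. ?q j (e S i)) =
      ?sgn * (V S ^ 2 * link {1..n} S * link S {N<..C})"
      unfolding prod_racah_weight[OF S(1)] Dq D_monic_products[of m "\<lambda>i. sq (e S i)"] v
      by (simp only: power2_eq_square mult_ac)
  qed
  also have "\<dots> = ?sgn * racah_selberg n N C m"
    by (simp add: racah_selberg_def sum_distrib_left)
  finally have 1: "D m (\<lambda>i j. \<Sum>s\<in>{n<..N}. racah_weight n N C s * ?p i s * ?q j s) = ?sgn * racah_selberg n N C m" .
  have "D m (\<lambda>i j. \<Sum>s\<in>{n<..N}. racah_weight n N C s * ?p i s * ?q j s) =
     D m (\<lambda>i j. (fact (n + C + i) * half_fact (n + 1 + i) / 2) * ((fact (C - N + j) / half_fact (n + L - j)) *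
        (if i + j \<le> L then (real C + 1 / 2) gchoose (L - i - j) else 0)))"
  proof (rule D_cong)
    fix i j assume i: "i < m" and j: "j < m"
    have jN: "j \<le> N" "N \<le> C" using j mL C by (auto simp: N_def)
    have "(\<Sum>s\<in>{n<..N}. racah_weight n N C s * ?p i s * ?q j s) = (\<Sum>s\<in>{n<..N}. racah_weight (n + i) (N - j) C s)"
      unfolding racah_weight_shift_upper[OF jN(2,1)] racah_weight_shift_lower ..
    also have "\<dots> = racah_mass (n + i) (N - j) C"
      by (rule racah_mass_extend) (use jN in auto)
    also have "\<dots> = (fact (n + C + i) * half_fact (n + 1 + i) / 2) * ((fact (C - N + j) / half_fact (n + L - j)) *
        (if i + j \<le> L then (real C + 1 / 2) gchoose (L - i - j) else 0))"
    proof (cases "i + j \<le> L")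
      case True
      then have e1: "N - j = (n + i) + 1 + (L - i - j)" by (simp add: N_def)
      have e2: "C - ((n + i) + 1 + (L - i - j)) = C - N + j" "(n + i) + (L - i - j) = n + L - j"
        using True C by (auto simp: N_def)
      show ?thesis unfolding e1
        by (subst racah_mass_closed) (use True C in \<open>simp_all only: e2, simp_all add: algebra_simps\<close>)
    next
      case False
      then have "{n + i<..N - j} = {}" by (auto simp: N_def)
      then show ?thesis using False by (simp add: racah_mass_def)
    qed
    finally show "(\<Sum>s\<in>{n<..N}. racah_weight n N C s * ?p i s * ?q j s) = \<dots>" .
  qed
  also have "\<dots> = (\<Prod>i<m. fact (n + C + i) * half_fact (n + 1 + i) / 2) * ((\<Prod>j<m. fact (C - N + j) / half_fact (n + L - j)) *
     (\<Prod>i<m. (- 1) ^ i * fact i * (\<Prod>r<Suc L - m. real C + 1 / 2 + real i - real r) / fact (L - i)))"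
    unfolding D_scale_rows D_scale_cols D_binomial[OF mL] ..
  also have "\<dots> = ?sgn * (\<Prod>i<m. fact (n + C + i) * fact (C - N + i) * fact i / (2 * fact (L - i)) *
       (half_fact (n + 1 + i) * half_fact (C + 1 + i) / (half_fact (n + L - i) * half_fact (C + i - L + m))))"
    unfolding prod.distrib[symmetric]
  proof (rule prod.cong[OF refl])
    fix i assume i: "i \<in> {..<m}"
    have "(\<Prod>r<Suc L - m. real C + 1 / 2 + real i - real r) = (\<Prod>r<Suc L - m. real (C + i) + 1 / 2 - real r)"
      by (simp add: algebra_simps)
    also have "\<dots> = half_fact (C + i + 1) / half_fact (C + i + 1 - (Suc L - m))"
      by (rule prod_half_fact_range) (use C in simp)
    also have "C + i + 1 - (Suc L - m) = C + i - L + m" using C mL by simp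
    finally have e: "(\<Prod>r<Suc L - m. real C + 1 / 2 + real i - real r) = half_fact (C + 1 + i) / half_fact (C + i - L + m)"
      by (simp add: add.commute add.left_commute)
    show "fact (n + C + i) * half_fact (n + 1 + i) / 2 * (fact (C - N + i) / half_fact (n + L - i) *
        ((- 1) ^ i * fact i * (\<Prod>r<Suc L - m. real C + 1 / 2 + real i - real r) / fact (L - i))) =
      (- 1) ^ i * (fact (n + C + i) * fact (C - N + i) * fact i / (2 * fact (L - i)) *
       (half_fact (n + 1 + i) * half_fact (C + 1 + i) / (half_fact (n + L - i) * half_fact (C + i - L + m))))"
      unfolding e by (simp add: field_simps)
  qed
  finally have "?sgn * racah_selberg n N C m = ?sgn * (\<Prod>i<m. fact (n + C + i) * fact (C - N + i) * fact i / (2 * fact (L - i)) *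
       (half_fact (n + 1 + i) * half_fact (C + 1 + i) / (half_fact (n + L - i) * half_fact (C + i - L + m))))"
    unfolding 1 .
  then have "?sgn * ?sgn * racah_selberg n N C m = ?sgn * ?sgn * (\<Prod>i<m. fact (n + C + i) * fact (C - N + i) * fact i / (2 * fact (L - i)) *
       (half_fact (n + 1 + i) * half_fact (C + 1 + i) / (half_fact (n + L - i) * half_fact (C + i - L + m))))"
    by (simp only: mult.assoc)
  then show ?thesis unfolding sgn2 by (simp add: N_def)
qed

lemma prod_fact_reverse: "m \<le> w + 1 \<Longrightarrow> (\<Prod>i<m. fact (w - i)) = sf (w + 1) / sf (w + 1 - m)"
proof -
  assume w: "m \<le> w + 1"
  have "(\<Prod>i<m. fact (w - i)) = (\<Prod>i<m. fact (w + 1 - m + (m - Suc i)) :: real)"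
    by (rule prod.cong) (use w in \<open>auto intro!: arg_cong[where f = fact]\<close>)
  also have "\<dots> = (\<Prod>i<m. fact (w + 1 - m + i))" by (rule prod.nat_diff_reindex)
  also have "\<dots> = sf (w + 1 - m + m) / sf (w + 1 - m)" by (rule prod_fact_shift)
  also have "w + 1 - m + m = w + 1" using w by simp
  finally show ?thesis .
qed

text \<open>
  The factors of \<open>hs\<close>; \<open>hf k\<close> is \<open>4 ^ k * half_fact k\<close>.
\<close>

definition hf :: "nat \<Rightarrow> real" where "hf k = fact (2 * k) / fact k"

lemma prod_hf: "(\<Prod>i<m. hf (w + i)) = hs (w + m) / hs w"
  unfolding hf_def by (rule prod_hs_shift)

lemma prod_hf_reverse: "m \<le> w + 1 \<Longrightarrow> (\<Prod>i<m. hf (w - i)) = hs (w + 1) / hs (w + 1 - m)"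
proof -
  assume w: "m \<le> w + 1"
  have "(\<Prod>i<m. hf (w - i)) = (\<Prod>i<m. hf (w + 1 - m + (m - Suc i)))"
    by (rule prod.cong) (use w in \<open>auto intro!: arg_cong[where f = hf]\<close>)
  also have "\<dots> = (\<Prod>i<m. hf (w + 1 - m + i))" by (rule prod.nat_diff_reindex)
  also have "\<dots> = hs (w + 1 - m + m) / hs (w + 1 - m)" by (rule prod_hf)
  also have "w + 1 - m + m = w + 1" using w by simp
  finally show ?thesis .
qed

lemma quotient_rescale:
  fixes p1 p2 p3 p4 p5 p6 h1 h2 h3 h4 :: real
  assumes "p1 \<noteq> 0" "p2 \<noteq> 0" "p3 \<noteq> 0" "p4 \<noteq> 0" "p5 \<noteq> 0" and q: "p3 * p4 * p5 = p6 * (p1 * p2)"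
  shows "h1 / p1 * (h2 / p2) / (h3 / p3 * (h4 / p4)) = h1 * h2 / (h3 * h4) * (p6 / p5)"
proof -
  have "h1 / p1 * (h2 / p2) / (h3 / p3 * (h4 / p4)) = h1 * h2 / (h3 * h4) * (p3 * p4 / (p1 * p2))"
    by simp
  also have "p3 * p4 / (p1 * p2) = p6 / p5"
    using assms by (simp add: frac_eq_eq)
  finally show ?thesis .
qed

text \<open>
  All powers of 4 that come from \<open>half_fact\<close> combine to \<open>4 ^ m\<close> in the denominator.
\<close>

lemma racah_selberg_sf:
  assumes m: "n + m \<le> N" and C: "N \<le> C"
  shows "racah_selberg n N C m =
    sf (n + C + m) / sf (n + C) * (sf (C - N + m) / sf (C - N)) * sf m * (sf (N - n - m) / sf (N - n)) *
    (hs (n + 1 + m) / hs (n + 1)) * (hs (C + 1 + m) / hs (C + 1)) * (hs (N - m) / hs N) *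
    (hs (C - N + n + m + 1) / hs (C - N + n + 2 * m + 1)) / 8 ^ m"
proof (cases "m = 0")
  case True
  have "{S. S \<subseteq> {n<..N} \<and> card S = 0} = {{}}" using finite_subset by fastforce
  then show ?thesis using True by (simp add: racah_selberg_def V_def sf_def)
next
  case False
  then obtain L where L: "N = n + 1 + L" using m le_Suc_ex[of "n + 1" N] by auto
  obtain r where r: "C = N + r" using C le_Suc_ex by blast
  have mL: "m \<le> Suc L" using m L by simp
  let ?t = "\<lambda>i. (4 :: real) ^ m / 4 ^ (2 * i + 2)"
  have t: "(\<Prod>i<m. ?t i) = 1 / 4 ^ m"
  proof -
    have "(\<Prod>i<m. (4 :: real) ^ (2 * i + 2)) = 4 ^ (m * m + m)"
      by (induction m) (simp_all add: power_add[symmetric] algebra_simps)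
    then show ?thesis by (simp add: prod_dividef power_mult[symmetric] power_add)
  qed
  have term_eq: "half_fact (n + 1 + i) * half_fact (C + 1 + i) / (half_fact (n + L - i) * half_fact (C + i - L + m)) =
     hf (n + 1 + i) * hf (C + 1 + i) / (hf (n + L - i) * hf (r + n + m + 1 + i)) * ?t i" if i: "i < m" for i
  proof -
    have c: "C + i - L + m = r + n + m + 1 + i" using r L by simp
    obtain l where l: "L = i + l" using i mL le_Suc_ex[of i L] by auto
    have nl: "n + L - i = n + l" using l by simp
    have CC: "C + 1 + i = n + 2 * i + l + r + 2" using r L l by simp
    have q: "(4 :: real) ^ (n + l) * 4 ^ (r + n + m + 1 + i) * 4 ^ (2 * i + 2) =
        4 ^ m * (4 ^ (n + 1 + i) * 4 ^ (n + 2 * i + l + r + 2))"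
      unfolding power_add[symmetric] by (rule arg_cong[where f = "power 4"]) simp
    show ?thesis unfolding c half_fact_eq hf_def[symmetric] nl CC
      by (rule quotient_rescale[OF _ _ _ _ _ q]) simp_all
  qed
  have "racah_selberg n N C m = (\<Prod>i<m. fact (n + C + i) * fact (r + i) * fact i / (2 * fact (L - i)) *
      (hf (n + 1 + i) * hf (C + 1 + i) / (hf (n + L - i) * hf (r + n + m + 1 + i)) * ?t i))"
    unfolding L
    by (subst racah_selberg_product[OF mL]) (use C L r term_eq in \<open>auto intro!: prod.cong\<close>)
  also have "\<dots> = (\<Prod>i<m. fact (n + C + i)) * (\<Prod>i<m. fact (r + i)) * (\<Prod>i<m. fact (0 + i)) / (2 ^ m * (\<Prod>i<m. fact (L - i))) *
      ((\<Prod>i<m. hf (n + 1 + i)) * (\<Prod>i<m. hf (C + 1 + i)) / ((\<Prod>i<m. hf (n + L - i)) * (\<Prod>i<m. hf (r + n + m + 1 + i))) * (\<Prod>i<m. ?t i))"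
    by (simp only: prod.distrib prod_dividef) simp
  also have "\<dots> = sf (n + C + m) / sf (n + C) * (sf (r + m) / sf r) * (sf m / sf 0) / (2 ^ m * (sf (L + 1) / sf (L + 1 - m))) *
     (hs (n + 1 + m) / hs (n + 1) * (hs (C + 1 + m) / hs (C + 1)) / (hs (n + L + 1) / hs (n + L + 1 - m) *
      (hs (r + n + m + 1 + m) / hs (r + n + m + 1))) * (1 / 4 ^ m))"
    unfolding t prod_fact_shift prod_hf
    using mL by (simp only: prod_fact_reverse prod_hf_reverse Suc_eq_plus1) simp
  finally have f: "racah_selberg n N C m = \<dots>" .
  have a: "C - N = r" "N - n - m = L + 1 - m" "N - n = L + 1" "n + L + 1 = N"
    "r + n + 2 * m + 1 = r + n + m + 1 + m"
    using r L mL by auto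
  have p8: "(8 :: real) ^ m = 2 ^ m * 4 ^ m" by (simp add: power_mult_distrib[symmetric])
  have sf0: "sf 0 = 1" by (simp add: sf_def)
  show ?thesis
    unfolding f a p8 sf0 times_divide_eq_left times_divide_eq_right divide_divide_eq_left divide_divide_eq_right
      mult_1_left mult_1_right div_by_1
    by (rule frac_eq_eq[THEN iffD2], simp, simp, simp only: mult_ac)
qed

section \<open>Superfactorial forms\<close>

lemma poch_fact:
  assumes "0 \<le> int v + k"
  shows "poch (real v + 1) k = fact (nat (int v + k)) / fact v"
proof (cases "0 \<le> k")
  case True
  have "pochhammer (real v + 1) n = fact (v + n) / fact v" for n
    by (induction n) (simp_all add: pochhammer_Suc algebra_simps)
  from this[of "nat k"] show ?thesis using True by (simp add: poch_def nat_add_distrib)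
next
  case False
  define d where "d = nat (- k)"
  have d: "d \<le> v" "k = - int d" using assms False by (auto simp: d_def)
  have "(\<Prod>j = 1..e. real v + 1 - real j) = fact v / fact (v - e)" if "e \<le> v" for e
    using that
  proof (induction e)
    case (Suc e)
    have "fact (v - e) = (real v - real e) * fact (v - Suc e)"
    proof -
      have "fact (v - e) = real (v - e) * fact (v - Suc e)"
        using Suc.prems fact_reduce[of "v - e", where 'a = real] by simp
      then show ?thesis using Suc.prems by (simp only: of_nat_diff)
    qed
    moreover have "real v - real e \<noteq> 0" using Suc.prems by simp
    ultimately show ?case using Suc by simp
  qed simp
  from this[OF d(1)] show ?thesis
    using d False by (simp add: poch_def nat_diff_distrib flip: of_nat_diff)
qed

lemma T_prod_sf:
  "T_prod (real (w + 1)) (int Y + int m - 1) m = sf (w + Y + m) * sf w / (sf (w + Y) * sf (w + m))"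
proof -
  have "T_prod (real (w + 1)) (int Y + int m - 1) m = (\<Prod>i<m. fact (w + Y + (m - Suc i)) / fact (w + i))"
    unfolding T_prod_def
  proof (rule prod.cong[OF refl])
    fix i assume i: "i \<in> {..<m}"
    have e: "int (w + i) + (int Y + int m - 1 - 2 * int i) = int (w + Y + (m - Suc i))"
      using i by (simp add: of_nat_diff)
    have r: "real (w + 1) + real i = real (w + i) + 1" by simp
    show "poch (real (w + 1) + real i) (int Y + int m - 1 - 2 * int i) = fact (w + Y + (m - Suc i)) / fact (w + i)"
      using poch_fact[of "w + i" "int Y + int m - 1 - 2 * int i"] unfolding e r nat_int
      by (simp only: of_nat_0_le_iff)
  qed
  also have "\<dots> = (\<Prod>i<m. fact (w + Y + (m - Suc i))) / (\<Prod>i<m. fact (w + i))" by (rule prod_dividef)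
  also have "(\<Prod>i<m. fact (w + Y + (m - Suc i)) :: real) = (\<Prod>i<m. fact (w + Y + i))" by (rule prod.nat_diff_reindex)
  finally show ?thesis unfolding prod_fact_shift by simp
qed

lemma K_interval_sf:
  assumes "p + m \<le> n + c"
  shows "K n c {p<..p + m} = sf (n + c - p) / sf (n + c - p - m) * (sf (n + c + p + m) / sf (n + c + p))"
  unfolding K_interval[OF assms] prod_fact_shift using assms by simp

text \<open>
  The effect on \<open>K\<close> of shifting an interval of \<open>m\<close> positions by \<open>q\<close>.
\<close>

lemma K_shift:
  assumes "p + q + m + e = n"
  shows "K n c {p + q<..p + q + m} * T_prod (real (c + e + 1)) (int q + int m - 1) m =
    K n c {p<..p + m} * T_prod (real (c + (p + n) + 1)) (int q + int m - 1) m"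
proof -
  have e: "n + c - (p + q) = c + e + m" "n + c - (p + q) - m = c + e" "n + c - p = c + e + q + m" "n + c - p - m = c + e + q"
    "n + c + p = c + (p + n)"
    using assms by auto
  have l: "p + q + m \<le> n + c" "p + m \<le> n + c" using assms by auto
  show ?thesis
    unfolding T_prod_sf K_interval_sf[OF l(1)] K_interval_sf[OF l(2)] e
    by (simp add: field_simps)
qed

text \<open>
  The discrete Selberg sum, with the dent product of the triangle at the eastern end, in terms of dent products of intervals that
  occur in the numbers \<open>P'\<close> and \<open>Q'\<close>; here \<open>m\<close> and \<open>m + d\<close> are the smaller and the larger one of \<open>y\<close> and \<open>z\<close>.
\<close>

lemma racah_selberg_V:
  "racah_selberg n (n + x + m) (n + x + m + d) m * V {n + x + m<..n + x + m + d} * V {n<..n + (2 * m + d)} =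
   V {n<..n + (m + d)} * V {n<..n + m} * V {n + x<..n + x + (2 * m + d)} *
    (sf (2 * n + m) * sf (2 * n + m + d) * sf n * sf (n + 2 * m + d) * sf (x + n + m) * sf (n + x + m + d) * sf x * sf (2 * n + x + 2 * m + d) /
     (sf (2 * n + 2 * m + d) * sf (2 * n) * sf (n + m) * sf (n + m + d) * sf (x + n) * sf (n + x + 2 * m + d) * sf (x + m) * sf (2 * n + x + m + d)))"
proof -
  have e: "n + (n + x + m + d) + m = 2 * n + x + 2 * m + d" "n + (n + x + m + d) = 2 * n + x + m + d"
    "n + x + m + d - (n + x + m) + m = d + m" "n + x + m + d - (n + x + m) = d"
    "x + m - m = x" "n + x + m - n = x + m" "2 * n + x + m + d + m = 2 * n + x + 2 * m + d" "n + x + m - m = n + x"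
    "d + n + m + 1 = n + m + d + 1" "d + n + 2 * m + 1 = n + 2 * m + d + 1"
    by auto
  have Z: "racah_selberg n (n + x + m) (n + x + m + d) m =
    sf (2 * n + x + 2 * m + d) / sf (2 * n + x + m + d) * (sf (d + m) / sf d) * sf m * (sf x / sf (x + m)) *
    (hs (n + 1 + m) / hs (n + 1)) * (hs (n + x + m + d + 1 + m) / hs (n + x + m + d + 1)) * (hs (n + x) / hs (n + x + m)) *
    (hs (n + m + d + 1) / hs (n + 2 * m + d + 1)) / 8 ^ m"
  proof -
    have "n + m \<le> n + x + m" "n + x + m \<le> n + x + m + d" by auto
    from racah_selberg_sf[OF this] show ?thesis unfolding e .
  qed
  define p2 p4 pd pn :: real where "p2 = 2 ^ m" and "p4 = 4 ^ m" and "pd = 4 ^ d" and "pn = 2 ^ (n + x)"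
  have nz: "p2 \<noteq> 0" "p4 \<noteq> 0" "pd \<noteq> 0" "pn \<noteq> 0" by (simp_all add: p2_def p4_def pd_def pn_def)
  have p: "(4 :: real) ^ (2 * m + d) = p4 * p4 * pd" "(4 :: real) ^ (m + d) = p4 * pd"
    "(8 :: real) ^ m = p4 * p2" "(2 :: real) ^ (n + x + m) = pn * p2" "(4 :: real) ^ m = p4" "(4 :: real) ^ d = pd"
    "(2 :: real) ^ (n + x) = pn"
    by (simp_all add: p2_def p4_def pd_def pn_def power_add mult_2 power_mult_distrib[symmetric])
  have E: "V {n + x + m<..n + x + m + d} =
      hs (n + x + m + d + 1) / hs (n + x + m + 1) * sf d * sf (n + x + m + d) *
      (sf (n + x + m) ^ 2 * hs (n + x + m) * hs (n + x + m + 1) / (pn * p2)) / (sf (n + x + m) * sf (2 * n + 2 * x + 2 * m + d) * pd)"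
    unfolding V_block[of "n + x + m"] sf_double[of "n + x + m"] p by (simp add: algebra_simps)
  have K0: "V {n<..n + (2 * m + d)} =
      hs (n + 2 * m + d + 1) / hs (n + 1) * sf (2 * m + d) * sf (n + 2 * m + d) * sf (2 * n) / (sf n * sf (2 * n + 2 * m + d) * (p4 * p4 * pd))"
    unfolding V_block[of n] p by (simp add: algebra_simps)
  have Y0: "V {n<..n + (m + d)} =
      hs (n + m + d + 1) / hs (n + 1) * sf (d + m) * sf (n + m + d) * sf (2 * n) / (sf n * sf (2 * n + m + d) * (p4 * pd))"
    unfolding V_block[of n] p by (simp add: algebra_simps)
  have Z0: "V {n<..n + m} = hs (n + 1 + m) / hs (n + 1) * sf m * sf (n + m) * sf (2 * n) / (sf n * sf (2 * n + m) * p4)"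
    unfolding V_block[of n] p by (simp add: algebra_simps)
  have Kx: "V {n + x<..n + x + (2 * m + d)} =
      hs (n + x + m + d + 1 + m) / hs (n + x + 1) * sf (2 * m + d) * sf (n + x + 2 * m + d) *
      (sf (n + x) ^ 2 * hs (n + x) * hs (n + x + 1) / pn) / (sf (n + x) * sf (2 * n + 2 * x + 2 * m + d) * (p4 * p4 * pd))"
  proof -
    have q: "n + x + (2 * m + d) = n + x + 2 * m + d" "n + x + 2 * m + d + 1 = n + x + m + d + 1 + m"
      "2 * (n + x) + (2 * m + d) = 2 * n + 2 * x + 2 * m + d" "Suc (n + x) = n + x + 1" by simp_all
    show ?thesis
      using V_block[of "n + x" "2 * m + d"] unfolding q sf_double[of "n + x"] p .
  qed
  have p42: "p4 = p2 * p2" by (simp add: p2_def p4_def power_mult_distrib[symmetric])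
  have s: "sf (x + n + m) = sf (n + x + m)" "sf (x + n) = sf (n + x)" by (simp_all add: ac_simps)
  show ?thesis
    unfolding Z E K0 Y0 Z0 Kx s p p42 power2_eq_square times_divide_eq_left times_divide_eq_right divide_divide_eq_left divide_divide_eq_right
    by (rule frac_eq_eq[THEN iffD2], simp add: nz, simp add: nz, simp only: mult_ac)
qed

section \<open>The tiling number of H as a product\<close>

lemma extension_Un:
  fixes n x y z :: nat
  shows "{n + x + z<..n + x + y} \<union> {n + x + y<..n + x + z} = {n + x + min y z<..n + x + max y z}"
  by (cases "y \<le> z") auto

text \<open>
  The sum over \<open>S\<close> separates: the dents of both halves together are \<open>{1..n}\<close>, the triangle at the eastern end, and \<open>S\<close> twice.
  The parts \<open>A\<close> and \<open>B\<close> of \<open>{1..n}\<close> interact with \<open>S\<close> only through their union.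
\<close>

lemma selberg_reduction:
  fixes n x y z :: nat and A B :: "nat set"
  assumes AB: "A \<union> B = {1..n}" "A \<inter> B = {}"
  defines "U \<equiv> {n + x + z<..n + x + y}" and "L \<equiv> {n + x + y<..n + x + z}"
  shows "(\<Sum>S\<in>Pow {n<..n + x + min y z}. trap_count (y + card A) (A \<union> U \<union> S) * trap_count (z + card B) (B \<union> L \<union> S)) =
    trap_const (y + card A) * trap_const (z + card B) * (V (A \<union> U) * V (B \<union> L)) *
      racah_selberg n (n + x + min y z) (n + x + max y z) (min y z)"
proof -
  let ?N = "n + x + min y z" and ?C = "n + x + max y z" and ?m = "min y z"
  let ?c = "trap_const (y + card A) * trap_const (z + card B) * (V (A \<union> U) * V (B \<union> L))"
  have fin: "finite A" "finite B" using AB(1) by (metis finite_Un finite_atLeastAtMost)+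
  have sub: "A \<subseteq> {1..n}" "B \<subseteq> {1..n}" using AB(1) by auto
  have UL: "U \<union> L = {?N<..?C}" "U \<inter> L = {}" "finite U" "finite L"
    unfolding U_def L_def using extension_Un[of n x z y] by auto
  have term_eq: "trap_count (y + card A) (A \<union> U \<union> S) * trap_count (z + card B) (B \<union> L \<union> S) =
      (if card S = ?m then ?c * (V S ^ 2 * link {1..n} S * link S {?N<..?C}) else 0)"
    if S: "S \<in> Pow {n<..?N}" for S
  proof -
    have S': "S \<subseteq> {n<..?N}" using S by simp
    have fS: "finite S" using S' finite_subset by blast
    have far: "U \<subseteq> {?N<..}" "L \<subseteq> {?N<..}" using UL(1) by auto
    have iv: "{1..n} \<inter> {?N<..} = {}" "{1..n} \<inter> {n<..?N} = {}" "{?N<..} \<inter> {n<..?N} = {}" by auto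
    have d: "A \<inter> U = {}" "B \<inter> L = {}" "(A \<union> U) \<inter> S = {}" "(B \<union> L) \<inter> S = {}" "U \<inter> S = {}" "L \<inter> S = {}" "A \<inter> S = {}" "B \<inter> S = {}"
      using sub far S' iv by blast+
    have "{1..n} \<subseteq> {1..}" "{?N<..} \<subseteq> {1..}" "{n<..?N} \<subseteq> {1..}" by auto
    then have pos: "A \<union> U \<subseteq> {1..}" "B \<union> L \<subseteq> {1..}" "S \<subseteq> {1..}"
      using sub far S' by blast+
    have "card (A \<union> U \<union> S) = card A + (y - z) + card S"
      using fin UL fS d by (simp add: card_Un_disjoint U_def)
    then have c1: "card (A \<union> U \<union> S) = y + card A \<longleftrightarrow> card S = ?m" by auto
    have "card (B \<union> L \<union> S) = card B + (z - y) + card S"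
      using fin UL fS d by (simp add: card_Un_disjoint L_def)
    then have c2: "card (B \<union> L \<union> S) = z + card B \<longleftrightarrow> card S = ?m" by auto
    have v1: "V (A \<union> U \<union> S) = V (A \<union> U) * V S * (link A S * link U S)"
      using V_Un[OF _ fS d(3) pos(1,3)] link_Un_left[OF fin(1) UL(3) d(1)] fin UL by simp
    have v2: "V (B \<union> L \<union> S) = V (B \<union> L) * V S * (link B S * link L S)"
      using V_Un[OF _ fS d(4) pos(2,3)] link_Un_left[OF fin(2) UL(4) d(2)] fin UL by simp
    have l1: "link {1..n} S = link A S * link B S"
      using link_Un_left[OF fin AB(2)] AB(1) by metis
    have l2: "link S {?N<..?C} = link U S * link L S"
      using link_Un_left[OF UL(3,4,2)] UL(1) by (metis link_commute)
    show ?thesis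
      unfolding trap_count_def c1 c2 v1 v2 l1 l2 by (simp add: power2_eq_square)
  qed
  have "(\<Sum>S\<in>Pow {n<..?N}. trap_count (y + card A) (A \<union> U \<union> S) * trap_count (z + card B) (B \<union> L \<union> S)) =
     (\<Sum>S\<in>Pow {n<..?N}. if card S = ?m then ?c * (V S ^ 2 * link {1..n} S * link S {?N<..?C}) else 0)"
    by (rule sum.cong[OF refl term_eq])
  also have "\<dots> = (\<Sum>S\<in>{S \<in> Pow {n<..?N}. card S = ?m}. ?c * (V S ^ 2 * link {1..n} S * link S {?N<..?C}))"
    by (rule sum.inter_filter[symmetric]) simp
  also have "\<dots> = ?c * racah_selberg n ?N ?C ?m"
    unfolding racah_selberg_def sum_distrib_left Pow_iff mem_Collect_eq by (rule sum.cong) auto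
  finally show ?thesis .
qed

lemma link_extension:
  fixes n x y z :: nat
  assumes AB: "A \<union> B = {1..n}" "A \<inter> B = {}"
  shows "link A {n + x + z<..n + x + y} * link B {n + x + y<..n + x + z} =
    (if z \<le> y then 1 else K n (x + z) {1..n} / K n (x + y) {1..n}) * (K n (x + y) A / K n (x + z) A)"
proof -
  have fin: "finite A" "finite B" using AB(1) by (metis finite_Un finite_atLeastAtMost)+
  have sub: "A \<subseteq> {1..n}" "B \<subseteq> {1..n}" using AB(1) by auto
  have K: "K n c {1..n} = K n c A * K n c B" for c using K_Un[OF fin AB(2)] AB(1) by metis
  show ?thesis
  proof (cases "z \<le> y")
    case True
    then have e: "{n + x + y<..n + x + z} = {}" by auto
    have "link A {n + (x + z)<..n + (x + y)} = K n (x + y) A / K n (x + z) A"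
      by (rule link_interval[OF sub(1)]) (use True in simp)
    then show ?thesis unfolding e using True by (simp add: add.assoc)
  next
    case False
    then have e: "{n + x + z<..n + x + y} = {}" by auto
    have "link B {n + (x + y)<..n + (x + z)} = K n (x + z) B / K n (x + y) B"
      by (rule link_interval[OF sub(2)]) (use False in simp)
    then show ?thesis unfolding e K using False by (simp add: add.assoc)
  qed
qed

lemma V_extension:
  fixes n x y z :: nat
  assumes AB: "A \<union> B = {1..n}" "A \<inter> B = {}"
  shows "V (A \<union> {n + x + z<..n + x + y}) * V (B \<union> {n + x + y<..n + x + z}) =
    V A * V B * (V {n + x + z<..n + x + y} * V {n + x + y<..n + x + z}) *
    (link A {n + x + z<..n + x + y} * link B {n + x + y<..n + x + z})"
proof -
  have fin: "finite A" "finite B" using AB(1) by (metis finite_Un finite_atLeastAtMost)+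
  have sub: "A \<subseteq> {1..n}" "B \<subseteq> {1..n}" using AB(1) by auto
  have "V (A \<union> {n + x + z<..n + x + y}) = V A * V {n + x + z<..n + x + y} * link A {n + x + z<..n + x + y}"
    by (rule V_Un) (use fin sub in fastforce)+
  moreover have "V (B \<union> {n + x + y<..n + x + z}) = V B * V {n + x + y<..n + x + z} * link B {n + x + y<..n + x + z}"
    by (rule V_Un) (use fin sub in fastforce)+
  ultimately show ?thesis by simp
qed

lemma V_adjacent:
  fixes n y z :: nat
  assumes AB: "A \<union> B = {1..n}" "A \<inter> B = {}"
  shows "V (A \<union> {n<..n + y}) * V (B \<union> {n<..n + z}) =
    V A * V B * (V {n<..n + y} * V {n<..n + z}) * (K n z {1..n} / K n 0 {1..n}) * (K n y A / K n z A)"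
proof -
  have fin: "finite A" "finite B" using AB(1) by (metis finite_Un finite_atLeastAtMost)+
  have sub: "A \<subseteq> {1..n}" "B \<subseteq> {1..n}" using AB(1) by auto
  have K: "K n c {1..n} = K n c A * K n c B" for c using K_Un[OF fin AB(2)] AB(1) by metis
  have "link A {n<..n + y} = K n y A / K n 0 A" "link B {n<..n + z} = K n z B / K n 0 B"
    using link_interval[OF sub(1), of 0 y] link_interval[OF sub(2), of 0 z] by simp_all
  moreover have "V (A \<union> {n<..n + y}) = V A * V {n<..n + y} * link A {n<..n + y}"
    by (rule V_Un) (use fin sub in fastforce)+
  moreover have "V (B \<union> {n<..n + z}) = V B * V {n<..n + z} * link B {n<..n + z}"
    by (rule V_Un) (use fin sub in fastforce)+
  ultimately show ?thesis unfolding K by simp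
qed

text \<open>
  Two ferns with the same total length.  The dent products for general \<open>x\<close> are compared with those for adjacent
  intervals, which belong to the numbers \<open>Q'\<close> and \<open>P'\<close>; what remains is a quotient of values of \<open>K\<close> for the
  odd segments only, since the even ones are the complement.
\<close>

lemma V_exchange:
  fixes n x y z :: nat
  assumes AB: "A \<union> B = {1..n}" "A \<inter> B = {}" and AB': "A' \<union> B' = {1..n}" "A' \<inter> B' = {}"
  shows "V (A \<union> {n + x + z<..n + x + y}) * V (B \<union> {n + x + y<..n + x + z}) =
    V (A' \<union> {n + x + z<..n + x + y}) * V (B' \<union> {n + x + y<..n + x + z}) *
    (V (A \<union> {n<..n + y}) * V (B \<union> {n<..n + z}) / (V (A' \<union> {n<..n + y}) * V (B' \<union> {n<..n + z}))) *
    ((K n (x + y) A / K n (x + y) A') * (K n z A / K n z A') / ((K n (x + z) A / K n (x + z) A') * (K n y A / K n y A')))"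
proof -
  have "V S \<noteq> 0" if "S \<subseteq> {1..}" for S using V_pos[OF that] by simp
  moreover have "A \<subseteq> {1..}" "B \<subseteq> {1..}" "A' \<subseteq> {1..}" "B' \<subseteq> {1..}" using AB(1) AB'(1) by auto
  moreover have "{n<..n + y} \<subseteq> {1..}" "{n<..n + z} \<subseteq> {1..}" by auto
  ultimately have nz: "V A \<noteq> 0" "V B \<noteq> 0" "V A' \<noteq> 0" "V B' \<noteq> 0" "V {n<..n + y} \<noteq> 0" "V {n<..n + z} \<noteq> 0" by blast+
  show ?thesis
    unfolding V_extension[OF AB] V_extension[OF AB'] link_extension[OF AB] link_extension[OF AB']
      V_adjacent[OF AB] V_adjacent[OF AB']
    using nz by (simp add: field_simps)
qed

lemma fern_odd_even_partition:
  "fern t odd \<union> fern t even = {1..s_sum (length t) t}" "fern t odd \<inter> fern t even = {}"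
proof -
  have "fern t odd \<union> fern t even = (\<Union>i\<in>{1..length t}. fern_block t i)" unfolding fern_def by blast
  then show "fern t odd \<union> fern t even = {1..s_sum (length t) t}" unfolding fern_blocks_cover .
  show "fern t odd \<inter> fern t even = {}"
  proof (rule equals0I)
    fix d assume "d \<in> fern t odd \<inter> fern t even"
    then obtain i j where "i \<in> {1..length t}" "odd i" "j \<in> {1..length t}" "even j" "d \<in> fern_block t i" "d \<in> fern_block t j"
      unfolding fern_def by blast
    then show False using fern_block_disjoint[of i j t] by force
  qed
qed

lemma card_fern_odd: "card (fern t odd) = odd_sum t" and card_fern_even: "card (fern t even) = even_sum t"
  unfolding card_fern odd_sum_def even_sum_def by (rule sum.cong; auto)+

lemma M_H3_racah_selberg:
  fixes x y z :: nat and a :: "nat list"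
  defines "n \<equiv> s_sum (length a) a"
  shows "M_H3 x y z a = 2 ^ entry a 1 * (trap_const (y + odd_sum a) * trap_const (z + even_sum a) *
     (V (fern a odd \<union> {n + x + z<..n + x + y}) * V (fern a even \<union> {n + x + y<..n + x + z})) *
     racah_selberg n (n + x + min y z) (n + x + max y z) (min y z))"
  using M_H3_eq[of x y z a] selberg_reduction[OF fern_odd_even_partition[of a], where x = x and y = y and z = z]
  unfolding card_fern_odd card_fern_even n_def by simp

lemma two_fern:
  "entry [a, b] 1 = a" "odd_sum [a, b] = a" "even_sum [a, b] = b" "s_sum (length [a, b]) [a, b] = a + b"
  "fern [a, b] odd = {1..a}" "fern [a, b] even = {a<..a + b}"
proof -
  have i: "{i \<in> {1..length [a, b]}. odd i} = {1}" "{i \<in> {1..length [a, b]}. even i} = {2}"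
    by (auto, presburger+)
  have s: "s_sum 0 [a, b] = 0" "s_sum 1 [a, b] = a" "s_sum 2 [a, b] = a + b"
    by (simp_all add: s_sum_def entry_def numeral_2_eq_2)
  show "entry [a, b] 1 = a" "s_sum (length [a, b]) [a, b] = a + b"
    using s by (simp_all add: entry_def numeral_2_eq_2)
  have f: "fern [a, b] odd = fern_block [a, b] 1" "fern [a, b] even = fern_block [a, b] 2"
    unfolding fern_def i by auto
  show 1: "fern [a, b] odd = {1..a}" "fern [a, b] even = {a<..a + b}"
    unfolding f fern_block_def using s by (auto simp: entry_def)
  show "odd_sum [a, b] = a" "even_sum [a, b] = b"
    unfolding card_fern_odd[symmetric] card_fern_even[symmetric] 1 by simp_all
qed

section \<open>Moving the odd segments of a fern together\<close>

lemma Q_num_V: "Q_num t = trap_const (card (fern t even)) * V (fern t even)"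
  unfolding Q_num_eq trap_count_def card_fern_even by simp

lemma fern_prepend_zero:
  assumes "even (length a)"
  shows "fern (0 # a @ [y]) even = fern a odd \<union> {s_sum (length a) a<..s_sum (length a) a + y}"
proof -
  let ?b = "0 # a @ [y]"
  have ent: "entry ?b (Suc i) = entry a i" if "1 \<le> i" "i \<le> length a" for i
    using that by (auto simp: entry_def nth_append nth_Cons')
  have last: "entry ?b (Suc (Suc (length a))) = y" by (simp add: entry_def nth_append)
  have sum: "i \<le> length a \<Longrightarrow> s_sum (Suc i) ?b = s_sum i a" for i
  proof (induction i)
    case 0
    show ?case by (simp add: s_sum_def entry_def)
  next
    case (Suc i)
    then show ?case using ent[of "Suc i"] by (simp add: s_sum_Suc[of "Suc i" ?b] s_sum_Suc[of i a])
  qed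
  have blk: "fern_block ?b (Suc i) = fern_block a i" if "1 \<le> i" "i \<le> length a" for i
    using sum[of "i - 1"] ent[OF that] that by (simp add: fern_block_def)
  have blk_last: "fern_block ?b (Suc (Suc (length a))) = {s_sum (length a) a<..s_sum (length a) a + y}"
    using sum[of "length a"] last by (simp add: fern_block_def)
  have idx: "{j \<in> {1..length ?b}. even j} = insert (Suc (Suc (length a))) (Suc ` {i \<in> {1..length a}. odd i})"
  proof (intro equalityI subsetI)
    fix j assume j: "j \<in> {j \<in> {1..length ?b}. even j}"
    then obtain i where i: "j = Suc i" "odd i" "i \<le> Suc (length a)" by (cases j) auto
    then have "1 \<le> i" by (auto simp: Suc_le_eq intro: odd_pos)
    then show "j \<in> insert (Suc (Suc (length a))) (Suc ` {i \<in> {1..length a}. odd i})"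
      using i by (cases "i = Suc (length a)") auto
  qed (use assms in auto)
  show ?thesis
    unfolding fern_def idx using blk blk_last by (auto simp: Un_commute)
qed

lemma fern_extend_last:
  assumes "even (length a)" "a \<noteq> []"
  shows "fern (butlast a @ [last a + z]) even = fern a even \<union> {s_sum (length a) a<..s_sum (length a) a + z}"
proof -
  let ?b = "butlast a @ [last a + z]"
  let ?l = "length a"
  have l: "length ?b = ?l" "1 \<le> ?l" using assms(2) by (auto simp: Suc_le_eq)
  have ent: "entry ?b i = entry a i" if "i < ?l" for i
    using that by (auto simp: entry_def nth_append nth_butlast)
  have last: "entry ?b ?l = entry a ?l + z"
    using assms(2) l(2) by (simp add: entry_def nth_append last_conv_nth)
  have sum: "s_sum i ?b = s_sum i a" if "i < ?l" for i
    unfolding s_sum_def by (rule sum.cong) (use ent that in auto)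
  have blk: "fern_block ?b i = fern_block a i" if "i < ?l" for i
    using sum[of "i - 1"] ent[OF that] that by (simp add: fern_block_def)
  have blk_last: "fern_block ?b ?l = fern_block a ?l \<union> {s_sum ?l a<..s_sum ?l a + z}"
    using sum[of "?l - 1"] last l(2) fern_block_end[OF l(2), of a] by (auto simp: fern_block_def)
  have idx: "{i \<in> {1..?l}. even i} = insert ?l {i \<in> {1..?l - 1}. even i}"
    using assms l(2) by auto
  have "fern ?b even = fern_block ?b ?l \<union> (\<Union>i\<in>{i \<in> {1..?l - 1}. even i}. fern_block ?b i)"
    unfolding fern_def l(1) idx by simp
  also have "(\<Union>i\<in>{i \<in> {1..?l - 1}. even i}. fern_block ?b i) = (\<Union>i\<in>{i \<in> {1..?l - 1}. even i}. fern_block a i)"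
    by (rule SUP_cong) (use blk l(2) in auto)
  also have "fern_block ?b ?l \<union> \<dots> = fern a even \<union> {s_sum ?l a<..s_sum ?l a + z}"
    unfolding blk_last fern_def idx by auto
  finally show ?thesis .
qed

text \<open>
  Prepending an empty segment makes the odd segments of \<open>a\<close> the removed triangles.
\<close>

lemma Q_num_prepend_zero:
  assumes "even (length a)"
  shows "Q_num (0 # a @ [y]) = trap_const (y + odd_sum a) * V (fern a odd \<union> {s_sum (length a) a<..s_sum (length a) a + y})"
proof -
  have "fern a odd \<subseteq> {1..s_sum (length a) a}" using fern_odd_even_partition(1)[of a] by blast
  moreover have "{1..s_sum (length a) a} \<inter> {s_sum (length a) a<..s_sum (length a) a + y} = {}" by auto
  ultimately have "fern a odd \<inter> {s_sum (length a) a<..s_sum (length a) a + y} = {}" by blast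
  then have "card (fern a odd \<union> {s_sum (length a) a<..s_sum (length a) a + y}) = y + odd_sum a"
    by (subst card_Un_disjoint) (simp_all add: card_fern_odd)
  then show ?thesis unfolding Q_num_V fern_prepend_zero[OF assms] by simp
qed

lemma Q_num_extend_last:
  assumes "even (length a)" "a \<noteq> []"
  shows "Q_num (butlast a @ [last a + z]) = trap_const (z + even_sum a) * V (fern a even \<union> {s_sum (length a) a<..s_sum (length a) a + z})"
proof -
  have "fern a even \<subseteq> {1..s_sum (length a) a}" using fern_odd_even_partition(1)[of a] by blast
  moreover have "{1..s_sum (length a) a} \<inter> {s_sum (length a) a<..s_sum (length a) a + z} = {}" by auto
  ultimately have "fern a even \<inter> {s_sum (length a) a<..s_sum (length a) a + z} = {}" by blast
  then have "card (fern a even \<union> {s_sum (length a) a<..s_sum (length a) a + z}) = z + even_sum a"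
    by (subst card_Un_disjoint) (simp_all add: card_fern_even)
  then show ?thesis unfolding Q_num_V fern_extend_last[OF assms] by simp
qed

lemma P_num_V:
  "P_num y (y + 2 * p) b = 2 ^ p * (trap_const (y + p) * V ({1..p} \<union> {p + b<..p + b + y}))"
proof -
  have "card ({1..p} \<union> {p + b<..p + b + y}) = y + p"
    by (subst card_Un_disjoint) auto
  then show ?thesis unfolding P_num_eq trap_count_def by simp
qed

lemma P_num_equal_V: "P_num k k p = trap_const k * V {p<..p + k}"
  using P_num_V[of k 0 p] by simp

text \<open>
  The segments before index \<open>2 * i - 1\<close>, and the odd and even ones from there on, make up the whole fern.
\<close>

lemma sum_tails:
  assumes "length a = 2 * k" "1 \<le> i" "i \<le> k + 1"
  shows "s_sum (2 * i - 2) a + o_sum i a + e_sum i a = s_sum (length a) a"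
  using assms(3,2)
proof (induction rule: inc_induct)
  case base
  have "o_sum (k + 1) a = 0" "e_sum (k + 1) a = 0"
    unfolding o_sum_def e_sum_def using assms(1) by (auto simp: entry_def)
  then show ?case using assms(1) by simp
next
  case (step i)
  have i: "i \<le> length a" using step assms(1) by simp
  have "o_sum i a = entry a (2 * i - 1) + o_sum (Suc i) a" "e_sum i a = entry a (2 * i) + e_sum (Suc i) a"
    unfolding o_sum_def e_sum_def using i by (simp_all add: sum.atLeast_Suc_atMost)
  moreover have "s_sum (2 * Suc i - 2) a = s_sum (2 * i - 2) a + entry a (2 * i - 1) + entry a (2 * i)"
  proof -
    have "2 * Suc i - 2 = Suc (Suc (2 * i - 2))" "Suc (2 * i - 2) = 2 * i - 1" "Suc (2 * i - 1) = 2 * i"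
      using step.prems by auto
    then show ?thesis by (metis s_sum_Suc)
  qed
  ultimately show ?case using step.IH step.prems by simp
qed

lemma K_UN: "finite I \<Longrightarrow> (\<And>i. i \<in> I \<Longrightarrow> finite (F i)) \<Longrightarrow> (\<And>i j. i \<in> I \<Longrightarrow> j \<in> I \<Longrightarrow> i \<noteq> j \<Longrightarrow> F i \<inter> F j = {})
    \<Longrightarrow> K n c (\<Union>i\<in>I. F i) = (\<Prod>i\<in>I. K n c (F i))"
  unfolding K_def by (rule prod.UNION_disjoint) auto

lemma T_seq_pos: "T_seq a i (w + 1) > 0"
  unfolding T_seq_def T_prod_sf by simp

text \<open>
  The odd segments are moved to the beginning of the line.  Each step closes the gap left by one even segment.
\<close>

theorem K_fern_odd:
  assumes len: "length a = 2 * k" and k: "1 \<le> k"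
  defines "n \<equiv> s_sum (length a) a"
  shows "K n c (fern a odd) / K n c {1..odd_sum a} =
    (\<Prod>i=2..k. T_seq a i (c + sigma a i + 1) / T_seq a i (c + e_sum i a + 1))"
proof -
  \<comment> \<open>\<open>F j\<close> belongs to the fern whose first \<open>j - 1\<close> odd segments are in place, while the other odd ones are merged right after segment \<open>2 * j - 2\<close>\<close>
  define F where "F = (\<lambda>j. (\<Prod>i\<in>{1..<j}. K n c (fern_block a (2 * i - 1))) *
      K n c {s_sum (2 * j - 2) a<..s_sum (2 * j - 2) a + o_sum j a})"
  have step: "F (Suc j) = F j * (T_seq a (Suc j) (c + sigma a (Suc j) + 1) / T_seq a (Suc j) (c + e_sum (Suc j) a + 1))"
    if j: "1 \<le> j" "Suc j \<le> k" for j
  proof -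
    let ?p = "s_sum (2 * j - 1) a" and ?q = "entry a (2 * j)" and ?o = "o_sum (Suc j) a" and ?e = "e_sum (Suc j) a"
    have s1: "?p = s_sum (2 * j - 2) a + entry a (2 * j - 1)"
      using j s_sum_Suc[of "2 * j - 2" a] by (simp add: numeral_2_eq_2 Suc_diff_Suc)
    have s2: "s_sum (2 * Suc j - 2) a = ?p + ?q"
      using j s_sum_Suc[of "2 * j - 1" a] by simp
    have o: "o_sum j a = entry a (2 * j - 1) + ?o"
      unfolding o_sum_def using j len by (simp add: sum.atLeast_Suc_atMost)
    have tot: "?p + ?q + ?o + ?e = n"
      using sum_tails[OF len, of "Suc j"] j unfolding s2 n_def by simp
    have split: "{s_sum (2 * j - 2) a<..s_sum (2 * j - 2) a + o_sum j a} = fern_block a (2 * j - 1) \<union> {?p<..?p + ?o}"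
      unfolding o s1 fern_block_def using j by (auto simp: numeral_2_eq_2)
    have "K n c {s_sum (2 * j - 2) a<..s_sum (2 * j - 2) a + o_sum j a} = K n c (fern_block a (2 * j - 1)) * K n c {?p<..?p + ?o}"
      unfolding split
    proof (rule K_Un)
      have "s_sum (2 * j - 1 - 1) a + entry a (2 * j - 1) = ?p" using fern_block_end[of "2 * j - 1" a] j by simp
      then show "fern_block a (2 * j - 1) \<inter> {?p<..?p + ?o} = {}" unfolding fern_block_def by auto
    qed (simp_all add: fern_block_def)
    then have Fj: "F j = (\<Prod>i\<in>{1..<Suc j}. K n c (fern_block a (2 * i - 1))) * K n c {?p<..?p + ?o}"
      unfolding F_def using j by (simp add: prod.atLeastLessThan_Suc mult_ac)
    have sig: "sigma a (Suc j) = ?p + n"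
      unfolding sigma_def n_def using j by (simp add: numeral_3_eq_3 numeral_2_eq_2)
    have T: "T_seq a (Suc j) u = T_prod (real u) (int ?q + int ?o - 1) ?o" for u
      unfolding T_seq_def by simp
    have "K n c {?p + ?q<..?p + ?q + ?o} * T_seq a (Suc j) (c + ?e + 1) = K n c {?p<..?p + ?o} * T_seq a (Suc j) (c + sigma a (Suc j) + 1)"
      using K_shift[OF tot, of c] unfolding T sig .
    then have "K n c {?p + ?q<..?p + ?q + ?o} = K n c {?p<..?p + ?o} * (T_seq a (Suc j) (c + sigma a (Suc j) + 1) / T_seq a (Suc j) (c + ?e + 1))"
      using T_seq_pos[of a "Suc j" "c + ?e"] by (simp add: field_simps)
    then show ?thesis unfolding Fj unfolding F_def s2 by simp
  qed
  have tele: "1 \<le> j \<Longrightarrow> j \<le> k \<Longrightarrow> F j = F 1 * (\<Prod>i=2..j. T_seq a i (c + sigma a i + 1) / T_seq a i (c + e_sum i a + 1))" for j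
  proof (induction j)
    case (Suc j)
    show ?case
    proof (cases "j = 0")
      case False
      then have "{2..Suc j} = insert (Suc j) {2..j}" by auto
      then show ?thesis using Suc False step[of j] by simp
    qed simp
  qed simp
  have idx: "{i \<in> {1..length a}. odd i} = (\<lambda>i. 2 * i - 1) ` {1..k}"
  proof (intro equalityI subsetI)
    fix i assume i: "i \<in> {i \<in> {1..length a}. odd i}"
    then obtain j where "i = 2 * j + 1" by (auto elim: oddE)
    then have "i = 2 * Suc j - 1" "Suc j \<in> {1..k}" using i len by auto
    then show "i \<in> (\<lambda>i. 2 * i - 1) ` {1..k}" by blast
  qed (use len in auto)
  have "fern a odd = (\<Union>i\<in>{1..k}. fern_block a (2 * i - 1))"
    unfolding fern_def idx by simp
  moreover have "K n c (\<Union>i\<in>{1..k}. fern_block a (2 * i - 1)) = (\<Prod>i\<in>{1..k}. K n c (fern_block a (2 * i - 1)))"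
  proof (rule K_UN)
    show "fern_block a (2 * i - 1) \<inter> fern_block a (2 * j - 1) = {}" if "i \<in> {1..k}" "j \<in> {1..k}" "i \<noteq> j" for i j
    proof (rule fern_block_disjoint)
      show "1 \<le> 2 * i - 1" "1 \<le> 2 * j - 1" "2 * i - 1 \<noteq> 2 * j - 1" using that by auto
    qed
  qed (simp_all add: fern_block_def)
  ultimately have "K n c (fern a odd) = (\<Prod>i\<in>{1..k}. K n c (fern_block a (2 * i - 1)))" by simp
  also have "\<dots> = F k"
  proof -
    have "o_sum k a = entry a (2 * k - 1) + o_sum (Suc k) a"
      unfolding o_sum_def using k len by (simp add: sum.atLeast_Suc_atMost)
    moreover have "o_sum (Suc k) a = 0" unfolding o_sum_def using len by (auto simp: entry_def)
    ultimately have "{s_sum (2 * k - 2) a<..s_sum (2 * k - 2) a + o_sum k a} = fern_block a (2 * k - 1)"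
      unfolding fern_block_def by (simp add: numeral_2_eq_2)
    moreover have "{1..k} = insert k {1..<k}" using k by auto
    ultimately show ?thesis unfolding F_def by simp
  qed
  also have "F k = F 1 * (\<Prod>i=2..k. T_seq a i (c + sigma a i + 1) / T_seq a i (c + e_sum i a + 1))"
    by (rule tele) (use k in auto)
  also have "F 1 = K n c {1..odd_sum a}"
  proof -
    have "odd_sum a = (\<Sum>i\<in>{1..k}. entry a (2 * i - 1))"
    proof -
      have "inj_on (\<lambda>i. 2 * i - 1 :: nat) {1..k}" by (auto simp: inj_on_def)
      moreover have "odd_sum a = (\<Sum>i\<in>{i \<in> {1..length a}. odd i}. entry a i)"
        unfolding odd_sum_def ..
      ultimately show ?thesis unfolding idx by (simp add: sum.reindex o_def)
    qed
    also have "\<dots> = o_sum 1 a"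
      unfolding o_sum_def by (rule sum.mono_neutral_left) (use len in \<open>auto simp: entry_def\<close>)
    finally have "o_sum 1 a = odd_sum a" ..
    moreover have "s_sum 0 a = 0" by (simp add: s_sum_def)
    ultimately have "{s_sum (2 * 1 - 2) a<..s_sum (2 * 1 - 2) a + o_sum 1 a} = {1..odd_sum a}" by auto
    then show ?thesis unfolding F_def by simp
  qed
  finally show ?thesis by simp
qed

theorem H3_ratio:
  assumes len: "length a = 2 * k" and k: "1 \<le> k"
  shows "M_H3 x y z a =
            2 ^ entry a 1 * M_H3 x y z [odd_sum a, even_sum a]
            * (Q_num (0 # a @ [y]) * Q_num (butlast a @ [last a + z])
               / (P_num y (y + 2 * odd_sum a) (even_sum a) * P_num (z + even_sum a) (z + even_sum a) (odd_sum a)))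
            * (\<Prod>i=2..k.
                 (T_seq a i (x + z + e_sum i a + 1) * T_seq a i (y + e_sum i a + 1)) / (T_seq a i (x + y + e_sum i a + 1) * T_seq a i (z + e_sum i a + 1))
                 * ((T_seq a i (x + y + sigma a i + 1) * T_seq a i (z + sigma a i + 1))
                    / (T_seq a i (x + z + sigma a i + 1) * T_seq a i (y + sigma a i + 1))))"
proof -
  define n where "n = s_sum (length a) a"
  let ?O = "odd_sum a" and ?E = "even_sum a"
  let ?A = "fern a odd" and ?B = "fern a even" and ?A' = "{1..?O}" and ?B' = "{?O<..?O + ?E}"
  have n: "n = ?O + ?E" unfolding n_def by (rule odd_sum_add_even_sum[symmetric])
  have AB: "?A \<union> ?B = {1..n}" "?A \<inter> ?B = {}" unfolding n_def by (rule fern_odd_even_partition)+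
  have AB': "?A' \<union> ?B' = {1..n}" "?A' \<inter> ?B' = {}" unfolding n by auto
  let ?r = "\<lambda>c. K n c ?A / K n c ?A'"
  let ?t = "\<lambda>c i. T_seq a i (c + sigma a i + 1) / T_seq a i (c + e_sum i a + 1)"
  have r: "?r c = (\<Prod>i=2..k. ?t c i)" for c unfolding n_def by (rule K_fern_odd[OF len k])
  have T: "?r (x + y) * ?r z / (?r (x + z) * ?r y) = (\<Prod>i=2..k.
                 (T_seq a i (x + z + e_sum i a + 1) * T_seq a i (y + e_sum i a + 1)) / (T_seq a i (x + y + e_sum i a + 1) * T_seq a i (z + e_sum i a + 1))
                 * ((T_seq a i (x + y + sigma a i + 1) * T_seq a i (z + sigma a i + 1))
                    / (T_seq a i (x + z + sigma a i + 1) * T_seq a i (y + sigma a i + 1))))"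
    unfolding r prod.distrib[symmetric] prod_dividef[symmetric] by (rule prod.cong) (simp_all add: mult_ac)
  have nz: "V S \<noteq> 0" if "S \<subseteq> {1..}" for S using V_pos[OF that] by simp
  have c: "trap_const k \<noteq> 0" for k by (simp add: trap_const_def)
  let ?c = "trap_const (y + ?O)" and ?d = "trap_const (z + ?E)"
  let ?U = "{n + x + z<..n + x + y}" and ?L = "{n + x + y<..n + x + z}"
  let ?Z = "racah_selberg n (n + x + min y z) (n + x + max y z) (min y z)"
  have a: "a \<noteq> []" "even (length a)" using len k by auto
  have M: "M_H3 x y z a = 2 ^ entry a 1 * (?c * ?d * (V (?A \<union> ?U) * V (?B \<union> ?L)) * ?Z)"
    unfolding n_def by (rule M_H3_racah_selberg)
  have M': "M_H3 x y z [?O, ?E] = 2 ^ ?O * (?c * ?d * (V (?A' \<union> ?U) * V (?B' \<union> ?L)) * ?Z)"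
    using M_H3_racah_selberg[of x y z "[?O, ?E]"] unfolding two_fern n[symmetric] .
  have Q1: "Q_num (0 # a @ [y]) = ?c * V (?A \<union> {n<..n + y})" unfolding n_def by (rule Q_num_prepend_zero[OF a(2)])
  have Q2: "Q_num (butlast a @ [last a + z]) = ?d * V (?B \<union> {n<..n + z})" unfolding n_def by (rule Q_num_extend_last[OF a(2,1)])
  have P1: "P_num y (y + 2 * ?O) ?E = 2 ^ ?O * (?c * V (?A' \<union> {n<..n + y}))" unfolding n by (rule P_num_V)
  have "{?O<..?O + (z + ?E)} = ?B' \<union> {n<..n + z}" unfolding n by auto
  then have P2: "P_num (z + ?E) (z + ?E) ?O = ?d * V (?B' \<union> {n<..n + z})" using P_num_equal_V[of "z + ?E" ?O] by simp
  have "V (?A' \<union> {n<..n + y}) \<noteq> 0" "V (?B' \<union> {n<..n + z}) \<noteq> 0" by (rule nz, force)+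
  then show ?thesis
    unfolding M M' Q1 Q2 P1 P2 T[symmetric] V_exchange[OF AB AB'] using c[of "y + ?O"] c[of "z + ?E"] by simp
qed

section \<open>Ferns with two segments\<close>

lemma K_first: "K (a + b) c {1..a} = sf (b + c + a + a) / sf (b + c)"
proof -
  have "{1..a} = {0<..0 + a}" by auto
  moreover have "K (a + b) c {0<..0 + a} = sf (a + b + c - 0) / sf (a + b + c - 0 - a) * (sf (a + b + c + 0 + a) / sf (a + b + c + 0))"
    by (rule K_interval_sf) simp
  moreover have "a + b + c - 0 - a = b + c" "a + b + c + 0 + a = b + c + a + a" "a + b + c + a = b + c + a + a" by simp_all
  ultimately show ?thesis by simp
qed

lemma K_second: "K (a + b) c {a<..a + b} = sf (b + c) * sf (c + a + a + b + b) / (sf c * sf (b + c + a + a))"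
proof -
  have "K (a + b) c {a<..a + b} = sf (a + b + c - a) / sf (a + b + c - a - b) * (sf (a + b + c + a + b) / sf (a + b + c + a))"
    by (rule K_interval_sf) simp
  moreover have "a + b + c - a = b + c" "b + c - b = c" "a + b + c + a + b = c + a + a + b + b" "a + b + c + a = b + c + a + a"
    "b + c + a + a + b = c + a + a + b + b" by simp_all
  ultimately show ?thesis by simp
qed

theorem H3_two_fern:
  "M_H3 x y z [a, b] =
          P_num y (y + 2 * a) b * P_num (z + b) (z + b) a * Q_num [a, b, x, y + z]
            / P_num (y + z + b) (y + z + b) a
          * ((T_prod (real (x + b + 1)) (int y + int a - 1) a
              * T_prod (real (x + z + a + b + 1)) (int y + int a - 1) a
              * T_prod (real (2 * a + b + 1)) (int y + int b - 1) b
              * T_prod (real (z + 1)) (int y + int b - 1) b)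
            / (T_prod (real (b + 1)) (int y + int a - 1) a
              * T_prod (real (z + a + b + 1)) (int y + int a - 1) a
              * T_prod (real (x + 2 * a + b + 1)) (int y + int b - 1) b
              * T_prod (real (x + z + 1)) (int y + int b - 1) b))"
proof -
  define n where "n = a + b"
  let ?A = "{1..a}" and ?B = "{a<..a + b}"
  let ?U = "{n + x + z<..n + x + y}" and ?L = "{n + x + y<..n + x + z}"
  let ?Y = "{n<..n + y}" and ?Z = "{n<..n + z}" and ?K0 = "{n<..n + (y + z)}" and ?Kx = "{n + x<..n + x + (y + z)}"
  let ?S = "racah_selberg n (n + x + min y z) (n + x + max y z) (min y z)"
  let ?c = "trap_const (y + a)" and ?d = "trap_const (z + b)" and ?e = "trap_const (y + z + b)"
  have AB: "?A \<union> ?B = {1..n}" "?A \<inter> ?B = {}" unfolding n_def by auto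
  have sub: "?A \<subseteq> {1..n}" "?B \<subseteq> {1..n}" using AB(1) by auto
  have nz: "V S \<noteq> 0" if "S \<subseteq> {1..}" for S using V_pos[OF that] by simp
  have c: "trap_const k \<noteq> 0" for k by (simp add: trap_const_def)
  have KAB: "K n s {1..n} = K n s ?A * K n s ?B" for s using K_Un[OF _ _ AB(2), of n s] AB(1) by simp
  define T where "T = (T_prod (real (x + b + 1)) (int y + int a - 1) a
              * T_prod (real (x + z + a + b + 1)) (int y + int a - 1) a
              * T_prod (real (2 * a + b + 1)) (int y + int b - 1) b
              * T_prod (real (z + 1)) (int y + int b - 1) b)
            / (T_prod (real (b + 1)) (int y + int a - 1) a
              * T_prod (real (z + a + b + 1)) (int y + int a - 1) a
              * T_prod (real (x + 2 * a + b + 1)) (int y + int b - 1) b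
              * T_prod (real (x + z + 1)) (int y + int b - 1) b)"
  let ?\<kappa> = "if z \<le> y then 1 else K n (x + z) {1..n} / K n (x + y) {1..n}"
  \<comment> \<open>what remains of the claim after cancelling the dent products of the two segments\<close>
  have key: "V ?U * V ?L * ?\<kappa> * (K n (x + y) ?A / K n (x + z) ?A) * ?S * V ?K0 =
     V ?Y * V ?Z * V ?Kx * (K n z {1..n} / K n 0 {1..n} * (K n y ?A / K n z ?A)) *
      (K n (x + (y + z)) ?B / K n x ?B * (K n 0 ?B / K n (y + z) ?B)) * T"
  proof (cases "z \<le> y")
    case True
    then obtain d where d: "y = z + d" using le_Suc_ex by blast
    have i: "min y z = z" "n + x + max y z = n + x + z + d" "n + x + y = n + x + z + d" "n + x + z + d + z = n + x + (2 * z + d)"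
      "y + z = 2 * z + d" using d by auto
    have L: "?L = {}" using True by auto
    have V1: "V {} = 1" by (simp add: V_def)
    have "V ?U * V ?L * ?\<kappa> * (K n (x + y) ?A / K n (x + z) ?A) * ?S * V ?K0 =
      (racah_selberg n (n + x + z) (n + x + z + d) z * V {n + x + z<..n + x + z + d} * V {n<..n + (2 * z + d)}) * (K n (x + y) ?A / K n (x + z) ?A)"
      unfolding i L by (simp add: True V1 mult_ac)
    also have "\<dots> = V ?Y * V ?Z * V ?Kx * (K n z {1..n} / K n 0 {1..n} * (K n y ?A / K n z ?A)) *
      (K n (x + (y + z)) ?B / K n x ?B * (K n 0 ?B / K n (y + z) ?B)) * T"
    proof -
      let ?F = "sf (2 * n + z) * sf (2 * n + z + d) * sf n * sf (n + 2 * z + d) * sf (x + n + z) * sf (n + x + z + d) * sf x * sf (2 * n + x + 2 * z + d) /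
         (sf (2 * n + 2 * z + d) * sf (2 * n) * sf (n + z) * sf (n + z + d) * sf (x + n) * sf (n + x + 2 * z + d) * sf (x + z) * sf (2 * n + x + z + d))"
      and ?R = "(K n (x + y) ?A / K n (x + z) ?A)"
      \<comment> \<open>both sides are products of superfactorials, and the factors agree up to order\<close>
      have F: "?F * ?R =
         K n z {1..n} / K n 0 {1..n} * (K n y ?A / K n z ?A) * (K n (x + (y + z)) ?B / K n x ?B * (K n 0 ?B / K n (y + z) ?B)) * T"
        unfolding T_def T_prod_sf KAB unfolding n_def K_first K_second d mult_2
          times_divide_eq_left times_divide_eq_right divide_divide_eq_left divide_divide_eq_right
        by (rule frac_eq_eq[THEN iffD2], simp, simp, simp only: add_0_right add_0_left ac_simps)
      have e: "n + (z + d) = n + y" "n + (2 * z + d) = n + (y + z)" "n + x + (2 * z + d) = n + x + (y + z)"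
        using d by simp_all
      have "racah_selberg n (n + x + z) (n + x + z + d) z * V {n + x + z<..n + x + z + d} * V {n<..n + (2 * z + d)} * ?R =
        V {n<..n + y} * V {n<..n + z} * V ?Kx * (?F * ?R)"
        unfolding racah_selberg_V unfolding e by (simp only: mult.assoc)
      then show ?thesis unfolding F by (simp only: mult_ac)
    qed
    finally show ?thesis .
  next
    case False
    then obtain d where d: "z = y + d" using le_Suc_ex[of y z] by auto
    have i: "min y z = y" "n + x + max y z = n + x + y + d" "n + x + z = n + x + y + d"
      "y + z = 2 * y + d" using d by auto
    have U: "?U = {}" using False by auto
    have V1: "V {} = 1" by (simp add: V_def)
    have "V ?U * V ?L * ?\<kappa> * (K n (x + y) ?A / K n (x + z) ?A) * ?S * V ?K0 =
      (racah_selberg n (n + x + y) (n + x + y + d) y * V {n + x + y<..n + x + y + d} * V {n<..n + (2 * y + d)}) *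
        (K n (x + z) {1..n} / K n (x + y) {1..n} * (K n (x + y) ?A / K n (x + z) ?A))"
      unfolding i U by (simp add: False V1 mult_ac)
    also have "\<dots> = V ?Y * V ?Z * V ?Kx * (K n z {1..n} / K n 0 {1..n} * (K n y ?A / K n z ?A)) *
      (K n (x + (y + z)) ?B / K n x ?B * (K n 0 ?B / K n (y + z) ?B)) * T"
    proof -
      let ?F = "sf (2 * n + y) * sf (2 * n + y + d) * sf n * sf (n + 2 * y + d) * sf (x + n + y) * sf (n + x + y + d) * sf x * sf (2 * n + x + 2 * y + d) /
         (sf (2 * n + 2 * y + d) * sf (2 * n) * sf (n + y) * sf (n + y + d) * sf (x + n) * sf (n + x + 2 * y + d) * sf (x + y) * sf (2 * n + x + y + d))"
      and ?R = "(K n (x + z) {1..n} / K n (x + y) {1..n} * (K n (x + y) ?A / K n (x + z) ?A))"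
      \<comment> \<open>both sides are products of superfactorials, and the factors agree up to order\<close>
      have F: "?F * ?R =
         K n z {1..n} / K n 0 {1..n} * (K n y ?A / K n z ?A) * (K n (x + (y + z)) ?B / K n x ?B * (K n 0 ?B / K n (y + z) ?B)) * T"
        unfolding T_def T_prod_sf KAB unfolding n_def K_first K_second d mult_2
          times_divide_eq_left times_divide_eq_right divide_divide_eq_left divide_divide_eq_right
        by (rule frac_eq_eq[THEN iffD2], simp, simp, simp only: add_0_right add_0_left ac_simps)
      have e: "n + (y + d) = n + z" "n + (2 * y + d) = n + (y + z)" "n + x + (2 * y + d) = n + x + (y + z)"
        using d by simp_all
      have "racah_selberg n (n + x + y) (n + x + y + d) y * V {n + x + y<..n + x + y + d} * V {n<..n + (2 * y + d)} * ?R =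
        V {n<..n + z} * V {n<..n + y} * V ?Kx * (?F * ?R)"
        unfolding racah_selberg_V unfolding e by (simp only: mult.assoc)
      then show ?thesis unfolding F by (simp only: mult_ac)
    qed
    finally show ?thesis .
  qed
  have M: "M_H3 x y z [a, b] = 2 ^ a * (?c * ?d * (V (?A \<union> ?U) * V (?B \<union> ?L)) * ?S)"
    using M_H3_racah_selberg[of x y z "[a, b]"] unfolding two_fern n_def[symmetric] by (simp add: n_def)
  have P1: "P_num y (y + 2 * a) b = 2 ^ a * (?c * V (?A \<union> ?Y))" unfolding n_def by (rule P_num_V)
  have "{a<..a + (z + b)} = ?B \<union> ?Z" "{a<..a + (y + z + b)} = ?B \<union> ?K0" unfolding n_def by auto
  then have P2: "P_num (z + b) (z + b) a = ?d * V (?B \<union> ?Z)" and P3: "P_num (y + z + b) (y + z + b) a = ?e * V (?B \<union> ?K0)"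
    using P_num_equal_V[of "z + b" a] P_num_equal_V[of "y + z + b" a] by simp_all
  have Q: "Q_num [a, b, x, y + z] = ?e * V (?B \<union> ?Kx)"
  proof -
    have "{1..length [a, b, x, y + z]} = {1, 2, 3, 4}" by auto
    then have i: "{i \<in> {1..length [a, b, x, y + z]}. even i} = {2, 4}" by auto
    have s: "s_sum 1 [a, b, x, y + z] = a" "s_sum 3 [a, b, x, y + z] = a + b + x"
      by (simp_all add: s_sum_def entry_def numeral_3_eq_3)
    have f: "fern [a, b, x, y + z] even = ?B \<union> ?Kx"
      unfolding fern_def i fern_block_def n_def using s by (simp add: entry_def numeral_3_eq_3)
    have "card (?B \<union> ?Kx) = y + z + b" unfolding n_def by (subst card_Un_disjoint) auto
    then show ?thesis unfolding Q_num_V f by simp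
  qed
  have VB: "V (?B \<union> {n + s<..n + s + r}) = V ?B * V {n + s<..n + s + r} * (K n (s + r) ?B / K n s ?B)" for s r
  proof -
    have "V (?B \<union> {n + s<..n + s + r}) = V ?B * V {n + s<..n + s + r} * link ?B {n + s<..n + s + r}"
      by (rule V_Un) (auto simp: n_def)
    then show ?thesis using link_interval[OF sub(2), of s "s + r"] by (simp add: add.assoc)
  qed
  have R: "V (?B \<union> ?Kx) / V (?B \<union> ?K0) = V ?Kx / V ?K0 * (K n (x + (y + z)) ?B / K n x ?B * (K n 0 ?B / K n (y + z) ?B))"
  proof -
    have "V ?B \<noteq> 0" by (rule nz) auto
    then show ?thesis using VB[of x "y + z"] VB[of 0 "y + z"] by simp
  qed
  have k0: "V ?K0 \<noteq> 0" by (rule nz) auto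
  have "V (?A \<union> ?U) * V (?B \<union> ?L) * ?S =
    V ?A * V ?B / V ?K0 * (V ?U * V ?L * ?\<kappa> * (K n (x + y) ?A / K n (x + z) ?A) * ?S * V ?K0)"
    unfolding V_extension[OF AB] link_extension[OF AB] using k0 by simp
  also have "\<dots> = V (?A \<union> ?Y) * V (?B \<union> ?Z) * (V (?B \<union> ?Kx) / V (?B \<union> ?K0)) * T"
    unfolding key V_adjacent[OF AB] R by (simp add: mult_ac)
  finally have main: "V (?A \<union> ?U) * V (?B \<union> ?L) * ?S = V (?A \<union> ?Y) * V (?B \<union> ?Z) * (V (?B \<union> ?Kx) / V (?B \<union> ?K0)) * T" .
  have "M_H3 x y z [a, b] = 2 ^ a * ?c * ?d * (V (?A \<union> ?U) * V (?B \<union> ?L) * ?S)" unfolding M by (simp only: mult_ac)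
  also have "\<dots> = P_num y (y + 2 * a) b * P_num (z + b) (z + b) a * Q_num [a, b, x, y + z] / P_num (y + z + b) (y + z + b) a * T"
    unfolding main P1 P2 P3 Q using c[of "y + z + b"] by simp
  finally show ?thesis unfolding T_def .
qed

theorem theorem2p4:
  fixes x y z :: nat
  shows
    "(\<forall>a b :: nat.
        M_H3 x y z [a, b] =
          P_num y (y + 2 * a) b * P_num (z + b) (z + b) a * Q_num [a, b, x, y + z]
            / P_num (y + z + b) (y + z + b) a
          * ((T_prod (real (x + b + 1)) (int y + int a - 1) a
              * T_prod (real (x + z + a + b + 1)) (int y + int a - 1) a
              * T_prod (real (2 * a + b + 1)) (int y + int b - 1) b
              * T_prod (real (z + 1)) (int y + int b - 1) b)
            / (T_prod (real (b + 1)) (int y + int a - 1) a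
              * T_prod (real (z + a + b + 1)) (int y + int a - 1) a
              * T_prod (real (x + 2 * a + b + 1)) (int y + int b - 1) b
              * T_prod (real (x + z + 1)) (int y + int b - 1) b)))
     \<and>
     (\<forall>k \<ge> 2. \<forall>a :: nat list. length a = 2 * k \<longrightarrow>
        (let Od = odd_sum a; Ev = even_sum a in
          M_H3 x y z a =
            2 ^ entry a 1 * M_H3 x y z [Od, Ev]
            * (Q_num (0 # a @ [y]) * Q_num (butlast a @ [last a + z])
               / (P_num y (y + 2 * Od) Ev * P_num (z + Ev) (z + Ev) Od))
            * (\<Prod>i=2..k.
                 let e = e_sum i a; \<sigma> = sigma a i; T = T_seq a i in
                 (T (x + z + e + 1) * T (y + e + 1)) / (T (x + y + e + 1) * T (z + e + 1))
                 * ((T (x + y + \<sigma> + 1) * T (z + \<sigma> + 1))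
                    / (T (x + z + \<sigma> + 1) * T (y + \<sigma> + 1))))))"
proof (intro conjI allI impI)
  fix k :: nat and a :: "nat list"
  assume "2 \<le> k" "length a = 2 * k"
  then show "let Od = odd_sum a; Ev = even_sum a in
          M_H3 x y z a =
            2 ^ entry a 1 * M_H3 x y z [Od, Ev]
            * (Q_num (0 # a @ [y]) * Q_num (butlast a @ [last a + z])
               / (P_num y (y + 2 * Od) Ev * P_num (z + Ev) (z + Ev) Od))
            * (\<Prod>i=2..k.
                 let e = e_sum i a; \<sigma> = sigma a i; T = T_seq a i in
                 (T (x + z + e + 1) * T (y + e + 1)) / (T (x + y + e + 1) * T (z + e + 1))
                 * ((T (x + y + \<sigma> + 1) * T (z + \<sigma> + 1))
                    / (T (x + z + \<sigma> + 1) * T (y + \<sigma> + 1))))"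
    unfolding Let_def by (intro H3_ratio) simp_all
qed (rule H3_two_fern)

end
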